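(* Let $L$ be a slowly varying function at $\infty$ and let $\mu$ be a probability measure on $\mathbb{Z}_{\ge 0}$ with mean $\sum_{i\ge 0} i\mu(i)=1$ and $\mu(n)\sim L(n)/n^2$ as $n\to\infty$. For $n$ large, let $\mathcal{T}_n$ be a $\mathrm{BGW}_\mu$ tree conditioned on having exactly $n$ vertices, and let $\mathsf{W}(\mathcal{T}_n)$ be its Łukasiewicz path. Then $$\left(\frac{\mathsf{W}_{\lfloor nt\rfloor}(\mathcal{T}_n)}{|b_n|}:-1\le t\le1\right)\ \longrightarrow\ \left((1-t)\mathbf{1}_{t\ge0}:-1\le t\le1\right)$$ in distribution in $\mathbb{D}([-1,1],\mathbb{R})$ as $n\to\infty$.
   Context: A plane tree $\tau$ is a rooted ordered tree; $k_v(\tau)$ denotes the number of children of the vertex $v$ and $|\tau|$ the number of vertices. A $\mathrm{BGW}_\mu$ tree is a random plane tree with law $\mathrm{BGW}_\mu(\tau)=\prod_{u\in\tau}\mu(k_u(\tau))$ for every finite plane tree $\tau$. Łukasiewicz path: if $u_0\prec u_1\prec\cdots\prec u_{|\tau|-1}$ are the vertices of $\tau$ in lexicographical (depth-first) order, then $\mathsf{W}_0(\tau)=0$ and $\mathsf{W}_{i+1}(\tau)=\mathsf{W}_i(\tau)+k_{u_i}(\tau)-1$ for $0\le i<|\tau|$; moreover $\mathsf{W}_i(\tau)=0$ for $i>|\tau|$ or $i<0$. Scaling constants: let $X$ have law $\mathbb{P}(X=i)=\mu(i+1)$, $i\ge -1$. $(a_n)_{n\ge1}$ and $(b_n)_{n\ge1}$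 are sequences such that $n\,\mathbb{P}(X\ge a_n)\to 1$ and $b_n=n\,\mathbb{E}[X\mathbf{1}_{|X|\le a_n}]$ (one has $b_n\to-\infty$). $\mathbb{D}(I,\mathbb{R})$ is the space of real-valued càdlàg functions on the interval $I$ equipped with the Skorokhod $J_1$ topology. *)

theory Defs
  imports "HOL-Probability.Probability" "HOL-Library.Landau_Symbols" "HOL-Library.List_Lexorder"
begin

section \<open>Plane trees\<close>

datatype plane_tree = Node (subtrees: "plane_tree list")

text \<open>
  Vertices are addressed by words of natural numbers: the root is the empty word, and the word
  \<open>v @ [i]\<close> addresses the child with index \<open>i\<close> (counted from 0, from left to right) of \<open>v\<close>.
\<close>

primrec subtree_at :: "nat list \<Rightarrow> plane_tree \<Rightarrow> plane_tree option" where
  "subtree_at [] \<tau> = Some \<tau>"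
| "subtree_at (i # v) \<tau> =
     (if i < length (subtrees \<tau>) then subtree_at v (subtrees \<tau> ! i) else None)"

definition vertices :: "plane_tree \<Rightarrow> nat list set" where
  "vertices \<tau> = {v. subtree_at v \<tau> \<noteq> None}"

definition num_vertices :: "plane_tree \<Rightarrow> nat" where
  "num_vertices \<tau> = card (vertices \<tau>)"

definition num_children :: "plane_tree \<Rightarrow> nat list \<Rightarrow> nat" where
  "num_children \<tau> v = length (subtrees (the (subtree_at v \<tau>)))"

text \<open>
  The order on \<^typ>\<open>nat list\<close> is the lexicographic one (a proper prefix comes first), so that
  \<open>dfs_vertex \<tau> i\<close> is the vertex \<open>u\<^sub>i\<close> of \<open>\<tau>\<close> in depth-first order.
\<close>

definition dfs_vertex :: "plane_tree \<Rightarrow> nat \<Rightarrow> nat list" where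
  "dfs_vertex \<tau> i = sorted_list_of_set (vertices \<tau>) ! i"

primrec luk_nat :: "plane_tree \<Rightarrow> nat \<Rightarrow> int" where
  "luk_nat \<tau> 0 = 0"
| "luk_nat \<tau> (Suc i) =
     (if i < num_vertices \<tau>
      then luk_nat \<tau> i + int (num_children \<tau> (dfs_vertex \<tau> i)) - 1
      else 0)"

definition luk :: "plane_tree \<Rightarrow> int \<Rightarrow> int" where
  "luk \<tau> i = (if i < 0 then 0 else luk_nat \<tau> (nat i))"

function preorder :: "plane_tree \<Rightarrow> nat list list" where
  "preorder (Node ts) =
     [] # concat (map (\<lambda>i. map (Cons i) (preorder (ts ! i))) [0..<length ts])"
  by pat_completeness auto
termination
proof (relation "Wellfounded.measure size")
  fix ts :: "plane_tree list" and i
  assume "i \<in> set [0..<length ts]"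
  then have "size (ts ! i) \<le> size_list size ts"
    by (intro size_list_estimation'[of "ts ! i"]) auto
  then show "(ts ! i, Node ts) \<in> Wellfounded.measure size" by simp
qed simp

declare preorder.simps [simp]

lemma vertices_Node:
  "vertices (Node ts) = insert [] (\<Union>i<length ts. Cons i ` vertices (ts ! i))"
proof -
  have "v \<in> vertices (Node ts) \<longleftrightarrow> v \<in> insert [] (\<Union>i<length ts. Cons i ` vertices (ts ! i))" for v
    by (cases v) (auto simp: vertices_def)
  then show ?thesis by blast
qed

lemma set_preorder: "set (preorder \<tau>) = vertices \<tau>"
proof (induction \<tau> rule: preorder.induct)
  case (1 ts)
  then show ?case by (auto simp: vertices_Node)
qed

lemma sorted_wrt_concat_Cons:
  fixes f :: "nat \<Rightarrow> nat list list"
  assumes "\<And>i. i < n \<Longrightarrow> sorted_wrt (<) (f i)"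
  shows "sorted_wrt (<) (concat (map (\<lambda>i. map (Cons i) (f i)) [0..<n]))"
  using assms
proof (induction n)
  case (Suc n)
  then show ?case by (auto simp: sorted_wrt_append sorted_wrt_map)
qed simp

lemma sorted_preorder: "sorted_wrt (<) (preorder \<tau>)"
proof (induction \<tau> rule: preorder.induct)
  case (1 ts)
  then show ?case by (auto intro!: sorted_wrt_concat_Cons)
qed

lemma finite_vertices: "finite (vertices \<tau>)"
  using set_preorder[of \<tau>] by (metis List.finite_set)

lemma sorted_list_of_vertices: "sorted_list_of_set (vertices \<tau>) = preorder \<tau>"
  using sorted_preorder[of \<tau>] set_preorder[of \<tau>]
  by (metis sorted_list_of_set.idem_if_sorted_distinct strict_sorted_iff)


section \<open>Conditioned Bienayme-Galton-Watson trees\<close>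

definition bgw :: "nat pmf \<Rightarrow> plane_tree measure" where
  "bgw \<mu> = density (count_space UNIV)
     (\<lambda>\<tau>. ennreal (\<Prod>u\<in>vertices \<tau>. pmf \<mu> (num_children \<tau> u)))"

text \<open>
  \<^const>\<open>uniform_measure\<close> is the library's conditional law.
  It is meaningful only if the conditioning event has positive probability.
\<close>

definition bgw_cond :: "nat pmf \<Rightarrow> nat \<Rightarrow> plane_tree measure" where
  "bgw_cond \<mu> n = uniform_measure (bgw \<mu>) {\<tau>. num_vertices \<tau> = n}"

definition step_pmf :: "nat pmf \<Rightarrow> int pmf" where
  "step_pmf \<mu> = map_pmf (\<lambda>k. int k - 1) \<mu>"


section \<open>Slowly varying functions\<close>

definition slowly_varying :: "(real \<Rightarrow> real) \<Rightarrow> bool" where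
  "slowly_varying L \<longleftrightarrow>
     (\<exists>A. L \<in> borel_measurable (restrict_space borel {A..}) \<and> (\<forall>x\<ge>A. L x > 0)) \<and>
     (\<forall>c>0. ((\<lambda>x. L (c * x) / L x) \<longlongrightarrow> 1) at_top)"


section \<open>The Skorokhod space on a compact interval\<close>

text \<open>
  Functions on \<open>{a..b}\<close> are represented by extensional functions, so that equality of the
  representatives is equality on \<open>{a..b}\<close>.
\<close>

definition cadlag :: "real \<Rightarrow> real \<Rightarrow> (real \<Rightarrow> real) set" where
  "cadlag a b = {f \<in> extensional {a..b}.
     (\<forall>t\<in>{a..<b}. (f \<longlongrightarrow> f t) (at_right t)) \<and>
     (\<forall>t\<in>{a<..b}. \<exists>l. (f \<longlongrightarrow> l) (at_left t))}"

definition time_changes :: "real \<Rightarrow> real \<Rightarrow> (real \<Rightarrow> real) set" where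
  "time_changes a b = {l. strict_mono_on {a..b} l \<and> continuous_on {a..b} l \<and>
     l ` {a..b} = {a..b}}"

text \<open>
  The value 0 off the space is irrelevant; it makes the function total and non-negative, as
  the locale \<^locale>\<open>Metric_space\<close> requires.
\<close>

definition skorokhod_dist :: "real \<Rightarrow> real \<Rightarrow> (real \<Rightarrow> real) \<Rightarrow> (real \<Rightarrow> real) \<Rightarrow> real" where
  "skorokhod_dist a b f g =
     (if f \<in> cadlag a b \<and> g \<in> cadlag a b
      then Inf {e. 0 < e \<and> (\<exists>l\<in>time_changes a b.
             \<forall>t\<in>{a..b}. \<bar>l t - t\<bar> \<le> e \<and> \<bar>f t - g (l t)\<bar> \<le> e)}
      else 0)"

definition skorokhod_J1 :: "real \<Rightarrow> real \<Rightarrow> (real \<Rightarrow> real) topology" where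
  "skorokhod_J1 a b = Metric_space.mtopology (cadlag a b) (skorokhod_dist a b)"

lemma cadlag_bounded:
  assumes f: "f \<in> cadlag a b" and ab: "a \<le> b"
  shows "\<exists>B. \<forall>t\<in>{a..b}. \<bar>f t\<bar> \<le> B"
proof -
  define P where "P = (\<lambda>u v. \<exists>B. \<forall>t\<in>{u..v} \<inter> {a..b}. \<bar>f t\<bar> \<le> B)"
  have "P a b" using ab
  proof (induction rule: Bolzano)
    case (trans u v w)
    then obtain B1 B2 where B: "\<forall>t\<in>{u..v} \<inter> {a..b}. \<bar>f t\<bar> \<le> B1"
      "\<forall>t\<in>{v..w} \<inter> {a..b}. \<bar>f t\<bar> \<le> B2" by (auto simp: P_def)
    have "\<bar>f t\<bar> \<le> max B1 B2" if t: "t \<in> {u..w} \<inter> {a..b}" for t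
    proof (cases "t \<le> v")
      case True
      then have "\<bar>f t\<bar> \<le> B1" using B(1) t by auto
      then show ?thesis by auto
    next
      case False
      then have "\<bar>f t\<bar> \<le> B2" using B(2) t by auto
      then show ?thesis by auto
    qed
    then show ?case unfolding P_def by blast
  next
    case (local x)
    have r: "\<exists>d>0. \<exists>B. \<forall>t. x < t \<and> t < x + d \<and> t \<le> b \<longrightarrow> \<bar>f t\<bar> \<le> B"
    proof (cases "x < b")
      case True
      then have "(f \<longlongrightarrow> f x) (at_right x)" using f local by (auto simp: cadlag_def)
      then have "\<forall>\<^sub>F t in at_right x. dist (f t) (f x) < 1" by (rule tendstoD) simp
      then obtain c where c: "c > x" "\<forall>t>x. t < c \<longrightarrow> dist (f t) (f x) < 1"
        by (auto simp: eventually_at_right_field)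
      have "\<forall>t. x < t \<and> t < x + (c - x) \<and> t \<le> b \<longrightarrow> \<bar>f t\<bar> \<le> \<bar>f x\<bar> + 1"
        using c by (force simp: dist_real_def)
      then show ?thesis using c(1) by (metis diff_gt_0_iff_gt)
    next
      case False
      then show ?thesis by (intro exI[of _ 1]) auto
    qed
    have l: "\<exists>d>0. \<exists>B. \<forall>t. x - d < t \<and> t < x \<and> a \<le> t \<longrightarrow> \<bar>f t\<bar> \<le> B"
    proof (cases "a < x")
      case True
      then have "x \<in> {a<..b}" using local by auto
      then obtain m where "(f \<longlongrightarrow> m) (at_left x)" using f unfolding cadlag_def by blast
      then have "\<forall>\<^sub>F t in at_left x. dist (f t) m < 1" by (rule tendstoD) simp
      then obtain c where c: "c < x" "\<forall>t>c. t < x \<longrightarrow> dist (f t) m < 1"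
        by (auto simp: eventually_at_left_field)
      have "\<forall>t. x - (x - c) < t \<and> t < x \<and> a \<le> t \<longrightarrow> \<bar>f t\<bar> \<le> \<bar>m\<bar> + 1"
        using c by (force simp: dist_real_def)
      then show ?thesis using c(1) by (metis diff_gt_0_iff_gt)
    next
      case False
      then show ?thesis by (intro exI[of _ 1]) auto
    qed
    obtain d1 B1 where 1: "d1 > 0" "\<And>t. x < t \<Longrightarrow> t < x + d1 \<Longrightarrow> t \<le> b \<Longrightarrow> \<bar>f t\<bar> \<le> B1"
      using r by blast
    obtain d2 B2 where 2: "d2 > 0" "\<And>t. x - d2 < t \<Longrightarrow> t < x \<Longrightarrow> a \<le> t \<Longrightarrow> \<bar>f t\<bar> \<le> B2"
      using l by blast
    show ?case
    proof (intro exI[of _ "min d1 d2"] conjI allI impI)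
      show "min d1 d2 > 0" using 1 2 by simp
      fix u v assume uv: "u \<le> x \<and> x \<le> v \<and> v - u < min d1 d2"
      have "\<bar>f t\<bar> \<le> max \<bar>f x\<bar> (max B1 B2)" if t: "t \<in> {u..v} \<inter> {a..b}" for t
      proof (rule linorder_cases[of t x])
        assume "t < x" then have "\<bar>f t\<bar> \<le> B2" using t uv by (intro 2) auto
        then show ?thesis by auto
      next
        assume "x < t" then have "\<bar>f t\<bar> \<le> B1" using t uv by (intro 1) auto
        then show ?thesis by auto
      qed auto
      then show "P u v" unfolding P_def by blast
    qed
  qed
  then show ?thesis by (auto simp: P_def)
qed

lemma time_changes_id: "(\<lambda>t. t) \<in> time_changes a b"
  by (auto simp: time_changes_def strict_mono_on_def)

lemma time_changes_comp:
  assumes "l \<in> time_changes a b" "m \<in> time_changes a b"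
  shows "(\<lambda>t. m (l t)) \<in> time_changes a b"
proof -
  have "continuous_on {a..b} (m \<circ> l)"
    using assms by (intro continuous_on_compose) (auto simp: time_changes_def)
  moreover have "(\<lambda>t. m (l t)) ` {a..b} = m ` (l ` {a..b})" by (simp add: image_image)
  moreover have "l t \<in> {a..b}" if "t \<in> {a..b}" for t
    using assms(1) that by (auto simp: time_changes_def)
  ultimately show ?thesis
    using assms by (auto simp: time_changes_def strict_mono_on_def comp_def)
qed

lemma time_changes_inverse:
  assumes "l \<in> time_changes a b"
  obtains m where "m \<in> time_changes a b" "\<And>t. t \<in> {a..b} \<Longrightarrow> l (m t) = t"
    "\<And>t. t \<in> {a..b} \<Longrightarrow> m t \<in> {a..b}"
proof -
  have mono: "strict_mono_on {a..b} l" and cont: "continuous_on {a..b} l"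
    and im: "l ` {a..b} = {a..b}" using assms by (auto simp: time_changes_def)
  have inj: "inj_on l {a..b}" using mono by (rule strict_mono_on_imp_inj_on)
  define m where "m = the_inv_into {a..b} l"
  have lm: "l (m t) = t" if "t \<in> {a..b}" for t
    unfolding m_def using inj im that by (simp add: f_the_inv_into_f)
  have mI: "m t \<in> {a..b}" if "t \<in> {a..b}" for t
    unfolding m_def using the_inv_into_into[OF inj, of t "{a..b}"] im that by blast
  have ml: "m (l t) = t" if "t \<in> {a..b}" for t
    unfolding m_def using inj that by (simp add: the_inv_into_f_f)
  have "continuous_on (l ` {a..b}) m"
    using cont ml by (intro continuous_on_inv) auto
  moreover have "strict_mono_on {a..b} m"
  proof (rule strict_mono_onI)
    fix r s assume rs: "r \<in> {a..b}" "s \<in> {a..b}" "r < s"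
    show "m r < m s"
    proof (rule ccontr)
      assume "\<not> m r < m s"
      then have "m s < m r \<or> m s = m r" by auto
      then have "l (m s) \<le> l (m r)" using mono mI rs by (auto simp: strict_mono_on_def less_imp_le)
      then show False using lm rs by auto
    qed
  qed
  moreover have "m ` {a..b} = {a..b}"
  proof
    show "m ` {a..b} \<subseteq> {a..b}" using mI by blast
    show "{a..b} \<subseteq> m ` {a..b}"
    proof
      fix t assume t: "t \<in> {a..b}"
      then have "l t \<in> {a..b}" using im by blast
      then show "t \<in> m ` {a..b}" using ml[OF t] by (metis imageI)
    qed
  qed
  ultimately have "m \<in> time_changes a b" using im by (auto simp: time_changes_def)
  then show ?thesis using lm mI that by blast
qed

lemma time_changes_end:
  assumes "l \<in> time_changes a b" "a \<le> b"
  shows "l b = b"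
proof -
  have lI: "\<And>t. t \<in> {a..b} \<Longrightarrow> l t \<in> {a..b}" and mono: "strict_mono_on {a..b} l"
    and im: "l ` {a..b} = {a..b}" using assms by (auto simp: time_changes_def)
  obtain s where s: "s \<in> {a..b}" "l s = b" using im assms(2) by (metis atLeastAtMost_iff imageE order_refl)
  have "s = b"
  proof (rule ccontr)
    assume "s \<noteq> b"
    then have "l s < l b" using mono s assms(2) by (auto simp: strict_mono_on_def)
    then show False using s lI[of b] assms(2) by auto
  qed
  then show ?thesis using s by simp
qed

definition skorokhod_bounds :: "real \<Rightarrow> real \<Rightarrow> (real \<Rightarrow> real) \<Rightarrow> (real \<Rightarrow> real) \<Rightarrow> real set" where
  "skorokhod_bounds a b f g = {e. 0 < e \<and> (\<exists>l\<in>time_changes a b.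
     \<forall>t\<in>{a..b}. \<bar>l t - t\<bar> \<le> e \<and> \<bar>f t - g (l t)\<bar> \<le> e)}"

lemma skorokhod_bounds_nonempty:
  assumes "f \<in> cadlag a b" "g \<in> cadlag a b" "a \<le> b"
  shows "skorokhod_bounds a b f g \<noteq> {}"
proof -
  obtain B C where B: "\<forall>t\<in>{a..b}. \<bar>f t\<bar> \<le> B" "\<forall>t\<in>{a..b}. \<bar>g t\<bar> \<le> C"
    using cadlag_bounded assms by metis
  have "\<bar>f t - g t\<bar> \<le> \<bar>B\<bar> + \<bar>C\<bar> + 1" if "t \<in> {a..b}" for t
    using B that by (smt (verit, best))
  then have "\<bar>B\<bar> + \<bar>C\<bar> + 1 \<in> skorokhod_bounds a b f g"
    unfolding skorokhod_bounds_def by (auto intro!: bexI[OF _ time_changes_id])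
  then show ?thesis by blast
qed

lemma skorokhod_bounds_bdd: "bdd_below (skorokhod_bounds a b f g)"
  by (rule bdd_belowI[of _ 0]) (auto simp: skorokhod_bounds_def)

lemma skorokhod_bounds_sym_aux:
  assumes "e \<in> skorokhod_bounds a b f g"
  shows "e \<in> skorokhod_bounds a b g f"
proof -
  obtain l where l: "l \<in> time_changes a b" "0 < e"
    "\<forall>t\<in>{a..b}. \<bar>l t - t\<bar> \<le> e \<and> \<bar>f t - g (l t)\<bar> \<le> e"
    using assms by (auto simp: skorokhod_bounds_def)
  obtain m where m: "m \<in> time_changes a b" "\<And>t. t \<in> {a..b} \<Longrightarrow> l (m t) = t"
    "\<And>t. t \<in> {a..b} \<Longrightarrow> m t \<in> {a..b}" using time_changes_inverse[OF l(1)] by metis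
  have "\<bar>m t - t\<bar> \<le> e \<and> \<bar>g t - f (m t)\<bar> \<le> e" if "t \<in> {a..b}" for t
    using l(3) m(2,3)[OF that] by (metis abs_minus_commute)
  then show ?thesis using m(1) l(2) unfolding skorokhod_bounds_def by blast
qed

lemma skorokhod_bounds_sym: "skorokhod_bounds a b f g = skorokhod_bounds a b g f"
  using skorokhod_bounds_sym_aux by blast

lemma skorokhod_bounds_add:
  assumes "d \<in> skorokhod_bounds a b f g" "e \<in> skorokhod_bounds a b g h"
  shows "d + e \<in> skorokhod_bounds a b f h"
proof -
  obtain l where l: "l \<in> time_changes a b" "0 < d"
    "\<forall>t\<in>{a..b}. \<bar>l t - t\<bar> \<le> d \<and> \<bar>f t - g (l t)\<bar> \<le> d"
    using assms(1) by (auto simp: skorokhod_bounds_def)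
  obtain m where m: "m \<in> time_changes a b" "0 < e"
    "\<forall>t\<in>{a..b}. \<bar>m t - t\<bar> \<le> e \<and> \<bar>g t - h (m t)\<bar> \<le> e"
    using assms(2) by (auto simp: skorokhod_bounds_def)
  have "\<bar>m (l t) - t\<bar> \<le> d + e \<and> \<bar>f t - h (m (l t))\<bar> \<le> d + e" if t: "t \<in> {a..b}" for t
  proof -
    have "l t \<in> {a..b}" using l(1) t by (auto simp: time_changes_def)
    then have "\<bar>m (l t) - l t\<bar> \<le> e" "\<bar>g (l t) - h (m (l t))\<bar> \<le> e" using m(3) by auto
    moreover have "\<bar>l t - t\<bar> \<le> d" "\<bar>f t - g (l t)\<bar> \<le> d" using l(3) t by auto
    ultimately show ?thesis by linarith
  qed
  then show ?thesis using time_changes_comp[OF l(1) m(1)] l(2) m(2)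
    unfolding skorokhod_bounds_def by (auto intro!: bexI[of _ "\<lambda>t. m (l t)"])
qed

lemma skorokhod_dist_eq:
  "f \<in> cadlag a b \<Longrightarrow> g \<in> cadlag a b \<Longrightarrow> skorokhod_dist a b f g = Inf (skorokhod_bounds a b f g)"
  by (simp add: skorokhod_dist_def skorokhod_bounds_def)

lemma skorokhod_separation:
  assumes f: "f \<in> cadlag a b" and g: "g \<in> cadlag a b" and "a \<le> b"
    and small: "\<And>e. e > 0 \<Longrightarrow> \<exists>e'\<in>skorokhod_bounds a b f g. e' < e"
  shows "f = g"
proof (rule extensionalityI[of _ "{a..b}"])
  show "f \<in> extensional {a..b}" "g \<in> extensional {a..b}" using f g by (auto simp: cadlag_def)
  fix t assume t: "t \<in> {a..b}"
  have ex: "\<exists>l\<in>time_changes a b. \<forall>t\<in>{a..b}. \<bar>l t - t\<bar> < e \<and> \<bar>f t - g (l t)\<bar> < e" if "e > 0" for e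
  proof -
    obtain e' l where *: "e' < e" "l \<in> time_changes a b"
      "\<forall>t\<in>{a..b}. \<bar>l t - t\<bar> \<le> e' \<and> \<bar>f t - g (l t)\<bar> \<le> e'"
      using small[OF \<open>e > 0\<close>] unfolding skorokhod_bounds_def by blast
    then show ?thesis by (intro bexI[of _ l]) (auto intro: le_less_trans)
  qed
  show "f t = g t"
  proof (cases "t = b")
    case True
    have "\<bar>f b - g b\<bar> < e" if "e > 0" for e
      using ex[OF that] time_changes_end[OF _ \<open>a \<le> b\<close>] \<open>a \<le> b\<close> by (metis atLeastAtMost_iff order_refl)
    then have "\<bar>f b - g b\<bar> = 0" by (metis abs_ge_zero less_irrefl order_le_less)
    then show ?thesis using True by simp
  next
    case False
    then have tb: "t < b" using t by auto
    have "(f \<longlongrightarrow> g t) (at_right t)"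
    proof (rule tendstoI)
      fix e :: real assume e: "e > 0"
      have "(g \<longlongrightarrow> g t) (at_right t)" using g t tb by (auto simp: cadlag_def)
      then have "\<forall>\<^sub>F s in at_right t. dist (g s) (g t) < e/2" by (rule tendstoD) (use e in simp)
      then obtain c where c: "c > t" "\<forall>s>t. s < c \<longrightarrow> dist (g s) (g t) < e/2"
        by (auto simp: eventually_at_right_field)
      have "dist (f s) (g t) < e" if s: "t < s" "s < min c b" for s
      proof -
        define r where "r = min (e/2) (min (s - t) (c - s))"
        have "r > 0" using e s by (simp add: r_def)
        then obtain l where l: "\<bar>l s - s\<bar> < r" "\<bar>f s - g (l s)\<bar> < r"
          using ex[of r] s t by fastforce
        have "t < l s" "l s < c" using l(1) by (auto simp: r_def)
        then have "dist (g (l s)) (g t) < e/2" using c by auto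
        moreover have "\<bar>f s - g (l s)\<bar> < e/2" using l(2) by (auto simp: r_def)
        ultimately show ?thesis unfolding dist_real_def by linarith
      qed
      moreover have "min c b > t" using c tb by simp
      ultimately show "\<forall>\<^sub>F s in at_right t. dist (f s) (g t) < e"
        unfolding eventually_at_right_field by blast
    qed
    moreover have "(f \<longlongrightarrow> f t) (at_right t)" using f t tb by (auto simp: cadlag_def)
    ultimately show ?thesis
      using tendsto_unique[of "at_right t" f] by (simp add: trivial_limit_at_right_real)
  qed
qed

lemma Metric_space_skorokhod:
  assumes ab: "a \<le> b"
  shows "Metric_space (cadlag a b) (skorokhod_dist a b)"
proof
  fix f g h
  show nonneg: "0 \<le> skorokhod_dist a b f g"
  proof (cases "f \<in> cadlag a b \<and> g \<in> cadlag a b")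
    case True
    then show ?thesis using skorokhod_bounds_nonempty[of f a b g] ab
      by (auto simp: skorokhod_dist_eq skorokhod_bounds_def intro!: cInf_greatest)
  qed (auto simp: skorokhod_dist_def)
  show "skorokhod_dist a b f g = skorokhod_dist a b g f"
    by (cases "f \<in> cadlag a b \<and> g \<in> cadlag a b")
       (simp add: skorokhod_dist_eq skorokhod_bounds_sym[of a b f g], auto simp: skorokhod_dist_def)
  {
    assume fg: "f \<in> cadlag a b" "g \<in> cadlag a b"
    show "skorokhod_dist a b f g = 0 \<longleftrightarrow> f = g"
    proof
      assume 0: "skorokhod_dist a b f g = 0"
      show "f = g"
      proof (rule skorokhod_separation[OF fg ab])
        fix e :: real assume "e > 0"
        then have "Inf (skorokhod_bounds a b f g) < e" using 0 fg by (simp add: skorokhod_dist_eq)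
        then show "\<exists>e'\<in>skorokhod_bounds a b f g. e' < e"
          using cInf_lessD[OF skorokhod_bounds_nonempty[OF fg ab]] by blast
      qed
    next
      assume "f = g"
      have "skorokhod_dist a b f f \<le> e" if "e > 0" for e
      proof -
        have "e \<in> skorokhod_bounds a b f f"
          unfolding skorokhod_bounds_def using that by (auto intro!: bexI[OF _ time_changes_id])
        then show ?thesis using fg by (simp add: skorokhod_dist_eq cInf_lower skorokhod_bounds_bdd)
      qed
      then show "skorokhod_dist a b f g = 0"
        using nonneg \<open>f = g\<close> field_le_epsilon[of "skorokhod_dist a b f f" 0] by simp
    qed
  }
  {
    assume fgh: "f \<in> cadlag a b" "g \<in> cadlag a b" "h \<in> cadlag a b"
    show "skorokhod_dist a b f h \<le> skorokhod_dist a b f g + skorokhod_dist a b g h"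
    proof (rule field_le_epsilon)
      fix e :: real assume e: "e > 0"
      obtain p where p: "p \<in> skorokhod_bounds a b f g" "p < skorokhod_dist a b f g + e/2"
        using cInf_lessD[OF skorokhod_bounds_nonempty[OF fgh(1,2) ab],
            of "skorokhod_dist a b f g + e/2"] e fgh by (auto simp: skorokhod_dist_eq)
      obtain q where q: "q \<in> skorokhod_bounds a b g h" "q < skorokhod_dist a b g h + e/2"
        using cInf_lessD[OF skorokhod_bounds_nonempty[OF fgh(2,3) ab],
            of "skorokhod_dist a b g h + e/2"] e fgh by (auto simp: skorokhod_dist_eq)
      have "skorokhod_dist a b f h \<le> p + q"
        using skorokhod_bounds_add[OF p(1) q(1)] fgh
        by (simp add: skorokhod_dist_eq cInf_lower skorokhod_bounds_bdd)
      then show "skorokhod_dist a b f h \<le> skorokhod_dist a b f g + skorokhod_dist a b g h + e"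
        using p q by linarith
    qed
  }
qed


section \<open>Convergence in distribution\<close>

definition borel_of_topology :: "'a topology \<Rightarrow> 'a measure" where
  "borel_of_topology X = sigma (topspace X) {U. openin X U}"

text \<open>Weak convergence of laws on the Borel sigma-algebra of the topological space \<open>X\<close>.\<close>

definition weak_conv_on :: "'a topology \<Rightarrow> (nat \<Rightarrow> 'a measure) \<Rightarrow> 'a measure \<Rightarrow> bool" where
  "weak_conv_on X P Q \<longleftrightarrow>
     (\<forall>F. continuous_map X euclideanreal F \<and> bounded (F ` topspace X) \<longrightarrow>
        (\<lambda>n. integral\<^sup>L (P n) F) \<longlonglongrightarrow> integral\<^sup>L Q F)"


section \<open>The rescaled Lukasiewicz path and its limit\<close>

definition luk_process :: "real \<Rightarrow> nat \<Rightarrow> plane_tree \<Rightarrow> real \<Rightarrow> real" where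
  "luk_process c n \<tau> = (\<lambda>t\<in>{-1..1}. real_of_int (luk \<tau> \<lfloor>real n * t\<rfloor>) / c)"

definition limit_process :: "real \<Rightarrow> real" where
  "limit_process = (\<lambda>t\<in>{-1..1}. (1 - t) * indicator {0..} t)"

lemma eventually_at_right_between:
  "x < (y::real) \<Longrightarrow> (\<And>s. x < s \<Longrightarrow> s < y \<Longrightarrow> P s) \<Longrightarrow> \<forall>\<^sub>F s in at_right x. P s"
  unfolding eventually_at_right_field by blast

lemma eventually_at_left_between:
  "y < (x::real) \<Longrightarrow> (\<And>s. y < s \<Longrightarrow> s < x \<Longrightarrow> P s) \<Longrightarrow> \<forall>\<^sub>F s in at_left x. P s"
  unfolding eventually_at_left_field by blast

lemma floor_path_cadlag:
  fixes h :: "int \<Rightarrow> real"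
  shows "(\<lambda>t\<in>{a..b}. h \<lfloor>real n * t\<rfloor>) \<in> cadlag a b"
proof (cases "n = 0")
  case True
  have "((\<lambda>t\<in>{a..b}. h 0) \<longlongrightarrow> h 0) (at_right t)" if "t \<in> {a..<b}" for t
    using that by (intro tendsto_eventually eventually_at_right_between[of t b]) auto
  moreover have "((\<lambda>t\<in>{a..b}. h 0) \<longlongrightarrow> h 0) (at_left t)" if "t \<in> {a<..b}" for t
    using that by (intro tendsto_eventually eventually_at_left_between[of a t]) auto
  ultimately show ?thesis using True by (fastforce simp: cadlag_def)
next
  case False
  then have n: "real n > 0" by simp
  have "((\<lambda>t\<in>{a..b}. h \<lfloor>real n * t\<rfloor>) \<longlongrightarrow> h \<lfloor>real n * t\<rfloor>) (at_right t)" if t: "t \<in> {a..<b}" for t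
  proof (rule tendsto_eventually,
      rule eventually_at_right_between[of t "min b ((of_int \<lfloor>real n * t\<rfloor> + 1) / real n)"])
    show "t < min b ((of_int \<lfloor>real n * t\<rfloor> + 1) / real n)"
      using t n by (simp add: pos_less_divide_eq mult.commute)
    fix s assume s: "t < s" "s < min b ((of_int \<lfloor>real n * t\<rfloor> + 1) / real n)"
    then have "real n * s < of_int \<lfloor>real n * t\<rfloor> + 1" "real n * t < real n * s"
      using n by (auto simp: pos_less_divide_eq mult.commute)
    then have "\<lfloor>real n * s\<rfloor> = \<lfloor>real n * t\<rfloor>" by linarith
    then show "(\<lambda>t\<in>{a..b}. h \<lfloor>real n * t\<rfloor>) s = h \<lfloor>real n * t\<rfloor>" using s t by auto
  qed
  moreover have "((\<lambda>t\<in>{a..b}. h \<lfloor>real n * t\<rfloor>) \<longlongrightarrow> h (\<lceil>real n * t\<rceil> - 1)) (at_left t)"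
    if t: "t \<in> {a<..b}" for t
  proof (rule tendsto_eventually,
      rule eventually_at_left_between[of "max a ((of_int \<lceil>real n * t\<rceil> - 1) / real n)"])
    show "max a ((of_int \<lceil>real n * t\<rceil> - 1) / real n) < t"
      using t n by (simp add: pos_divide_less_eq mult.commute) linarith
    fix s assume s: "max a ((of_int \<lceil>real n * t\<rceil> - 1) / real n) < s" "s < t"
    then have "of_int \<lceil>real n * t\<rceil> - 1 < real n * s" "real n * s < real n * t"
      using n by (auto simp: pos_divide_less_eq mult.commute)
    then have "\<lfloor>real n * s\<rfloor> = \<lceil>real n * t\<rceil> - 1" by linarith
    then show "(\<lambda>t\<in>{a..b}. h \<lfloor>real n * t\<rfloor>) s = h (\<lceil>real n * t\<rceil> - 1)" using s t by auto
  qed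
  ultimately show ?thesis by (fastforce simp: cadlag_def)
qed

lemma luk_process_cadlag: "luk_process c n \<tau> \<in> cadlag (-1) 1"
  unfolding luk_process_def by (rule floor_path_cadlag)

lemma limit_process_cadlag: "limit_process \<in> cadlag (-1) 1"
proof -
  have "(limit_process \<longlongrightarrow> limit_process t) (at_right t)" if t: "t \<in> {-1..<1}" for t
  proof (cases "t < 0")
    case True
    then show ?thesis using t
      by (intro tendsto_eventually eventually_at_right_between[of t 0]) (auto simp: limit_process_def)
  next
    case False
    have "((\<lambda>s. 1 - s) \<longlongrightarrow> 1 - t) (at_right t)" by (intro tendsto_intros)
    then have "(limit_process \<longlongrightarrow> 1 - t) (at_right t)"
      by (rule Lim_transform_eventually)
        (use t False in \<open>auto intro!: eventually_at_right_between[of t 1] simp: limit_process_def\<close>)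
    then show ?thesis using t False by (simp add: limit_process_def)
  qed
  moreover have "\<exists>l. (limit_process \<longlongrightarrow> l) (at_left t)" if t: "t \<in> {-1<..1}" for t
  proof (cases "t \<le> 0")
    case True
    then have "(limit_process \<longlongrightarrow> 0) (at_left t)" using t
      by (intro tendsto_eventually eventually_at_left_between[of "-1" t]) (auto simp: limit_process_def)
    then show ?thesis by blast
  next
    case False
    have "((\<lambda>s. 1 - s) \<longlongrightarrow> 1 - t) (at_left t)" by (intro tendsto_intros)
    then have "(limit_process \<longlongrightarrow> 1 - t) (at_left t)"
      by (rule Lim_transform_eventually)
        (use t False in \<open>auto intro!: eventually_at_left_between[of 0 t] simp: limit_process_def\<close>)
    then show ?thesis by blast
  qed
  ultimately show ?thesis by (auto simp: cadlag_def limit_process_def)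
qed

lemma topspace_skorokhod_J1: "a \<le> b \<Longrightarrow> topspace (skorokhod_J1 a b) = cadlag a b"
  unfolding skorokhod_J1_def by (rule Metric_space.topspace_mtopology[OF Metric_space_skorokhod])

lemma space_borel_of_topology [simp]: "space (borel_of_topology X) = topspace X"
  unfolding borel_of_topology_def
  by (rule space_measure_of) (auto dest: openin_subset)

lemma measurable_luk_process:
  "luk_process c n \<in> bgw_cond \<mu> m \<rightarrow>\<^sub>M borel_of_topology (skorokhod_J1 (-1) 1)"
proof -
  have "sets (bgw_cond \<mu> m) = sets (count_space UNIV)" by (simp add: bgw_cond_def bgw_def)
  then have "measurable (bgw_cond \<mu> m) (borel_of_topology (skorokhod_J1 (-1) 1)) =
      measurable (count_space UNIV) (borel_of_topology (skorokhod_J1 (-1) 1))"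
    by (rule measurable_cong_sets) simp
  then show ?thesis using luk_process_cadlag by (auto simp: topspace_skorokhod_J1)
qed

end

theory Submission
  imports Defs
begin

text \<open>
  By the cycle lemma, \<open>n\<close> times the probability that \<open>n\<close> independent steps \<open>X = k - 1\<close> form the
  Lukasiewicz path of a tree equals the probability that they sum to \<open>-1\<close>, and each such word has
  exactly one cyclic shift that is a tree. Truncating at the level \<open>\<bar>b\<^sub>n\<bar>\<close> gives a maximal law of large
  numbers: away from big jumps the walk follows the line of slope \<open>b\<^sub>n / n\<close>. To return to \<open>-1\<close> it
  needs one jump of size about \<open>\<bar>b\<^sub>n\<bar>\<close>, which costs about \<open>n \<mu>(\<bar>b\<^sub>n\<bar>)\<close>.
  Words without a jump exceeding \<open>\<delta> \<bar>b\<^sub>n\<bar>\<close> are negligible in comparison: if the largest step lies in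
  \<open>[y, 2y)\<close>, that step alone has density at most \<open>c \<mu>(y)\<close>, while the Chernoff bound at scale \<open>y\<close> gives the
  other steps a factor \<open>exp (- c \<bar>b\<^sub>n\<bar> / y)\<close>, and the sum over dyadic \<open>y \<le> \<delta> \<bar>b\<^sub>n\<bar>\<close> is
  \<open>O(\<delta>) n \<mu>(\<bar>b\<^sub>n\<bar>)\<close>. Finally, a tree path is nonnegative, which forces the jump of the shifted word
  to occur near time \<open>0\<close>.
\<close>

text \<open>The conditioning event is only known to have probability at least a multiple of
  \<open>p (\<beta> n)\<close>, so an error that merely tends to 0 is not enough: every bound has to
  be relative to this point mass. The law of large numbers comes without a rate and suffices
  nevertheless, because once the big letter is rotated to the front the total determines it from the
  others, and the bound becomes a point mass times a probability for the rest. For letters of order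
  at least \<open>\<beta> n\<close> that point mass is at most a multiple of
  \<open>p (\<beta> n)\<close>. For a largest letter of smaller size y the bound is worse by a
  factor \<open>(\<beta> n / y) ^ 3\<close>, and this loss is what the exponential factor has to
  beat. A second obstacle is that b_n is defined by truncation at a_n, while the argument truncates
  at the level |b_n|, which is of larger order; the two drifts differ by o(|b_n|) only. Slow
  variation enters only through the weight k^2 p k, which stays comparable on ranges of bounded
  ratio and changes at most like a square root on long ones.\<close>

section \<open>Slowly varying functions\<close>

text \<open>
  If the claim fails along \<open>x\<^sub>n\<close>, \<open>u\<^sub>n\<close>, then for large \<open>n\<close> the shifts that work for \<open>x\<^sub>n\<close> and those that
  work for \<open>x\<^sub>n + u\<^sub>n\<close> each fill more than half of an interval containing both, so they meet.
\<close>

lemma additive_uniform_convergence: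
  fixes h :: "real \<Rightarrow> real"
  assumes meas[measurable]: "h \<in> borel_measurable borel"
    and lim: "\<And>u. ((\<lambda>x. h (x + u) - h x) \<longlongrightarrow> 0) at_top"
    and e: "e > 0" and T: "T > 0"
  shows "\<exists>X. \<forall>x\<ge>X. \<forall>u\<in>{0..T}. \<bar>h (x + u) - h x\<bar> < e"
proof (rule ccontr)
  assume "\<not> ?thesis"
  then have "\<forall>n::nat. \<exists>x u. x \<ge> real n \<and> u \<in> {0..T} \<and> \<not> \<bar>h (x + u) - h x\<bar> < e"
    by blast
  then obtain x u where xu: "\<And>n::nat. x n \<ge> real n" "\<And>n. u n \<in> {0..T}"
    "\<And>n. \<not> \<bar>h (x n + u n) - h (x n)\<bar> < e"
    by metis
  have key: "\<exists>N. \<forall>n\<ge>N. measure lebesgue {v\<in>{0..2*T}. \<forall>m\<ge>n. \<bar>h (z m + v) - h (z m)\<bar> < e/2} > 3/2 * T"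
    if z: "\<And>n::nat. z n \<ge> real n" for z
  proof -
    define U where "U = (\<lambda>n. {v\<in>{0..2*T}. \<forall>m\<ge>n. \<bar>h (z m + v) - h (z m)\<bar> < e/2})"
    have Us: "U n \<in> sets borel" for n
    proof -
      have "U n = {0..2*T} \<inter> (\<Inter>m\<in>{n..}. {v. \<bar>h (z m + v) - h (z m)\<bar> < e/2})"
        by (auto simp: U_def)
      moreover have "{v. \<bar>h (z m + v) - h (z m)\<bar> < e/2} \<in> sets borel" for m
      proof -
        have "{v \<in> space borel. \<bar>h (z m + v) - h (z m)\<bar> < e/2} \<in> sets borel"
          by measurable
        then show ?thesis by simp
      qed
      then have "(\<Inter>m\<in>{n..}. {v. \<bar>h (z m + v) - h (z m)\<bar> < e/2}) \<in> sets borel"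
        by (intro sets.countable_INT'') simp_all
      ultimately show ?thesis by simp
    qed
    have zlim: "filterlim z at_top sequentially"
      by (rule filterlim_at_top_mono[OF filterlim_real_sequentially]) (use z in auto)
    have un: "(\<Union>n. U n) = {0..2*T}"
    proof (intro equalityI subsetI)
      fix v assume v: "v \<in> {0..2*T}"
      have "((\<lambda>m. h (z m + v) - h (z m)) \<longlongrightarrow> 0) sequentially"
        using filterlim_compose[OF lim[of v] zlim] by simp
      then have "\<forall>\<^sub>F m in sequentially. dist (h (z m + v) - h (z m)) 0 < e/2"
        by (rule tendstoD) (use e in simp)
      then show "v \<in> (\<Union>n. U n)" using v
        by (auto simp: U_def eventually_sequentially)
    qed (auto simp: U_def)
    have "(\<lambda>n. measure lebesgue (U n)) \<longlonglongrightarrow> measure lebesgue (\<Union>n. U n)"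
    proof (rule Lim_measure_incseq)
      show "range U \<subseteq> sets lebesgue" using Us by auto
      show "incseq U" by (auto simp: U_def incseq_def)
      show "emeasure lebesgue (\<Union>n. U n) \<noteq> \<infinity>" unfolding un using T by simp
    qed
    then have "(\<lambda>n. measure lebesgue (U n)) \<longlonglongrightarrow> 2 * T" unfolding un using T by simp
    then have "\<forall>\<^sub>F n in sequentially. measure lebesgue (U n) > 3/2 * T"
      by (rule order_tendstoD) (use T in simp)
    then show ?thesis unfolding U_def eventually_sequentially by blast
  qed
  define U where "U = (\<lambda>n. {v\<in>{0..2*T}. \<forall>m\<ge>n. \<bar>h (x m + v) - h (x m)\<bar> < e/2})"
  define V where "V = (\<lambda>n. {v\<in>{0..2*T}. \<forall>m\<ge>n. \<bar>h (x m + u m + v) - h (x m + u m)\<bar> < e/2})"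
  obtain N1 where N1: "\<And>n. n \<ge> N1 \<Longrightarrow> measure lebesgue (U n) > 3/2 * T"
    using key[of x] xu(1) unfolding U_def by auto
  have "x n + u n \<ge> real n" for n using xu(1)[of n] xu(2)[of n] by auto
  from key[of "\<lambda>n. x n + u n", OF this] obtain N2 where N2: "\<And>n. n \<ge> N2 \<Longrightarrow> measure lebesgue (V n) > 3/2 * T"
    unfolding V_def by auto
  define n where "n = max N1 N2"
  define V' where "V' = (+) (u n) ` V n"
  have U3: "measure lebesgue (U n) > 3/2 * T" and V3: "measure lebesgue V' > 3/2 * T"
    using N1[of n] N2[of n] unfolding V'_def n_def by (auto simp: measure_translation)
  \<comment> \<open>\<open>measure\<close> is 0 outside the sigma-algebra, so the strict lower bound
    already forces measurability.\<close>
  have meas_pos: "W \<in> sets lebesgue" if "measure lebesgue W > 3/2 * T" for W :: "real set"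
    by (rule ccontr) (use that T in \<open>simp add: measure_notin_sets\<close>)
  have lU: "U n \<in> lmeasurable"
    by (rule fmeasurableI2[of "{0..2*T}", OF _ _ meas_pos[OF U3]]) (auto simp only: U_def lmeasurable_cbox box_real[symmetric])
  have "measure lebesgue (V n) > 3/2 * T" using N2[of n] n_def by simp
  from meas_pos[OF this] have "V n \<in> lmeasurable"
    by (rule fmeasurableI2[of "{0..2*T}", rotated 2]) (auto simp only: V_def lmeasurable_cbox box_real[symmetric])
  then have lV': "V' \<in> lmeasurable" unfolding V'_def by (rule measurable_translation)
  have "U n \<inter> V' \<noteq> {}"
  proof
    assume "U n \<inter> V' = {}"
    then have "measure lebesgue (U n \<union> V') = measure lebesgue (U n) + measure lebesgue V'"
      using lU lV' by (intro measure_Un_AE) auto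
    moreover have "measure lebesgue (U n \<union> V') \<le> measure lebesgue {0..3*T}"
    proof (rule measure_mono_fmeasurable)
      show "U n \<union> V' \<subseteq> {0..3*T}" using xu(2)[of n] T by (auto simp: U_def V'_def V_def)
    qed (use lU lV' in auto)
    ultimately show False using U3 V3 T by simp
  qed
  then obtain v where v: "u n + v \<in> U n" "v \<in> V n" unfolding V'_def by blast
  have "\<bar>h (x n + (u n + v)) - h (x n)\<bar> < e/2" using v(1) unfolding U_def by blast
  moreover have "\<bar>h (x n + u n + v) - h (x n + u n)\<bar> < e/2" using v(2) unfolding V_def by blast
  ultimately have "\<bar>h (x n + u n) - h (x n)\<bar> < e"
    by (simp only: add.assoc abs_less_iff) linarith
  then show False using xu(3) by blast
qed

text \<open>Additive uniform convergence is applied to the logarithm of \<open>L (exp x)\<close>: a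
  factor c in [1, R] becomes a shift in [0, ln R], and an error below ln q becomes a ratio below
  q.\<close>

lemma slowly_varying_uniform:
  assumes sv: "slowly_varying L" and R: "R > 1" and q: "q > 1"
  shows "\<exists>A>0. \<forall>x\<ge>A. \<forall>c. 1 \<le> c \<and> c \<le> R \<longrightarrow> 0 < L x \<and> L (c * x) \<le> q * L x \<and> L x \<le> q * L (c * x)"
proof -
  obtain A where A: "L \<in> borel_measurable (restrict_space borel {A..})" "\<And>x. x \<ge> A \<Longrightarrow> L x > 0"
    using sv unfolding slowly_varying_def by blast
  \<comment> \<open>\<open>L\<close> is measurable and positive only beyond \<open>A\<close>; the
    filler value 1 yields a Borel function on the whole line with a harmless logarithm.\<close>
  have [measurable]: "(\<lambda>x. if x \<in> {A..} then L x else 1) \<in> borel_measurable borel"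
    using A(1) by (subst (asm) measurable_restrict_space_iff[where c = 1]) auto
  define h where "h = (\<lambda>x. ln (if exp x \<in> {A..} then L (exp x) else 1))"
  have h: "h x = ln (L (exp x))" if "exp x \<ge> A" for x using that by (simp add: h_def)
  have lim: "((\<lambda>x. h (x + u) - h x) \<longlongrightarrow> 0) at_top" for u
  proof -
    have "((\<lambda>x. L (exp u * x) / L x) \<longlongrightarrow> 1) at_top"
      using sv unfolding slowly_varying_def by simp
    then have "((\<lambda>x. L (exp u * exp x) / L (exp x)) \<longlongrightarrow> 1) at_top"
      by (rule filterlim_compose[OF _ exp_at_top])
    then have "((\<lambda>x. ln (L (exp u * exp x) / L (exp x))) \<longlongrightarrow> ln 1) at_top"
      by (rule tendsto_ln) simp
    moreover have "\<forall>\<^sub>F x in at_top. ln (L (exp u * exp x) / L (exp x)) = h (x + u) - h x"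
    proof -
      have "\<forall>\<^sub>F x in at_top. exp x \<ge> A" using exp_at_top by (simp add: filterlim_at_top)
      moreover have "filterlim (\<lambda>x::real. exp (x + u)) at_top at_top"
        by (rule filterlim_compose[OF exp_at_top]) (subst add.commute, rule filterlim_tendsto_add_at_top[OF tendsto_const filterlim_ident])
      then have "\<forall>\<^sub>F x in at_top. exp (x + u) \<ge> A" by (simp add: filterlim_at_top)
      ultimately show ?thesis
      proof eventually_elim
        case (elim x)
        have "L (exp x) > 0" "L (exp (x + u)) > 0" using A(2) elim by auto
        then show ?case using elim by (simp add: h ln_div exp_add mult.commute)
      qed
    qed
    ultimately show ?thesis by (simp add: tendsto_cong)
  qed
  have [measurable]: "h \<in> borel_measurable borel" unfolding h_def
    by (intro borel_measurable_ln)
      (rule measurable_compose[of exp borel borel "\<lambda>x. if x \<in> {A..} then L x else 1"], simp, fact)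
  obtain X where X: "\<forall>x\<ge>X. \<forall>u\<in>{0..ln R}. \<bar>h (x + u) - h x\<bar> < ln q"
    using additive_uniform_convergence[of h "ln q" "ln R"] lim R q by auto
  show ?thesis
  proof (intro exI[of _ "max (max 1 A) (exp X)"] conjI allI impI)
    fix x c assume x: "max (max 1 A) (exp X) \<le> x" and c: "1 \<le> c \<and> c \<le> R"
    have x1: "x \<ge> 1" "x \<ge> A" "x \<ge> exp X" using x by auto
    then have lx: "ln x \<ge> X" by (metis exp_le_cancel_iff exp_ln less_le_trans zero_less_one)
    have cx: "c * x \<ge> x" using c x1 mult_right_mono[of 1 c x] by simp
    show Lx: "0 < L x" using A x1 by simp
    have Lcx: "0 < L (c * x)" using A(2)[of "c * x"] x1 cx by linarith
    have "ln c \<in> {0..ln R}" using c by simp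
    then have "\<bar>h (ln x + ln c) - h (ln x)\<bar> < ln q" using X lx by blast
    moreover have "ln x + ln c = ln (c * x)" using c x1 by (simp add: ln_mult)
    moreover have "exp (ln (c * x)) = c * x" using x1 c by simp
    then have "h (ln (c * x)) = ln (L (c * x))" using h[of "ln (c * x)"] x1 cx by simp
    moreover have "h (ln x) = ln (L x)" using x1 h[of "ln x"] by simp
    ultimately have "ln (L (c * x)) < ln (q * L x)" "ln (L x) < ln (q * L (c * x))"
      using Lx Lcx q by (auto simp: ln_mult)
    then show "L (c * x) \<le> q * L x" "L x \<le> q * L (c * x)" using Lx Lcx q
      by (auto simp: less_imp_le)
  qed auto
qed

text \<open>Each doubling of the argument changes \<open>L\<close> by at most a factor sqrt 2, so j
  doublings with 2^j <= x/y cost at most sqrt (x/y); the factor 2 covers the last, incomplete one.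
  The later sums need a power of x/y below 1, and the square root is a convenient choice.\<close>

lemma slowly_varying_potter:
  assumes sv: "slowly_varying L"
  shows "\<exists>A>0. \<forall>y x. A \<le> y \<and> y \<le> x \<longrightarrow>
    0 < L y \<and> L x \<le> 2 * sqrt (x / y) * L y \<and> L y \<le> 2 * sqrt (x / y) * L x"
proof -
  obtain A where A: "A > 0" "\<And>x c. x \<ge> A \<Longrightarrow> 1 \<le> c \<Longrightarrow> c \<le> 2 \<Longrightarrow>
      0 < L x \<and> L (c * x) \<le> sqrt 2 * L x \<and> L x \<le> sqrt 2 * L (c * x)"
    using slowly_varying_uniform[OF sv, of 2 "sqrt 2"] by auto
  have *: "L x \<le> sqrt 2 ^ (j+1) * L y \<and> L y \<le> sqrt 2 ^ (j+1) * L x"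
    if "A \<le> y" "2 ^ j * y \<le> x" "x \<le> 2 ^ (j+1) * y" for j x y
    using that
  proof (induction j arbitrary: x)
    case 0
    then show ?case using A(2)[of y "x/y"] A(1) by (auto simp: field_simps)
  next
    case (Suc j)
    have IH: "L (x/2) \<le> sqrt 2 ^ (j+1) * L y \<and> L y \<le> sqrt 2 ^ (j+1) * L (x/2)"
      using Suc.prems by (intro Suc.IH) auto
    have "y \<le> 2 ^ j * y" using A(1) Suc.prems(1) by simp
    then have "x / 2 \<ge> A" using Suc.prems by simp
    then have *: "L x \<le> sqrt 2 * L (x/2)" "L (x/2) \<le> sqrt 2 * L x" using A(2)[of "x/2" 2] by auto
    have "L x \<le> sqrt 2 * (sqrt 2 ^ (j+1) * L y)" using * IH by (meson mult_left_mono order_trans real_sqrt_ge_zero zero_le_numeral)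
    moreover have "L y \<le> sqrt 2 ^ (j+1) * (sqrt 2 * L x)" using * IH
      by (meson mult_left_mono order_trans real_sqrt_ge_zero zero_le_numeral zero_le_power)
    ultimately show ?case by (simp add: mult_ac)
  qed
  show ?thesis
  proof (intro exI[of _ A] conjI allI impI)
    fix y x assume yx: "A \<le> y \<and> y \<le> x"
    have y0: "y > 0" using yx A by simp
    have "1 \<le> x / y" using yx y0 by simp
    obtain j :: nat where j: "2 ^ j \<le> x / y" "x / y < 2 ^ (j+1)"
    proof -
      have "\<exists>m. x / y < 2 ^ m" using real_arch_pow[of 2 "x/y"] by auto
      define m where "m = (LEAST m. x / y < 2 ^ m)"
      have m: "x / y < 2 ^ m" unfolding m_def using \<open>\<exists>m. _\<close> by (rule LeastI_ex)
      have "m \<noteq> 0" using m \<open>1 \<le> x/y\<close> by (cases m) auto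
      then obtain k where k: "m = Suc k" by (cases m) auto
      have "\<not> x / y < 2 ^ k" using not_less_Least[of k "\<lambda>m. x / y < 2 ^ m"] k m_def by auto
      then show ?thesis using that[of k] m k by auto
    qed
    have b: "L x \<le> sqrt 2 ^ (j+1) * L y \<and> L y \<le> sqrt 2 ^ (j+1) * L x"
      using j yx y0 by (intro *) (auto simp: field_simps)
    have "sqrt 2 ^ j \<le> sqrt (x / y)" using j(1) by (simp flip: real_sqrt_power)
    then have s: "sqrt 2 ^ (j+1) \<le> 2 * sqrt (x / y)"
      using sqrt2_less_2 by (simp add: mult_mono)
    show Ly: "0 < L y" using A(2)[of y 1] yx by auto
    have Lx: "0 < L x" using A(2)[of x 1] yx by auto
    show "L x \<le> 2 * sqrt (x / y) * L y" using b mult_right_mono[OF s, of "L y"] Ly by linarith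
    show "L y \<le> 2 * sqrt (x / y) * L x" using b mult_right_mono[OF s, of "L x"] Lx by linarith
  qed (use A in auto)
qed

text \<open>The factor 8 consists of 2 for \<open>L\<close> and 2 for each of the two passages
  between \<open>w\<close> and \<open>L\<close>. In the first claim the threshold depends on
  \<open>R\<close> but the constant does not; \<open>g_dominates\<close> relies on this.\<close>

lemma weight_regularity:
  fixes p :: "nat \<Rightarrow> real" and L :: "real \<Rightarrow> real"
  assumes sv: "slowly_varying L" and p0: "\<And>n. 0 \<le> p n"
    and tail: "p \<sim>[sequentially] (\<lambda>n. L (real n) / real n ^ 2)"
  defines "w \<equiv> \<lambda>k. p k * real k ^ 2"
  shows "\<exists>A\<ge>1. \<forall>y\<ge>A. \<forall>x. y \<le> x \<and> x \<le> R * y \<longrightarrow> w y \<le> 8 * w x"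
    and "\<exists>A\<ge>1. \<forall>y x. A \<le> y \<and> y \<le> x \<longrightarrow>
      0 < w y \<and> w x \<le> 8 * sqrt (real x / real y) * w y \<and> w y \<le> 8 * sqrt (real x / real y) * w x"
proof -
  have "\<forall>\<^sub>F n in sequentially. norm (p n) \<le> 2 * norm (L (real n) / real n ^ 2)"
    by (rule asymp_equiv_imp_eventually_le[OF tail]) simp
  moreover have "\<forall>\<^sub>F n in sequentially. norm (p n) \<ge> 1/2 * norm (L (real n) / real n ^ 2)"
    by (rule asymp_equiv_imp_eventually_ge[OF tail]) simp
  ultimately have "\<forall>\<^sub>F n in sequentially. norm (p n) \<le> 2 * norm (L (real n) / real n ^ 2) \<and>
     norm (p n) \<ge> 1/2 * norm (L (real n) / real n ^ 2)" by (rule eventually_conj)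
  then obtain N where N: "\<And>n. n \<ge> N \<Longrightarrow> norm (p n) \<le> 2 * norm (L (real n) / real n ^ 2) \<and>
     norm (p n) \<ge> 1/2 * norm (L (real n) / real n ^ 2)"
    unfolding eventually_sequentially by blast
  have cmp: "w n \<le> 2 * L n \<and> L n \<le> 2 * w n" if "n \<ge> N" "n \<ge> 1" "L n > 0" for n
  proof -
    have "p n \<le> 2 * (L n / real n ^ 2)" "1/2 * (L n / real n ^ 2) \<le> p n"
      using N[of n] that p0[of n] by auto
    then show ?thesis using that unfolding w_def by (auto simp: field_simps)
  qed
  obtain A2 where A2: "A2 > 0" "\<And>y x. A2 \<le> y \<Longrightarrow> y \<le> x \<Longrightarrow> 0 < L y \<and>
      L x \<le> 2 * sqrt (x / y) * L y \<and> L y \<le> 2 * sqrt (x / y) * L x"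
    using slowly_varying_potter[OF sv] by blast
  show "\<exists>A\<ge>1. \<forall>y x. A \<le> y \<and> y \<le> x \<longrightarrow>
      0 < w y \<and> w x \<le> 8 * sqrt (real x / real y) * w y \<and> w y \<le> 8 * sqrt (real x / real y) * w x"
  proof (intro exI[of _ "max 1 (max N (nat \<lceil>A2\<rceil>))"] conjI allI impI)
    fix y x :: nat assume yx: "max 1 (max N (nat \<lceil>A2\<rceil>)) \<le> y \<and> y \<le> x"
    then have y: "A2 \<le> real y" "y \<ge> N" "y \<ge> 1" "x \<ge> N" "x \<ge> 1" "A2 \<le> real x" "real y \<le> real x" by linarith+
    have Ly: "L y > 0" "L x > 0" using A2(2)[of "real y" "real y"] A2(2)[of "real x" "real x"] y by auto
    have c: "w y \<le> 2 * L y" "L y \<le> 2 * w y" "w x \<le> 2 * L x" "L x \<le> 2 * w x"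
      using cmp[of x] cmp[of y] y Ly by auto
    have P: "L x \<le> 2 * sqrt (real x / real y) * L y" "L y \<le> 2 * sqrt (real x / real y) * L x"
      using A2(2)[of "real y" "real x"] y by auto
    have s: "0 \<le> 2 * sqrt (real x / real y)" by simp
    show "0 < w y" using Ly c by simp
    have "2 * sqrt (real x / real y) * L y \<le> 2 * sqrt (real x / real y) * (2 * w y)"
      by (rule mult_left_mono[OF c(2) s])
    then show "w x \<le> 8 * sqrt (real x / real y) * w y" using P(1) c(3) by linarith
    have "2 * sqrt (real x / real y) * L x \<le> 2 * sqrt (real x / real y) * (2 * w x)"
      by (rule mult_left_mono[OF c(4) s])
    then show "w y \<le> 8 * sqrt (real x / real y) * w x" using P(2) c(1) by linarith
  qed auto
  \<comment> \<open>\<open>real R + 2\<close> exceeds 1 for every natural \<open>R\<close>, as the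
    uniform bound requires.\<close>
  obtain A1 where A1: "A1 > 0" "\<And>x c. x \<ge> A1 \<Longrightarrow> 1 \<le> c \<Longrightarrow> c \<le> real R + 2 \<Longrightarrow>
      0 < L x \<and> L (c * x) \<le> 2 * L x \<and> L x \<le> 2 * L (c * x)"
    using slowly_varying_uniform[OF sv, of "real R + 2" 2] by auto
  show "\<exists>A\<ge>1. \<forall>y\<ge>A. \<forall>x. y \<le> x \<and> x \<le> R * y \<longrightarrow> w y \<le> 8 * w x"
  proof (intro exI[of _ "max 1 (max N (nat \<lceil>A1\<rceil>))"] conjI allI impI)
    fix y x :: nat assume y: "max 1 (max N (nat \<lceil>A1\<rceil>)) \<le> y" and x: "y \<le> x \<and> x \<le> R * y"
    then have y': "A1 \<le> real y" "y \<ge> N" "y \<ge> 1" "x \<ge> N" "x \<ge> 1" "A1 \<le> real x" "real y \<le> real x" by linarith+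
    have "real x \<le> real R * real y" using x by (metis of_nat_le_iff of_nat_mult)
    then have c: "1 \<le> real x / real y" "real x / real y \<le> real R + 2"
      using y' by (auto simp: field_simps)
    have "0 < L y" "L y \<le> 2 * L x" using A1(2)[OF y'(1) c] y' by auto
    moreover have "w y \<le> 2 * L y" "L x \<le> 2 * w x"
      using cmp[of x] cmp[of y] y' A1(2)[of "real x" 1] A1(2)[of "real y" 1] by auto
    ultimately show "w y \<le> 8 * w x" by linarith
  qed auto
qed

section \<open>Offspring laws with regularly varying tails\<close>

text \<open>Telescoping: for a = sqrt n and b = sqrt (n + 1), the facts (b - a)^2 >= 0 and b^2 - a^2
  = 1 give 1/b <= 2b - 2a.\<close>

lemma sum_inverse_sqrt_le:
  assumes "m \<ge> 1"
  shows "(\<Sum>k=m..n. 1 / sqrt (real k)) \<le> 2 * sqrt (real n)"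
proof (induction n)
  case (Suc n)
  note IH = Suc
  define a b where "a = sqrt (real n)" and "b = sqrt (real (Suc n))"
  have ab: "b > 0" "b\<^sup>2 = a\<^sup>2 + 1" by (auto simp: a_def b_def)
  have "0 \<le> (b - a)\<^sup>2" by simp
  then have "1 \<le> (2 * b - 2 * a) * b" using ab by (simp add: power2_eq_square algebra_simps)
  then have "1 / b \<le> 2 * b - 2 * a" using ab by (simp add: pos_divide_le_eq)
  then have step: "1 / sqrt (real (Suc n)) \<le> 2 * sqrt (real (Suc n)) - 2 * sqrt (real n)"
    by (simp add: a_def b_def)
  show ?case
  proof (cases "m \<le> Suc n")
    case True
    then have "(\<Sum>k=m..Suc n. 1 / sqrt (real k)) = (\<Sum>k=m..n. 1 / sqrt (real k)) + 1 / sqrt (real (Suc n))"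
      by simp
    then show ?thesis using IH step by linarith
  qed simp
qed (use assms in simp)

text \<open>Telescoping again: k^(-3/2) <= 4 / sqrt k - 4 / sqrt (k + 1).\<close>

lemma sum_sqrt_over_square_le:
  assumes "y \<ge> 1"
  shows "(\<Sum>k\<in>{y..<n::nat}. sqrt (real k) / real k ^ 2) \<le> 4 / sqrt (real y)"
proof (cases "y \<le> n")
  case True
  then have "(\<Sum>k\<in>{y..<n::nat}. sqrt (real k) / real k ^ 2) \<le> 4 / sqrt (real y) - 4 / sqrt (real n)"
  proof (induction n rule: dec_induct)
    case (step n)
    have n: "n \<ge> 1" using step assms by simp
    define a b where "a = sqrt (real n)" and "b = sqrt (real (Suc n))"
    have ab: "a \<ge> 1" "b > 0" "b\<^sup>2 = a\<^sup>2 + 1" "a \<le> b" "real n = a\<^sup>2" using n by (auto simp: a_def b_def)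
    have a2: "a\<^sup>2 \<ge> 1" using ab(1) by simp
    have "0 \<le> (b - a)\<^sup>2" by simp
    then have "b * (a + b) \<le> 4 * a\<^sup>2" using ab a2 by (simp add: power2_eq_square algebra_simps)
    moreover have "(b - a) * (a + b) = 1" using ab by (simp add: power2_eq_square algebra_simps)
    ultimately have "b * (a + b) \<le> (4 * a\<^sup>2 * (b - a)) * (a + b)" by (simp add: mult.assoc)
    then have "b \<le> 4 * a\<^sup>2 * (b - a)" using ab by (simp add: mult_le_cancel_right)
    then have "b / (a ^ 3 * b) \<le> 4 * a\<^sup>2 * (b - a) / (a ^ 3 * b)"
      using ab(1,2) by (intro divide_right_mono) simp_all
    moreover have nz: "a \<noteq> 0" "b \<noteq> 0" using ab(1,2) by auto
    then have "b / (a ^ 3 * b) = a / (a\<^sup>2)\<^sup>2"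
      by (simp add: power2_eq_square power3_eq_cube)
    moreover have "4 / a - 4 / b = (4 * b - 4 * a) / (a * b)" using nz by (simp add: diff_frac_eq)
    moreover have "4 * a\<^sup>2 * (b - a) / (a ^ 3 * b) = (4 * b - 4 * a) / (a * b)"
    proof (subst frac_eq_eq)
      show "4 * a\<^sup>2 * (b - a) * (a * b) = (4 * b - 4 * a) * (a ^ 3 * b)" by algebra
    qed (use nz in simp_all)
    ultimately have "a / (a\<^sup>2)\<^sup>2 \<le> 4 / a - 4 / b" by metis
    then have "sqrt (real n) / real n ^ 2 \<le> 4 / sqrt (real n) - 4 / sqrt (real (Suc n))"
      unfolding ab(5)[symmetric] unfolding a_def b_def .
    then show ?case using step by (simp del: of_nat_Suc)
  qed simp
  also have "\<dots> \<le> 4 / sqrt (real y)" by simp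
  finally show ?thesis .
qed simp

text \<open>A dyadic block starting at 2^J y has 2^J y terms, each at least 1 / (2^(J+1) y), hence
  contributes at least 1/2.\<close>

lemma sum_inverse_dyadic_ge:
  assumes "y \<ge> 1"
  shows "real J / 2 \<le> (\<Sum>k\<in>{y..<2 ^ J * y}. 1 / real k)"
proof (induction J)
  case (Suc J)
  have "(\<Sum>k\<in>{2 ^ J * y..<2 ^ Suc J * y}. 1 / real (2 ^ Suc J * y)) \<le> (\<Sum>k\<in>{2 ^ J * y..<2 ^ Suc J * y}. 1 / real k)"
  proof (intro sum_mono divide_left_mono)
    fix k assume k: "k \<in> {2 ^ J * y..<2 ^ Suc J * y}"
    have "1 \<le> 2 ^ J * y" using assms by (simp add: Suc_leI)
    then show "0 < real (2 ^ Suc J * y) * real k" using k assms by (intro mult_pos_pos) auto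
    show "real k \<le> real (2 ^ Suc J * y)" using k by (subst of_nat_le_iff) simp
  qed simp
  then have "1/2 \<le> (\<Sum>k\<in>{2 ^ J * y..<2 ^ Suc J * y}. 1 / real k)" using assms by simp
  moreover have "{y..<2 ^ Suc J * y} = {y..<2 ^ J * y} \<union> {2 ^ J * y..<2 ^ Suc J * y}"
    by (intro ivl_disj_un_two(3)[symmetric]) simp_all
  then have "(\<Sum>k\<in>{y..<2 ^ Suc J * y}. 1 / real k) =
     (\<Sum>k\<in>{y..<2 ^ J * y}. 1 / real k) + (\<Sum>k\<in>{2 ^ J * y..<2 ^ Suc J * y}. 1 / real k)"
    by (simp add: sum.union_disjoint ivl_disj_int)
  ultimately show ?case using Suc by simp
qed simp

text \<open>
  \<open>T y\<close> is the tail probability of the offspring law and, its mean being 1, \<open>g y\<close> is the tail mean of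
  \<open>k - 1\<close> over \<open>k \<ge> y\<close>.
\<close>

locale cauchy_offspring =
  fixes \<mu> :: "nat pmf" and p w T g Q :: "nat \<Rightarrow> real"
  defines "p \<equiv> pmf \<mu>"
    and "w \<equiv> \<lambda>k. p k * real k ^ 2"
    and "T \<equiv> \<lambda>y. 1 - (\<Sum>k<y. p k)"
    and "g \<equiv> \<lambda>y. \<Sum>k<y. (1 - real k) * p k"
    and "Q \<equiv> \<lambda>y. \<Sum>k<y. (real k - 1) ^ 2 * p k"
  assumes mean: "(\<lambda>k. real k * p k) sums 1"
    and weight_dyadic: "\<And>R. \<exists>A\<ge>1. \<forall>y\<ge>A. \<forall>x. y \<le> x \<and> x \<le> R * y \<longrightarrow> w y \<le> 8 * w x"
    and weight_potter: "\<exists>A\<ge>1. \<forall>y x. A \<le> y \<and> y \<le> x \<longrightarrow> 0 < w y \<and>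
      w x \<le> 8 * sqrt (real x / real y) * w y \<and> w y \<le> 8 * sqrt (real x / real y) * w x"
begin

text \<open>One threshold fixed for the whole locale, so that later estimates need not intersect
  their own. The range up to \<open>4 * y\<close> covers passages to small multiples of y, and the
  bound 2 gives k - 1 >= k / 2.\<close>

definition A0 :: nat where "A0 = (SOME A. A \<ge> 2 \<and> (\<forall>y x. A \<le> y \<and> y \<le> x \<longrightarrow> 0 < w y \<and>
      w x \<le> 8 * sqrt (real x / real y) * w y \<and> w y \<le> 8 * sqrt (real x / real y) * w x) \<and>
      (\<forall>y\<ge>A. \<forall>x. y \<le> x \<and> x \<le> 4 * y \<longrightarrow> w y \<le> 8 * w x))"

lemma A0: "A0 \<ge> 2" "\<And>y x. A0 \<le> y \<Longrightarrow> y \<le> x \<Longrightarrow> w x \<le> 8 * sqrt (real x / real y) * w y"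
  "\<And>y x. A0 \<le> y \<Longrightarrow> y \<le> x \<Longrightarrow> w y \<le> 8 * sqrt (real x / real y) * w x"
  "\<And>y. A0 \<le> y \<Longrightarrow> 0 < w y"
  "\<And>y x. A0 \<le> y \<Longrightarrow> y \<le> x \<Longrightarrow> x \<le> 4 * y \<Longrightarrow> w y \<le> 8 * w x"
proof -
  obtain A where A: "\<forall>y x. A \<le> y \<and> y \<le> x \<longrightarrow> 0 < w y \<and>
      w x \<le> 8 * sqrt (real x / real y) * w y \<and> w y \<le> 8 * sqrt (real x / real y) * w x"
    using weight_potter by blast
  obtain A' where A': "\<forall>y\<ge>A'. \<forall>x. y \<le> x \<and> x \<le> 4 * y \<longrightarrow> w y \<le> 8 * w x"
    using weight_dyadic by blast
  have "\<exists>A. A \<ge> 2 \<and> (\<forall>y x. A \<le> y \<and> y \<le> x \<longrightarrow> 0 < w y \<and>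
      w x \<le> 8 * sqrt (real x / real y) * w y \<and> w y \<le> 8 * sqrt (real x / real y) * w x) \<and>
      (\<forall>y\<ge>A. \<forall>x. y \<le> x \<and> x \<le> 4 * y \<longrightarrow> w y \<le> 8 * w x)"
    using A A' by (intro exI[of _ "max 2 (max A A')"]) auto
  from someI_ex[OF this, folded A0_def]
  show "A0 \<ge> 2" "\<And>y x. A0 \<le> y \<Longrightarrow> y \<le> x \<Longrightarrow> w x \<le> 8 * sqrt (real x / real y) * w y"
    "\<And>y x. A0 \<le> y \<Longrightarrow> y \<le> x \<Longrightarrow> w y \<le> 8 * sqrt (real x / real y) * w x"
    "\<And>y. A0 \<le> y \<Longrightarrow> 0 < w y"
    "\<And>y x. A0 \<le> y \<Longrightarrow> y \<le> x \<Longrightarrow> x \<le> 4 * y \<Longrightarrow> w y \<le> 8 * w x" by blast+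
qed

lemma p_nonneg: "0 \<le> p k" by (simp add: p_def)

lemma p_eq: "k \<ge> 1 \<Longrightarrow> p k = w k / real k ^ 2" by (simp add: w_def)

lemma p_pos: "k \<ge> A0 \<Longrightarrow> 0 < p k" using A0(4)[of k] A0(1) by (simp add: p_eq)

lemma p_sums: "p sums 1"
proof -
  have "(\<lambda>n. measure_pmf.prob \<mu> {n}) sums measure_pmf.prob \<mu> (\<Union>n. {n})"
    by (rule measure_pmf.finite_measure_UNION) (auto simp: disjoint_family_on_def)
  then show ?thesis by (simp add: p_def pmf.rep_eq UNION_singleton_eq_range)
qed

section \<open>Tail, tail mean and truncated second moment of the offspring law\<close>

lemma lim_T: "T \<longlonglongrightarrow> 0"
proof -
  have "(\<lambda>n. \<Sum>k<n. p k) \<longlonglongrightarrow> 1" using p_sums unfolding sums_def .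
  then have "(\<lambda>n. 1 - (\<Sum>k<n. p k)) \<longlonglongrightarrow> 1 - 1" by (intro tendsto_diff tendsto_const)
  then show ?thesis by (simp add: T_def)
qed

lemma lim_g: "g \<longlonglongrightarrow> 0"
proof -
  have "(\<lambda>n. (\<Sum>k<n. p k) - (\<Sum>k<n. real k * p k)) \<longlonglongrightarrow> 1 - 1"
    using p_sums mean unfolding sums_def by (rule tendsto_diff)
  then show ?thesis by (simp add: g_def sum_subtractf left_diff_distrib)
qed

lemma sum_split: "y \<le> (x::nat) \<Longrightarrow> sum f {..<x} = sum f {..<y} + sum f {y..<x}" for f :: "nat \<Rightarrow> real"
  by (simp add: lessThan_atLeast0 sum.atLeastLessThan_concat)

lemma T_diff: "y \<le> x \<Longrightarrow> T y - T x = (\<Sum>k\<in>{y..<x}. p k)"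
  by (simp add: T_def sum_split)

lemma g_diff: "y \<le> x \<Longrightarrow> g y - g x = (\<Sum>k\<in>{y..<x}. (real k - 1) * p k)"
  by (simp add: g_def sum_split flip: sum_negf) (simp add: algebra_simps)

lemma T_antimono: "y \<le> x \<Longrightarrow> T x \<le> T y"
  using T_diff[of y x] sum_nonneg[of "{y..<x}" p] p_nonneg by simp

lemma g_antimono: assumes "1 \<le> y" "y \<le> x" shows "g x \<le> g y"
proof -
  have "0 \<le> (\<Sum>k\<in>{y..<x}. (real k - 1) * p k)" using assms p_nonneg by (intro sum_nonneg) auto
  then show ?thesis using g_diff[OF assms(2)] by simp
qed

lemma T_nonneg: "0 \<le> T y"
  by (rule LIMSEQ_le_const2[OF lim_T]) (use T_antimono in blast)

lemma g_nonneg: "1 \<le> y \<Longrightarrow> 0 \<le> g y"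
  by (rule LIMSEQ_le_const2[OF lim_g]) (use g_antimono in blast)

lemma T_eq_prob: "T y = measure_pmf.prob \<mu> {y..}"
proof -
  have "measure_pmf.prob \<mu> {y..} = 1 - measure_pmf.prob \<mu> {..<y}"
    using measure_pmf.prob_compl[of "{..<y}" \<mu>] by (simp add: Compl_eq_Diff_UNIV[symmetric] flip: atLeast_def) 
  then show ?thesis by (simp add: T_def p_def measure_measure_pmf_finite)
qed

text \<open>The upper half of a Karamata estimate: \<open>p k = w k / k\<^sup>2\<close>, and the
  Potter bound turns the tail sum into a multiple of w y / sqrt y times the tail of the sum of
  k^(-3/2).\<close>

lemma T_le: assumes y: "y \<ge> A0" shows "T y \<le> 32 * w y / real y"
proof -
  have y1: "y \<ge> 2" using A0(1) y by simp
  have "T y - T x \<le> 32 * w y / real y" if "x \<ge> y" for x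
  proof -
    have "p k \<le> (8 * w y / sqrt (real y)) * (sqrt (real k) / real k ^ 2)" if "k \<in> {y..<x}" for k
    proof -
      have "w k / real k ^ 2 \<le> 8 * sqrt (real k / real y) * w y / real k ^ 2"
        using A0(2)[of y k] that y by (intro divide_right_mono) auto
      then show ?thesis using that y1 by (simp add: p_eq real_sqrt_divide mult_ac)
    qed
    then have "(\<Sum>k\<in>{y..<x}. p k) \<le> (\<Sum>k\<in>{y..<x}. (8 * w y / sqrt (real y)) * (sqrt (real k) / real k ^ 2))"
      by (rule sum_mono)
    also have "\<dots> = (8 * w y / sqrt (real y)) * (\<Sum>k\<in>{y..<x}. sqrt (real k) / real k ^ 2)"
      by (simp add: sum_distrib_left)
    also have "\<dots> \<le> (8 * w y / sqrt (real y)) * (4 / sqrt (real y))"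
      using A0(4)[OF y] y1 by (intro mult_left_mono sum_sqrt_over_square_le) auto
    also have "\<dots> = 32 * w y / real y" using y1 by (simp add: field_simps)
    finally show ?thesis using T_diff[OF that] by simp
  qed
  moreover have "(\<lambda>x. T y - T x) \<longlonglongrightarrow> T y - 0" by (intro tendsto_diff tendsto_const lim_T)
  ultimately show ?thesis using LIMSEQ_le_const2[of "\<lambda>x. T y - T x" "T y" "32 * w y / real y"] by auto
qed

text \<open>The block [y, 2y) alone suffices: on it \<open>w\<close> is at least
  \<open>w y / 8\<close> and k^2 is at most 4 y^2.\<close>

lemma T_ge: assumes y: "y \<ge> A0" shows "w y / (32 * real y) \<le> T y"
proof -
  have y1: "y \<ge> 2" using A0(1) y by simp
  have "w y / (32 * real y ^ 2) \<le> p k" if "k \<in> {y..<2*y}" for k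
  proof -
    have k: "w y \<le> 8 * w k" "0 < w k" using A0(5)[of y k] A0(4)[of k] that y by auto
    have "real k ^ 2 \<le> (2 * real y) ^ 2" using that by (intro power_mono) auto
    then have "w y / (32 * real y ^ 2) \<le> w y / (8 * real k ^ 2)"
      using A0(4)[OF y] y1 that by (intro divide_left_mono) auto
    also have "\<dots> = (w y / 8) / real k ^ 2" by simp
    also have "\<dots> \<le> w k / real k ^ 2" using k by (intro divide_right_mono) auto
    also have "\<dots> = p k" using that y1 by (simp add: p_eq)
    finally show ?thesis .
  qed
  then have "(\<Sum>k\<in>{y..<2*y}. w y / (32 * real y ^ 2)) \<le> (\<Sum>k\<in>{y..<2*y}. p k)" by (rule sum_mono)
  then have "w y / (32 * real y) \<le> (\<Sum>k\<in>{y..<2*y}. p k)" using y1 by (simp add: field_simps power2_eq_square)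
  also have "\<dots> = T y - T (2*y)" by (simp add: T_diff)
  also have "\<dots> \<le> T y" using T_nonneg by simp
  finally show ?thesis .
qed

text \<open>The lower bound on n P(X >= a_n) becomes a bound on the tail at
  \<open>\<alpha> n - 1\<close>, whereas the estimates are expressed at \<open>\<alpha> n\<close>;
  this bridges the shift by one.\<close>

lemma T_pred_le: assumes y: "y > A0" shows "T (y - 1) \<le> 1024 * w y / real y"
proof -
  have y1: "y \<ge> 3" using A0(1) y by simp
  have "w (y - 1) \<le> 8 * w y" using A0(5)[of "y-1" y] y y1 by auto
  have "T (y - 1) \<le> 32 * w (y - 1) / real (y - 1)" by (rule T_le) (use y in simp)
  also have "\<dots> \<le> 32 * (8 * w y) / real (y - 1)"
    using \<open>w (y - 1) \<le> 8 * w y\<close> by (intro divide_right_mono) auto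
  also have "\<dots> \<le> 32 * (8 * w y) / (real y / 2)"
    using A0(4)[of y] y y1 by (intro divide_left_mono) auto
  also have "\<dots> \<le> 1024 * w y / real y" using A0(4)[of y] y y1 by (simp add: field_simps)
  finally show ?thesis .
qed

text \<open>Controls the change of the truncated drift when the truncation level is raised, later
  from \<open>\<alpha> n\<close> to \<open>\<beta> n\<close>. By the Potter bound the summands are
  at most 8 w y / sqrt (y k).\<close>

lemma g_diff_le:
  assumes y: "y \<ge> A0" "y \<le> x"
  shows "g y - g x \<le> 16 * w y * sqrt (real x / real y)"
proof -
  have y1: "y \<ge> 2" using A0(1) y by simp
  have "(real k - 1) * p k \<le> (8 * w y / sqrt (real y)) * (1 / sqrt (real k))" if "k \<in> {y..<x}" for k
  proof -
    have k: "k \<ge> 2" "k \<ge> y" using that y1 by auto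
    have "(real k - 1) * p k \<le> real k * p k" using p_nonneg by (intro mult_right_mono) auto
    also have "\<dots> = w k / real k" using k by (simp add: p_eq power2_eq_square)
    also have "\<dots> \<le> 8 * sqrt (real k / real y) * w y / real k"
      using A0(2)[of y k] y k by (intro divide_right_mono) auto
    also have "\<dots> = (8 * w y / sqrt (real y)) * (sqrt (real k) / real k)"
      by (simp add: real_sqrt_divide)
    also have "sqrt (real k) / real k = 1 / sqrt (real k)" using k by (simp add: field_simps)
    finally show ?thesis .
  qed
  then have "(\<Sum>k\<in>{y..<x}. (real k - 1) * p k) \<le> (\<Sum>k\<in>{y..<x}. (8 * w y / sqrt (real y)) * (1 / sqrt (real k)))"
    by (rule sum_mono)
  then have "g y - g x \<le> (8 * w y / sqrt (real y)) * (\<Sum>k\<in>{y..<x}. 1 / sqrt (real k))"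
    by (simp add: sum_distrib_left g_diff[OF y(2)])
  also have "(\<Sum>k\<in>{y..<x}. 1 / sqrt (real k)) \<le> (\<Sum>k=y..x. 1 / sqrt (real k))"
    by (rule sum_mono2) auto
  then have "(8 * w y / sqrt (real y)) * (\<Sum>k\<in>{y..<x}. 1 / sqrt (real k)) \<le>
      (8 * w y / sqrt (real y)) * (2 * sqrt (real x))"
    using y1 A0(4)[OF y(1)] sum_inverse_sqrt_le[of y x]
    by (intro mult_left_mono) auto
  finally show ?thesis by (simp add: real_sqrt_divide)
qed

text \<open>On [y, 2^J y) the comparability of weights gives (k - 1) p k >= w y / (16 k), and the
  harmonic sum over J dyadic blocks is at least J/2. As J is arbitrary, \<open>w\<close> is
  negligible against \<open>g\<close>: this is why the drift beats the fluctuations.\<close>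

lemma g_dominates: "\<exists>A\<ge>A0. \<forall>y\<ge>A. K * w y \<le> g y"
proof -
  obtain J :: nat where J: "32 * K \<le> real J" using real_arch_simple by blast
  obtain A where A: "\<forall>y\<ge>A. \<forall>x. y \<le> x \<and> x \<le> 2 ^ J * y \<longrightarrow> w y \<le> 8 * w x"
    using weight_dyadic[of "2 ^ J"] by blast
  show ?thesis
  proof (intro exI[of _ "max A A0"] conjI allI impI)
    fix y assume y: "y \<ge> max A A0"
    then have y': "y \<ge> A" "y \<ge> A0" "y \<ge> 2" using A0(1) by auto
    have "(w y / 16) * (1 / real k) \<le> (real k - 1) * p k" if "k \<in> {y..<2 ^ J * y}" for k
    proof -
      have k: "k \<ge> 2" "w y \<le> 8 * w k" "0 < w k" using that y' A A0(4) by auto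
      have "(w y / 16) * (1 / real k) = (w y / 16) / real k" by simp
      also have "\<dots> \<le> (w k / 2) / real k"
        using k by (intro divide_right_mono) auto
      also have "\<dots> = real k / 2 * p k" using k by (simp add: p_eq power2_eq_square)
      also have "\<dots> \<le> (real k - 1) * p k" using k p_nonneg by (intro mult_right_mono) auto
      finally show ?thesis .
    qed
    then have "(\<Sum>k\<in>{y..<2 ^ J * y}. (w y / 16) * (1 / real k)) \<le> (\<Sum>k\<in>{y..<2 ^ J * y}. (real k - 1) * p k)"
      by (rule sum_mono)
    then have "(w y / 16) * (\<Sum>k\<in>{y..<2 ^ J * y}. 1 / real k) \<le> g y - g (2 ^ J * y)"
      by (simp add: g_diff sum_distrib_left)
    moreover have "(w y / 16) * (real J / 2) \<le> (w y / 16) * (\<Sum>k\<in>{y..<2 ^ J * y}. 1 / real k)"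
      using A0(4)[of y] y' by (intro mult_left_mono sum_inverse_dyadic_ge) auto
    moreover have "g (2 ^ J * y) \<ge> 0" using y' by (intro g_nonneg) (simp add: Suc_leI)
    moreover have "32 * K * w y \<le> real J * w y" using A0(4)[of y] y' J by (intro mult_right_mono) auto
    ultimately show "K * w y \<le> g y" by (simp add: field_simps)
  qed auto
qed

lemma g_pos: "1 \<le> y \<Longrightarrow> 0 < g y"
proof -
  assume y: "1 \<le> y"
  obtain A where A: "A \<ge> A0" "\<forall>y\<ge>A. 1 * w y \<le> g y" using g_dominates by blast
  have "0 < w (max A y)" using A(1) A0(4) by simp
  also have "\<dots> \<le> g (max A y)" using A(2) by auto
  also have "\<dots> \<le> g y" using y by (intro g_antimono) auto
  finally show ?thesis .
qed

text \<open>Beyond \<open>A0\<close> the Potter bound gives 16 y w y. The fixed initial part is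
  absorbed in one further y w y, which grows at least like sqrt y.\<close>

lemma Q_le: "\<exists>A\<ge>A0. \<forall>y\<ge>A. Q y \<le> 17 * real y * w y"
proof -
  define c where "c = (\<Sum>k<A0. (real k - 1) ^ 2 * p k)"
  have wA: "0 < w A0" using A0(4) by simp
  have A0p: "0 < real A0" using A0(1) by simp
  obtain A1 :: nat where A1: "(8 * c / (w A0 * sqrt (real A0))) ^ 2 \<le> real A1" using real_arch_simple by blast
  show ?thesis
  proof (intro exI[of _ "max A0 A1"] conjI allI impI)
    fix y assume "y \<ge> max A0 A1"
    then have y: "y \<ge> A0" "y \<ge> A1" "y \<ge> 2" using A0(1) by auto
    have yp: "0 < real y" using y by simp
    have "8 * c / (w A0 * sqrt (real A0)) \<le> sqrt (real y)"
      using A1 y by (intro real_le_rsqrt) linarith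
    then have "c \<le> sqrt (real y) * (w A0 * sqrt (real A0)) / 8" using wA A0p by (simp add: field_simps)
    also have "\<dots> \<le> sqrt (real y) * (8 * sqrt (real y / real A0) * w y * sqrt (real A0)) / 8"
      using A0(3)[of A0 y] y by (intro divide_right_mono mult_left_mono mult_right_mono) auto
    also have "\<dots> = real y * w y" using A0p yp by (simp add: real_sqrt_divide)
    finally have c: "c \<le> real y * w y" .
    have "(real k - 1)\<^sup>2 * p k \<le> (8 * sqrt (real y) * w y) * (1 / sqrt (real k))" if "k \<in> {A0..<y}" for k
    proof -
      have k: "k \<ge> 2" "k \<ge> A0" "k \<le> y" using that A0(1) by auto
      have "(real k - 1)\<^sup>2 * p k \<le> (real k)\<^sup>2 * p k" using k p_nonneg by (intro mult_right_mono power_mono) auto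
      also have "\<dots> = w k" by (simp add: w_def)
      also have "\<dots> \<le> 8 * sqrt (real y / real k) * w y" using A0(3)[of k y] k by auto
      finally show ?thesis by (simp add: real_sqrt_divide)
    qed
    then have "(\<Sum>k\<in>{A0..<y}. (real k - 1)\<^sup>2 * p k) \<le> (\<Sum>k\<in>{A0..<y}. (8 * sqrt (real y) * w y) * (1 / sqrt (real k)))"
      by (rule sum_mono)
    also have "\<dots> = (8 * sqrt (real y) * w y) * (\<Sum>k\<in>{A0..<y}. 1 / sqrt (real k))"
      by (simp add: sum_distrib_left)
    also have "\<dots> \<le> (8 * sqrt (real y) * w y) * (\<Sum>k=A0..y. 1 / sqrt (real k))"
      using A0(4)[OF y(1)] by (intro mult_left_mono sum_mono2) auto
    also have "\<dots> \<le> (8 * sqrt (real y) * w y) * (2 * sqrt (real y))"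
      using A0(1) A0(4)[OF y(1)] by (intro mult_left_mono sum_inverse_sqrt_le) auto
    also have "\<dots> = 16 * real y * w y" by simp
    finally have "(\<Sum>k\<in>{A0..<y}. (real k - 1)\<^sup>2 * p k) \<le> 16 * real y * w y" .
    moreover have "Q y = c + (\<Sum>k\<in>{A0..<y}. (real k - 1)\<^sup>2 * p k)"
      using y(1) by (simp add: Q_def c_def sum_split)
    ultimately show "Q y \<le> 17 * real y * w y" using c by simp
  qed auto
qed

text \<open>Prepares the exponential moment with parameter 1/y: its quadratic term Q y / y^2 uses up
  at most a quarter of the gain g y / y.\<close>

lemma Q_over_g: "\<exists>A\<ge>A0. \<forall>y\<ge>A. 4 * Q y \<le> real y * g y"
proof -
  obtain A1 where A1: "A1 \<ge> A0" "\<forall>y\<ge>A1. Q y \<le> 17 * real y * w y" using Q_le by blast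
  obtain A2 where A2: "A2 \<ge> A0" "\<forall>y\<ge>A2. 68 * w y \<le> g y" using g_dominates by blast
  show ?thesis
  proof (intro exI[of _ "max A1 A2"] conjI allI impI)
    fix y assume y: "y \<ge> max A1 A2"
    have "4 * Q y \<le> real y * (68 * w y)" using A1(2) y by fastforce
    also have "\<dots> \<le> real y * g y" using A2(2) y by (intro mult_left_mono) auto
    finally show "4 * Q y \<le> real y * g y" .
  qed (use A1 in auto)
qed

end

text \<open>
  In the application \<open>\<alpha> n = \<lfloor>a\<^sub>n\<rfloor> + 2\<close>, so that a step \<open>X = k - 1\<close> satisfies \<open>\<bar>X\<bar> \<le> a\<^sub>n\<close> iff \<open>k < \<alpha> n\<close>, and
  \<open>B n = \<bar>b\<^sub>n\<bar>\<close>.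
\<close>

locale cauchy_scaling = cauchy_offspring +
  fixes \<alpha> :: "nat \<Rightarrow> nat" and B :: "nat \<Rightarrow> real" and \<beta> :: "nat \<Rightarrow> nat"
  defines "B \<equiv> \<lambda>n. real n * g (\<alpha> n)"
    and "\<beta> \<equiv> \<lambda>n. nat \<lceil>B n\<rceil>"
  assumes \<alpha>_lim: "filterlim \<alpha> at_top sequentially"
    and T_scale_le: "\<forall>\<^sub>F n in sequentially. real n * T (\<alpha> n) \<le> 2"
    and T_scale_ge: "\<forall>\<^sub>F n in sequentially. 1 / 2 \<le> real n * T (\<alpha> n - 1)"
begin

section \<open>Comparison of the truncation level a_n with the drift |b_n|\<close>

lemma eventually_\<alpha>_ge: "\<forall>\<^sub>F n in sequentially. \<alpha> n > A"
  using \<alpha>_lim[unfolded filterlim_at_top, rule_format, of "Suc A"] by (simp add: Suc_le_eq)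

text \<open>Together with \<open>w_scale_ge\<close> this says that \<open>n * w (\<alpha> n)\<close>
  has the order of \<open>\<alpha> n\<close>, by the two-sided tail estimates.\<close>

lemma w_scale_le: "\<forall>\<^sub>F n in sequentially. real n * w (\<alpha> n) / real (\<alpha> n) \<le> 64"
  using T_scale_le eventually_\<alpha>_ge[of A0]
proof eventually_elim
  case (elim n)
  have "real n * (w (\<alpha> n) / (32 * real (\<alpha> n))) \<le> real n * T (\<alpha> n)"
    using T_ge[of "\<alpha> n"] elim by (intro mult_left_mono) auto
  then have "real n * (w (\<alpha> n) / (32 * real (\<alpha> n))) \<le> 2" using elim by linarith
  then have "32 * (real n * (w (\<alpha> n) / (32 * real (\<alpha> n)))) \<le> 32 * 2" by (rule mult_left_mono) simp
  then show ?case by simp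
qed

lemma w_scale_ge: "\<forall>\<^sub>F n in sequentially. real (\<alpha> n) \<le> 2048 * (real n * w (\<alpha> n))"
  using T_scale_ge eventually_\<alpha>_ge[of A0]
proof eventually_elim
  case (elim n)
  have "real n * T (\<alpha> n - 1) \<le> real n * (1024 * w (\<alpha> n) / real (\<alpha> n))"
    using T_pred_le[of "\<alpha> n"] elim by (intro mult_left_mono) auto
  then have "1 / 2 \<le> real n * (1024 * w (\<alpha> n) / real (\<alpha> n))" using elim by linarith
  then show ?case using elim by (simp add: field_simps)
qed

text \<open>\<open>n * g (\<alpha> n)\<close> dominates \<open>n * w (\<alpha> n)\<close>, which is
  at least of order \<open>\<alpha> n\<close>. Hence |b_n| is of larger order than a_n.\<close>

lemma B_dominates_\<alpha>: "\<forall>\<^sub>F n in sequentially. K * real (\<alpha> n) \<le> B n"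
proof -
  obtain A where A: "A \<ge> A0" "\<forall>y\<ge>A. (2048 * \<bar>K\<bar>) * w y \<le> g y" using g_dominates by blast
  show ?thesis using w_scale_ge eventually_\<alpha>_ge[of A]
  proof eventually_elim
    case (elim n)
    have "K * real (\<alpha> n) \<le> \<bar>K\<bar> * real (\<alpha> n)" by (intro mult_right_mono) auto
    also have "\<dots> \<le> \<bar>K\<bar> * (2048 * (real n * w (\<alpha> n)))" using elim by (intro mult_left_mono) auto
    also have "\<dots> = real n * ((2048 * \<bar>K\<bar>) * w (\<alpha> n))" by simp
    also have "\<dots> \<le> real n * g (\<alpha> n)" using A elim by (intro mult_left_mono) auto
    finally show ?case by (simp add: B_def)
  qed
qed

lemma B_at_top: "filterlim B at_top sequentially"
  unfolding filterlim_at_top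
proof
  fix Z
  show "\<forall>\<^sub>F n in sequentially. Z \<le> B n"
    using B_dominates_\<alpha>[of 1] eventually_\<alpha>_ge[of "nat \<lceil>Z\<rceil>"]
    by eventually_elim linarith
qed

lemma B_le_\<beta>: "B n \<le> real (\<beta> n)" by (simp add: \<beta>_def real_nat_ceiling_ge)

lemma \<beta>_bounds: "\<forall>\<^sub>F n in sequentially. 1 \<le> B n \<and> B n \<le> real (\<beta> n) \<and> real (\<beta> n) \<le> B n + 1 \<and> \<alpha> n \<le> \<beta> n"
  using B_dominates_\<alpha>[of 1] filterlim_at_top[THEN iffD1, OF B_at_top, THEN spec[of _ 1]]
proof eventually_elim
  case (elim n)
  then show ?case using B_le_\<beta>[of n] unfolding \<beta>_def by linarith
qed

lemma \<beta>_at_top: "filterlim \<beta> at_top sequentially"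
  unfolding filterlim_at_top
proof
  fix Z :: nat
  show "\<forall>\<^sub>F n in sequentially. Z \<le> \<beta> n"
    using filterlim_at_top[THEN iffD1, OF B_at_top, THEN spec[of _ "real Z"]]
    by eventually_elim (use B_le_\<beta> order_trans in \<open>fastforce simp flip: of_nat_le_iff\<close>)
qed

lemma eventually_\<beta>_ge: "\<forall>\<^sub>F n in sequentially. \<beta> n > A"
  using \<beta>_at_top[unfolded filterlim_at_top, rule_format, of "Suc A"] by (simp add: Suc_le_eq)

lemma \<beta>_over_B: "(\<lambda>n. real (\<beta> n) / B n) \<longlonglongrightarrow> 1"
proof (rule tendsto_sandwich)
  show "\<forall>\<^sub>F n in sequentially. 1 \<le> real (\<beta> n) / B n"
    using \<beta>_bounds by eventually_elim auto
  show "\<forall>\<^sub>F n in sequentially. real (\<beta> n) / B n \<le> 1 + 1 / B n"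
    using \<beta>_bounds by eventually_elim (auto simp: field_simps)
  have "(\<lambda>n. 1 / B n) \<longlonglongrightarrow> 0"
    using tendsto_divide_0[OF tendsto_const filterlim_at_top_imp_at_infinity[OF B_at_top]] by simp
  then show "(\<lambda>n. 1 + 1 / B n) \<longlonglongrightarrow> 1" using tendsto_add[OF tendsto_const] by fastforce
qed simp

lemma sqrt_ratio_lim: "(\<lambda>n. sqrt (real (\<alpha> n) / real (\<beta> n))) \<longlonglongrightarrow> 0"
proof -
  have "(\<lambda>n. real (\<alpha> n) / real (\<beta> n)) \<longlonglongrightarrow> 0"
  proof (rule tendstoI)
    fix e :: real assume e: "e > 0"
    show "\<forall>\<^sub>F n in sequentially. dist (real (\<alpha> n) / real (\<beta> n)) 0 < e"
      using B_dominates_\<alpha>[of "2/e"] \<beta>_bounds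
    proof eventually_elim
      case (elim n)
      then have "2 * real (\<alpha> n) / e \<le> real (\<beta> n)" "real (\<beta> n) > 0" by auto
      then have "2 * real (\<alpha> n) \<le> e * real (\<beta> n)" "0 < e * real (\<beta> n)" using e by (auto simp: field_simps)
      then have "real (\<alpha> n) < e * real (\<beta> n)" by linarith
      then show ?case using \<open>real (\<beta> n) > 0\<close> by (simp add: pos_divide_less_eq)
    qed
  qed
  from tendsto_real_sqrt[OF this] show ?thesis by simp
qed

text \<open>A Potter bound from \<open>\<alpha> n\<close> to \<open>\<beta> n\<close> produces this
  expression both for the weight and for the drift. As \<open>n * w (\<alpha> n)\<close> is at most
  of order \<open>\<alpha> n\<close>, a vanishing factor is left.\<close>

lemma eventually_scale_\<beta>:
  "\<forall>\<^sub>F n in sequentially. real n * w (\<alpha> n) * sqrt (real (\<beta> n) / real (\<alpha> n)) / real (\<beta> n)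
     \<le> 64 * sqrt (real (\<alpha> n) / real (\<beta> n))"
  using w_scale_le \<beta>_bounds eventually_\<alpha>_ge[of A0]
proof eventually_elim
  case (elim n)
  define x y where "x = sqrt (real (\<alpha> n))" and "y = sqrt (real (\<beta> n))"
  have xy: "x > 0" "y > 0" "real (\<alpha> n) = x * x" "real (\<beta> n) = y * y" using elim by (auto simp: x_def y_def)
  have "real n * w (\<alpha> n) * sqrt (real (\<beta> n) / real (\<alpha> n)) / real (\<beta> n) =
     (real n * w (\<alpha> n) / real (\<alpha> n)) * (x / y)"
    using xy by (simp add: real_sqrt_divide flip: x_def y_def)
  also have "\<dots> \<le> 64 * (x / y)" using elim xy by (intro mult_right_mono) auto
  finally show ?case by (simp add: real_sqrt_divide x_def y_def)
qed

text \<open>This one limit controls both the expected number of letters beyond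
  \<open>\<beta> n\<close> and the truncated variance relative to the square of
  \<open>\<beta> n\<close>.\<close>

lemma w_\<beta>_lim: "(\<lambda>n. real n * w (\<beta> n) / real (\<beta> n)) \<longlonglongrightarrow> 0"
proof (rule tendsto_sandwich)
  show "\<forall>\<^sub>F n in sequentially. 0 \<le> real n * w (\<beta> n) / real (\<beta> n)"
    by (simp add: w_def p_nonneg)
  show "\<forall>\<^sub>F n in sequentially. real n * w (\<beta> n) / real (\<beta> n) \<le> 512 * sqrt (real (\<alpha> n) / real (\<beta> n))"
    using eventually_scale_\<beta> \<beta>_bounds eventually_\<alpha>_ge[of A0]
  proof eventually_elim
    case (elim n)
    have "real n * w (\<beta> n) / real (\<beta> n) \<le> real n * (8 * sqrt (real (\<beta> n) / real (\<alpha> n)) * w (\<alpha> n)) / real (\<beta> n)"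
      using A0(2)[of "\<alpha> n" "\<beta> n"] elim by (intro divide_right_mono mult_left_mono) auto
    also have "\<dots> = 8 * (real n * w (\<alpha> n) * sqrt (real (\<beta> n) / real (\<alpha> n)) / real (\<beta> n))" by simp
    finally show ?case using elim by linarith
  qed
  show "(\<lambda>n. 512 * sqrt (real (\<alpha> n) / real (\<beta> n))) \<longlonglongrightarrow> 0"
    by (rule tendsto_mult_right_zero[OF sqrt_ratio_lim])
qed simp

lemma T_\<beta>_lim: "(\<lambda>n. real n * T (\<beta> n)) \<longlonglongrightarrow> 0"
proof (rule tendsto_sandwich)
  show "\<forall>\<^sub>F n in sequentially. 0 \<le> real n * T (\<beta> n)" by (simp add: T_nonneg)
  show "\<forall>\<^sub>F n in sequentially. real n * T (\<beta> n) \<le> 32 * (real n * w (\<beta> n) / real (\<beta> n))"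
    using eventually_\<beta>_ge[of A0]
  proof eventually_elim
    case (elim n)
    have "real n * T (\<beta> n) \<le> real n * (32 * w (\<beta> n) / real (\<beta> n))"
      using T_le[of "\<beta> n"] elim by (intro mult_left_mono) auto
    then show ?case by (simp add: mult_ac)
  qed
  show "(\<lambda>n. 32 * (real n * w (\<beta> n) / real (\<beta> n))) \<longlonglongrightarrow> 0"
    by (rule tendsto_mult_right_zero[OF w_\<beta>_lim])
qed simp

lemma Q_\<beta>_lim: "(\<lambda>n. real n * Q (\<beta> n) / real (\<beta> n) ^ 2) \<longlonglongrightarrow> 0"
proof (rule tendsto_sandwich)
  show "\<forall>\<^sub>F n in sequentially. 0 \<le> real n * Q (\<beta> n) / real (\<beta> n) ^ 2"
    by (simp add: Q_def p_nonneg sum_nonneg)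
  obtain A where A: "A \<ge> A0" "\<forall>y\<ge>A. Q y \<le> 17 * real y * w y" using Q_le by blast
  show "\<forall>\<^sub>F n in sequentially. real n * Q (\<beta> n) / real (\<beta> n) ^ 2 \<le> 17 * (real n * w (\<beta> n) / real (\<beta> n))"
    using eventually_\<beta>_ge[of A]
  proof eventually_elim
    case (elim n)
    have "real n * Q (\<beta> n) / real (\<beta> n) ^ 2 \<le> real n * (17 * real (\<beta> n) * w (\<beta> n)) / real (\<beta> n) ^ 2"
      using A elim by (intro divide_right_mono mult_left_mono) auto
    moreover have "real n * (17 * real (\<beta> n) * w (\<beta> n)) / real (\<beta> n) ^ 2 = 17 * (real n * w (\<beta> n) / real (\<beta> n))"
      using elim by (simp add: power2_eq_square)
    ultimately show ?case by linarith
  qed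
  show "(\<lambda>n. 17 * (real n * w (\<beta> n) / real (\<beta> n))) \<longlonglongrightarrow> 0"
    by (rule tendsto_mult_right_zero[OF w_\<beta>_lim])
qed simp

text \<open>Permits truncation at |b_n| instead of a_n without changing the drift to leading
  order.\<close>

lemma drift_lim: "(\<lambda>n. (B n - real n * g (\<beta> n)) / real (\<beta> n)) \<longlonglongrightarrow> 0"
proof (rule tendsto_sandwich)
  show "\<forall>\<^sub>F n in sequentially. 0 \<le> (B n - real n * g (\<beta> n)) / real (\<beta> n)"
    using \<beta>_bounds eventually_\<alpha>_ge[of 1]
  proof eventually_elim
    case (elim n)
    have "real n * g (\<beta> n) \<le> real n * g (\<alpha> n)"
      using g_antimono[of "\<alpha> n" "\<beta> n"] elim by (intro mult_left_mono) auto
    then show ?case by (simp add: B_def)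
  qed
  show "\<forall>\<^sub>F n in sequentially. (B n - real n * g (\<beta> n)) / real (\<beta> n) \<le> 1024 * sqrt (real (\<alpha> n) / real (\<beta> n))"
    using eventually_scale_\<beta> \<beta>_bounds eventually_\<alpha>_ge[of A0]
  proof eventually_elim
    case (elim n)
    have "(B n - real n * g (\<beta> n)) / real (\<beta> n) = real n * (g (\<alpha> n) - g (\<beta> n)) / real (\<beta> n)"
      by (simp add: B_def right_diff_distrib)
    also have "\<dots> \<le> real n * (16 * w (\<alpha> n) * sqrt (real (\<beta> n) / real (\<alpha> n))) / real (\<beta> n)"
      using g_diff_le[of "\<alpha> n" "\<beta> n"] elim by (intro divide_right_mono mult_left_mono) auto
    also have "\<dots> = 16 * (real n * w (\<alpha> n) * sqrt (real (\<beta> n) / real (\<alpha> n)) / real (\<beta> n))" by simp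
    finally show ?case using elim by linarith
  qed
  show "(\<lambda>n. 1024 * sqrt (real (\<alpha> n) / real (\<beta> n))) \<longlonglongrightarrow> 0"
    by (rule tendsto_mult_right_zero[OF sqrt_ratio_lim])
qed simp

lemma B_over_n_lim: "(\<lambda>n. B n / real n) \<longlonglongrightarrow> 0"
proof -
  have "(\<lambda>n. g (\<alpha> n)) \<longlonglongrightarrow> 0" by (rule filterlim_compose[OF lim_g \<alpha>_lim])
  moreover have "\<forall>\<^sub>F n in sequentially. g (\<alpha> n) = B n / real n"
    using eventually_gt_at_top[of 0] by eventually_elim (simp add: B_def)
  ultimately show ?thesis by (rule Lim_transform_eventually)
qed

end

section \<open>Words of independent letters\<close>

abbreviation iid_prob :: "nat \<Rightarrow> 'a pmf \<Rightarrow> 'a list set \<Rightarrow> real" where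
  "iid_prob n p \<equiv> measure_pmf.prob (replicate_pmf n p)"

lemma emeasure_replicate_pmf_Suc:
  "emeasure (replicate_pmf (Suc n) p) A = (\<integral>\<^sup>+x. emeasure (replicate_pmf n p) {xs. x # xs \<in> A} \<partial>p)"
  by (simp add: vimage_def flip: map_pmf_def)

text \<open>The first letter is integrated last, with the rest of the word given. In this order a
  first letter determined by the rest contributes only its point mass.\<close>

lemma emeasure_replicate_pmf_Suc':
  "emeasure (replicate_pmf (Suc n) p) A = (\<integral>\<^sup>+xs. emeasure p {x. x # xs \<in> A} \<partial>replicate_pmf n p)"
proof -
  have "replicate_pmf (Suc n) p = bind_pmf (replicate_pmf n p) (\<lambda>xs. bind_pmf p (\<lambda>x. return_pmf (x # xs)))"
    unfolding replicate_pmf.simps by (rule bind_commute_pmf)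
  then show ?thesis by (simp add: vimage_def flip: map_pmf_def)
qed

lemma pmf_replicate_pmf:
  "pmf (replicate_pmf n p) xs = (if length xs = n then prod_list (map (pmf p) xs) else 0)"
proof (induction n arbitrary: xs)
  case (Suc n)
  show ?case
  proof (cases xs)
    case Nil
    then show ?thesis by (simp add: pmf_eq_0_set_pmf set_replicate_pmf)
  next
    case (Cons y ys)
    have "emeasure (replicate_pmf (Suc n) p) {xs} =
        (\<integral>\<^sup>+x. ennreal (pmf (replicate_pmf n p) ys) * indicator {y} x \<partial>p)"
      unfolding emeasure_replicate_pmf_Suc
      by (intro nn_integral_cong) (auto simp: Cons emeasure_pmf_single indicator_def)
    also have "\<dots> = ennreal (pmf (replicate_pmf n p) ys) * ennreal (pmf p y)"
      by (simp add: nn_integral_cmult emeasure_pmf_single)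
    also have "\<dots> = ennreal (pmf (replicate_pmf n p) ys * pmf p y)" by (simp add: ennreal_mult)
    finally have "pmf (replicate_pmf (Suc n) p) xs = pmf (replicate_pmf n p) ys * pmf p y"
      by (simp add: emeasure_pmf_single del: replicate_pmf.simps)
    then show ?thesis using Suc[of ys] by (simp add: Cons del: replicate_pmf.simps)
  qed
qed (auto simp: pmf_return)

section \<open>Invariance of random words under rotation, and elementary estimates\<close>

lemma map_rotate1_replicate_pmf: "map_pmf rotate1 (replicate_pmf n p) = replicate_pmf n p"
proof (cases n)
  case (Suc m)
  have "replicate_pmf (m + 1) p = bind_pmf (replicate_pmf m p) (\<lambda>xs. bind_pmf p (\<lambda>x. return_pmf (xs @ [x])))"
    unfolding replicate_pmf_distrib replicate_pmf_1 by (simp add: bind_map_pmf)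
  also have "\<dots> = bind_pmf p (\<lambda>x. bind_pmf (replicate_pmf m p) (\<lambda>xs. return_pmf (xs @ [x])))"
    by (rule bind_commute_pmf)
  also have "\<dots> = map_pmf rotate1 (replicate_pmf (Suc m) p)"
    by (simp add: map_bind_pmf)
  finally show ?thesis using Suc by simp
qed simp

lemma map_rotate_replicate_pmf: "map_pmf (rotate i) (replicate_pmf n p) = replicate_pmf n p"
proof (induction i)
  case (Suc i)
  have "map_pmf (rotate (Suc i)) (replicate_pmf n p) = map_pmf rotate1 (map_pmf (rotate i) (replicate_pmf n p))"
    by (simp add: map_pmf_comp rotate_def comp_def)
  then show ?case by (simp only: Suc map_rotate1_replicate_pmf)
qed (simp add: rotate_def)

lemma iid_prob_rotate: "iid_prob n p {xs. rotate i xs \<in> Z} = iid_prob n p Z"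
  using measure_map_pmf[of "rotate i" "replicate_pmf n p" Z]
  by (simp add: map_rotate_replicate_pmf vimage_def)

lemma iid_prob_some_rotation_le: "iid_prob n p {xs. \<exists>i<n. rotate i xs \<in> Z} \<le> real n * iid_prob n p Z"
proof -
  have "iid_prob n p (\<Union>i\<in>{..<n}. {xs. rotate i xs \<in> Z}) \<le> (\<Sum>i<n. iid_prob n p {xs. rotate i xs \<in> Z})"
    by (rule measure_pmf.finite_measure_subadditive_finite) auto
  moreover have "{xs. \<exists>i<n. rotate i xs \<in> Z} = (\<Union>i\<in>{..<n}. {xs. rotate i xs \<in> Z})" by auto
  ultimately show ?thesis by (simp add: iid_prob_rotate)
qed

lemma iid_prob_cong: "(\<And>xs. length xs = n \<Longrightarrow> xs \<in> A \<longleftrightarrow> xs \<in> A') \<Longrightarrow> iid_prob n p A = iid_prob n p A'"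
  by (rule measure_pmf.finite_measure_eq_AE) (auto simp: AE_measure_pmf_iff set_replicate_pmf)

lemma iid_prob_mono: "(\<And>xs. length xs = n \<Longrightarrow> xs \<in> A \<Longrightarrow> xs \<in> A') \<Longrightarrow> iid_prob n p A \<le> iid_prob n p A'"
  by (rule measure_pmf.finite_measure_mono_AE) (auto simp: AE_measure_pmf_iff set_replicate_pmf)

text \<open>Disjoint rotated events turn the union bound into an equality, which the lower bound for
  bridges and the passage from excursions to bridges require.\<close>

lemma iid_prob_some_rotation_eq:
  assumes uniq: "\<And>xs i j. length xs = n \<Longrightarrow> i < j \<Longrightarrow> j < n \<Longrightarrow> rotate i xs \<in> Z \<Longrightarrow> rotate j xs \<notin> Z"
  shows "iid_prob n p {xs. \<exists>i<n. rotate i xs \<in> Z} = real n * iid_prob n p Z"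
proof -
  define A where "A = (\<lambda>i. {xs. length xs = n \<and> rotate i xs \<in> Z})"
  have A: "iid_prob n p (A i) = iid_prob n p Z" for i
  proof -
    have "iid_prob n p (A i) = iid_prob n p {xs. rotate i xs \<in> Z}"
      by (rule iid_prob_cong) (simp add: A_def)
    then show ?thesis by (simp add: iid_prob_rotate)
  qed
  have "disjoint_family_on A {..<n}"
    unfolding disjoint_family_on_def
  proof (intro ballI impI)
    fix i j assume "i \<in> {..<n}" "j \<in> {..<n}" "i \<noteq> j"
    then show "A i \<inter> A j = {}" using uniq[of _ i j] uniq[of _ j i] by (cases "i < j") (auto simp: A_def)
  qed
  then have "iid_prob n p (\<Union>i\<in>{..<n}. A i) = (\<Sum>i<n. iid_prob n p (A i))"
    by (intro measure_pmf.finite_measure_finite_Union) auto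
  moreover have "iid_prob n p {xs. \<exists>i<n. rotate i xs \<in> Z} = iid_prob n p (\<Union>i\<in>{..<n}. A i)"
    by (rule iid_prob_cong) (auto simp: A_def)
  ultimately show ?thesis by (simp add: A)
qed

text \<open>At most one letter completes a given \<open>xs\<close> to a word of \<open>Z\<close>, so
  integrating over the first letter costs at most \<open>c\<close>. In the applications it is the
  prescribed total that determines this letter.\<close>

lemma iid_prob_first_le:
  assumes c: "\<And>x xs. x # xs \<in> Z \<Longrightarrow> pmf p x \<le> c" "0 \<le> c"
    and R: "\<And>x xs. length xs = n \<Longrightarrow> x # xs \<in> Z \<Longrightarrow> xs \<in> R"
    and det: "\<And>x y xs. x # xs \<in> Z \<Longrightarrow> y # xs \<in> Z \<Longrightarrow> x = y"
  shows "iid_prob (Suc n) p Z \<le> c * iid_prob n p R"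
proof -
  have "emeasure (replicate_pmf (Suc n) p) Z \<le> (\<integral>\<^sup>+xs. ennreal c * indicator R xs \<partial>replicate_pmf n p)"
    unfolding emeasure_replicate_pmf_Suc'
  proof (rule nn_integral_mono_AE, unfold AE_measure_pmf_iff, intro ballI)
    fix xs assume xs: "xs \<in> set_pmf (replicate_pmf n p)"
    show "emeasure p {x. x # xs \<in> Z} \<le> ennreal c * indicator R xs"
    proof (cases "\<exists>x. x # xs \<in> Z")
      case True
      then obtain x where x: "x # xs \<in> Z" by blast
      then have "{x. x # xs \<in> Z} = {x}" using det by blast
      moreover have "xs \<in> R" using R x xs by (auto simp: set_replicate_pmf)
      ultimately show ?thesis using c x by (simp add: emeasure_pmf_single ennreal_leI)
    qed auto
  qed
  also have "\<dots> = ennreal (c * iid_prob n p R)"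
    using c(2) by (simp add: nn_integral_cmult measure_pmf.emeasure_eq_measure ennreal_mult)
  finally show ?thesis using c(2) by (simp add: measure_pmf.emeasure_eq_measure ennreal_le_iff del: replicate_pmf.simps)
qed

lemma iid_prob_first_ge:
  assumes c: "0 \<le> c" and R: "\<And>xs. length xs = n \<Longrightarrow> xs \<in> R \<Longrightarrow> \<exists>x. x # xs \<in> Z \<and> c \<le> pmf p x"
  shows "c * iid_prob n p R \<le> iid_prob (Suc n) p Z"
proof -
  have "ennreal (c * iid_prob n p R) = (\<integral>\<^sup>+xs. ennreal c * indicator R xs \<partial>replicate_pmf n p)"
    using c by (simp add: nn_integral_cmult measure_pmf.emeasure_eq_measure ennreal_mult)
  also have "\<dots> \<le> emeasure (replicate_pmf (Suc n) p) Z"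
    unfolding emeasure_replicate_pmf_Suc'
  proof (rule nn_integral_mono_AE, unfold AE_measure_pmf_iff, intro ballI)
    fix xs assume xs: "xs \<in> set_pmf (replicate_pmf n p)"
    show "ennreal c * indicator R xs \<le> emeasure p {x. x # xs \<in> Z}"
    proof (cases "xs \<in> R")
      case True
      then obtain x where x: "x # xs \<in> Z" "c \<le> pmf p x" using R xs by (auto simp: set_replicate_pmf)
      have "ennreal c \<le> emeasure p {x}" using x by (simp add: emeasure_pmf_single ennreal_leI)
      also have "\<dots> \<le> emeasure p {x. x # xs \<in> Z}" using x by (intro emeasure_mono) auto
      finally show ?thesis using True by simp
    qed simp
  qed
  finally show ?thesis by (simp add: measure_pmf.emeasure_eq_measure ennreal_le_iff del: replicate_pmf.simps)
qed

lemma iid_prob_exists_le: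
  "iid_prob n p {xs. \<exists>x\<in>set xs. x \<in> H} \<le> real n * measure_pmf.prob p H"
proof (induction n)
  case (Suc n)
  have "emeasure (replicate_pmf (Suc n) p) {xs. \<exists>x\<in>set xs. x \<in> H} \<le>
     (\<integral>\<^sup>+x. indicator H x + emeasure (replicate_pmf n p) {xs. \<exists>x\<in>set xs. x \<in> H} \<partial>p)"
    unfolding emeasure_replicate_pmf_Suc
  proof (rule nn_integral_mono)
    fix x
    show "emeasure (replicate_pmf n p) {xs. x # xs \<in> {xs. \<exists>x\<in>set xs. x \<in> H}} \<le>
       indicator H x + emeasure (replicate_pmf n p) {xs. \<exists>x\<in>set xs. x \<in> H}"
    proof (cases "x \<in> H")
      case True
      have "emeasure (replicate_pmf n p) {xs. x # xs \<in> {xs. \<exists>x\<in>set xs. x \<in> H}} \<le> 1"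
        by (rule measure_pmf.emeasure_le_1)
      then show ?thesis using True by (simp add: add_increasing2)
    qed simp
  qed
  also have "\<dots> = ennreal (measure_pmf.prob p H + iid_prob n p {xs. \<exists>x\<in>set xs. x \<in> H})"
    by (simp add: nn_integral_add measure_pmf.emeasure_eq_measure)
  finally have "iid_prob (Suc n) p {xs. \<exists>x\<in>set xs. x \<in> H} \<le> measure_pmf.prob p H + iid_prob n p {xs. \<exists>x\<in>set xs. x \<in> H}"
    by (simp add: measure_pmf.emeasure_eq_measure ennreal_le_iff del: replicate_pmf.simps flip: ennreal_plus)
  then show ?case using Suc by (simp add: algebra_simps del: replicate_pmf.simps)
qed simp

text \<open>
  Letting the walk start from an arbitrary point \<open>s\<close> makes this a one-step induction: a centred step
  preserves the expectation of \<open>s\<^sup>2\<close> plus the remaining variance.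
\<close>

lemma kolmogorov_maximal:
  fixes f :: "'a \<Rightarrow> real" and p :: "'a pmf"
  assumes int: "integrable (measure_pmf p) f" "integrable (measure_pmf p) (\<lambda>x. f x ^ 2)"
    and mean: "measure_pmf.expectation p f = 0"
    and v: "measure_pmf.expectation p (\<lambda>x. f x ^ 2) \<le> v" and c: "c > 0"
  shows "iid_prob n p {xs. \<exists>i\<le>n. c \<le> \<bar>s + sum_list (map f (take i xs))\<bar>} \<le> (s ^ 2 + real n * v) / c ^ 2"
proof -
  have "0 \<le> measure_pmf.expectation p (\<lambda>x. f x ^ 2)" by (rule integral_nonneg_AE) simp
  then have v0: "0 \<le> v" using v by linarith
  have "emeasure (replicate_pmf n p) {xs. \<exists>i\<le>n. c \<le> \<bar>s + sum_list (map f (take i xs))\<bar>} \<le> ennreal ((s ^ 2 + real n * v) / c ^ 2)"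
  proof (induction n arbitrary: s)
    case (0 s)
    show ?case
    proof (cases "c \<le> \<bar>s\<bar>")
      case True
      then have "c\<^sup>2 \<le> s\<^sup>2" using c by (metis abs_le_square_iff abs_of_pos)
      then have "1 \<le> s\<^sup>2 / c\<^sup>2" using c by simp
      then show ?thesis by (intro order_trans[OF measure_pmf.emeasure_le_1]) simp
    qed simp
  next
    case (Suc n s)
    show ?case
    proof (cases "c \<le> \<bar>s\<bar>")
      case True
      then have "c\<^sup>2 \<le> s\<^sup>2" using c by (metis abs_le_square_iff abs_of_pos)
      then have "c\<^sup>2 \<le> s\<^sup>2 + real (Suc n) * v" using v0 by (simp add: add_increasing2)
      then have "1 \<le> (s\<^sup>2 + real (Suc n) * v) / c\<^sup>2" using c by simp
      then show ?thesis by (intro order_trans[OF measure_pmf.emeasure_le_1]) (simp del: of_nat_Suc)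
    next
      case False
      have "emeasure (replicate_pmf (Suc n) p) {xs. \<exists>i\<le>Suc n. c \<le> \<bar>s + sum_list (map f (take i xs))\<bar>} \<le>
        (\<integral>\<^sup>+x. ennreal (((s + f x) ^ 2 + real n * v) / c ^ 2) \<partial>p)"
        unfolding emeasure_replicate_pmf_Suc
      proof (rule nn_integral_mono)
        fix x
        have "{xs. x # xs \<in> {xs. \<exists>i\<le>Suc n. c \<le> \<bar>s + sum_list (map f (take i xs))\<bar>}} \<subseteq>
           {xs. \<exists>i\<le>n. c \<le> \<bar>(s + f x) + sum_list (map f (take i xs))\<bar>}"
        proof (intro subsetI, unfold mem_Collect_eq)
          fix xs assume "\<exists>i\<le>Suc n. c \<le> \<bar>s + sum_list (map f (take i (x # xs)))\<bar>"
          then obtain i where i: "i \<le> Suc n" "c \<le> \<bar>s + sum_list (map f (take i (x # xs)))\<bar>" by blast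
          then obtain j where "i = Suc j" using False by (cases i) auto
          then show "\<exists>i\<le>n. c \<le> \<bar>(s + f x) + sum_list (map f (take i xs))\<bar>"
            using i by (intro exI[of _ j]) (simp add: add.assoc)
        qed
        then have "emeasure (replicate_pmf n p) {xs. x # xs \<in> {xs. \<exists>i\<le>Suc n. c \<le> \<bar>s + sum_list (map f (take i xs))\<bar>}} \<le>
          emeasure (replicate_pmf n p) {xs. \<exists>i\<le>n. c \<le> \<bar>(s + f x) + sum_list (map f (take i xs))\<bar>}"
          by (rule emeasure_mono) simp
        also have "\<dots> \<le> ennreal (((s + f x) ^ 2 + real n * v) / c ^ 2)" by (rule Suc.IH)
        finally show "emeasure (replicate_pmf n p) {xs. x # xs \<in> {xs. \<exists>i\<le>Suc n. c \<le> \<bar>s + sum_list (map f (take i xs))\<bar>}} \<le>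
          ennreal (((s + f x) ^ 2 + real n * v) / c ^ 2)" .
      qed
      also have "\<dots> = ennreal (measure_pmf.expectation p (\<lambda>x. ((s + f x) ^ 2 + real n * v) / c ^ 2))"
      proof (rule nn_integral_eq_integral)
        show "integrable (measure_pmf p) (\<lambda>x. ((s + f x) ^ 2 + real n * v) / c ^ 2)"
          using int by (simp add: power2_sum)
        show "AE x in p. 0 \<le> ((s + f x) ^ 2 + real n * v) / c ^ 2"
          using v0 by (intro AE_I2) simp
      qed
      also have "measure_pmf.expectation p (\<lambda>x. ((s + f x) ^ 2 + real n * v) / c ^ 2) =
          (s\<^sup>2 + measure_pmf.expectation p (\<lambda>x. f x ^ 2) + real n * v) / c ^ 2"
        using int mean by (simp add: power2_sum)
      also have "\<dots> \<le> (s\<^sup>2 + real (Suc n) * v) / c ^ 2"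
        using v by (intro divide_right_mono) (auto simp: algebra_simps)
      finally show ?thesis by (simp add: ennreal_leI del: of_nat_Suc replicate_pmf.simps)
    qed
  qed
  moreover have "0 \<le> (s ^ 2 + real n * v) / c ^ 2" using v0 by simp
  ultimately show ?thesis by (simp add: measure_pmf.emeasure_eq_measure ennreal_le_iff)
qed

text \<open>The moment is restricted to \<open>H\<close>, so the truncation is carried through the
  product and \<open>M\<close> may lie below 1. A general \<open>t\<close> lets the induction absorb
  the first step as \<open>t + f x\<close>.\<close>

lemma iid_chernoff:
  fixes f :: "'a \<Rightarrow> real" and p :: "'a pmf"
  assumes M: "(\<integral>\<^sup>+x. ennreal (exp (l * f x)) * indicator H x \<partial>p) \<le> ennreal M" "0 \<le> M" and l: "0 \<le> l"
  shows "iid_prob n p {xs. set xs \<subseteq> H \<and> - t \<le> sum_list (map f xs)} \<le> exp (l * t) * M ^ n"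
proof -
  have "emeasure (replicate_pmf n p) {xs. set xs \<subseteq> H \<and> - t \<le> sum_list (map f xs)} \<le> ennreal (exp (l * t) * M ^ n)"
  proof (induction n arbitrary: t)
    case (0 t)
    show ?case
    proof (cases "0 \<le> t")
      case True
      then have "1 \<le> exp (l * t)" using l by simp
      then show ?thesis by (intro order_trans[OF measure_pmf.emeasure_le_1]) simp
    qed simp
  next
    case (Suc n t)
    have "emeasure (replicate_pmf (Suc n) p) {xs. set xs \<subseteq> H \<and> - t \<le> sum_list (map f xs)} \<le>
      (\<integral>\<^sup>+x. ennreal (exp (l * t) * M ^ n) * (ennreal (exp (l * f x)) * indicator H x) \<partial>p)"
      unfolding emeasure_replicate_pmf_Suc
    proof (rule nn_integral_mono)
      fix x
      show "emeasure (replicate_pmf n p) {xs. x # xs \<in> {xs. set xs \<subseteq> H \<and> - t \<le> sum_list (map f xs)}} \<le>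
        ennreal (exp (l * t) * M ^ n) * (ennreal (exp (l * f x)) * indicator H x)"
      proof (cases "x \<in> H")
        case True
        then have "{xs. x # xs \<in> {xs. set xs \<subseteq> H \<and> - t \<le> sum_list (map f xs)}} =
          {xs. set xs \<subseteq> H \<and> - (t + f x) \<le> sum_list (map f xs)}" by auto
        then show ?thesis using Suc.IH[of "t + f x"] True M(2)
          by (simp add: exp_add distrib_left mult_ac flip: ennreal_mult)
      qed simp
    qed
    also have "\<dots> = ennreal (exp (l * t) * M ^ n) * (\<integral>\<^sup>+x. ennreal (exp (l * f x)) * indicator H x \<partial>p)"
      by (rule nn_integral_cmult) simp
    also have "\<dots> \<le> ennreal (exp (l * t) * M ^ n) * ennreal M" by (rule mult_left_mono[OF M(1)]) simp
    also have "\<dots> = ennreal (exp (l * t) * M ^ Suc n)" using M(2) by (simp add: mult_ac flip: ennreal_mult)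
    finally show ?case .
  qed
  then show ?thesis using M(2) by (simp add: measure_pmf.emeasure_eq_measure ennreal_le_iff)
qed

section \<open>The cycle lemma and one big jump\<close>

definition lsum :: "nat list \<Rightarrow> int" where
  "lsum xs = (\<Sum>x\<leftarrow>xs. int x - 1)"

lemma lsum_simps [simp]: "lsum [] = 0" "lsum (x # xs) = int x - 1 + lsum xs" "lsum (xs @ ys) = lsum xs + lsum ys"
  by (simp_all add: lsum_def)

lemma real_lsum: "real_of_int (lsum xs) = (\<Sum>x\<leftarrow>xs. real x - 1)"
  by (induction xs) auto

lemma lsum_take_drop: "lsum (take i xs) + lsum (drop i xs) = lsum xs"
  by (metis append_take_drop_id lsum_simps(3))

lemma lsum_take_add: "lsum (take (k + i) xs) = lsum (take k xs) + lsum (take i (drop k xs))"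
  by (simp add: take_add)

text \<open>The rotated walk runs to the end of the word and then wraps around; only the wrapped
  case picks up the total.\<close>

lemma lsum_take_rotate:
  assumes "k \<le> length xs" "i \<le> length xs"
  shows "lsum (take i (rotate k xs)) =
    (if i \<le> length xs - k then lsum (take (k + i) xs) - lsum (take k xs)
     else lsum xs - lsum (take k xs) + lsum (take (i - (length xs - k)) xs))"
proof (cases "k = length xs")
  case True
  then show ?thesis using assms by (cases "i = 0") auto
next
  case False
  then have "rotate k xs = drop k xs @ take k xs" using assms by (simp add: rotate_drop_take)
  moreover have "i - (length xs - k) \<le> k" using assms by simp
  ultimately show ?thesis using lsum_take_drop[of k xs] lsum_take_add[of k i xs]
    by (auto simp: min_def)
qed

lemma lsum_rotate [simp]: "lsum (rotate k xs) = lsum xs"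
proof -
  have "rotate k xs = drop (k mod length xs) xs @ take (k mod length xs) xs"
    by (rule rotate_drop_take)
  then show ?thesis using lsum_take_drop[of "k mod length xs" xs] by simp
qed

text \<open>The child-count sequences of plane trees in depth-first order are exactly these lists.\<close>

definition excursions :: "nat list set" where
  "excursions = {xs. lsum xs = -1 \<and> (\<forall>i<length xs. 0 \<le> lsum (take i xs))}"

text \<open>Cutting the cyclic word at the first time its walk attains the minimum gives the excursion.\<close>

lemma excursion_rotation_exists:
  assumes "lsum xs = -1"
  shows "\<exists>i<length xs. rotate i xs \<in> excursions"
proof -
  define n s where "n = length xs" and "s = (\<lambda>i. lsum (take i xs))"
  have sn: "s n = -1" "s 0 = 0" using assms by (auto simp: s_def n_def)
  define m where "m = Min (s ` {..n})"
  have m: "\<And>i. i \<le> n \<Longrightarrow> m \<le> s i" "m \<in> s ` {..n}"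
    unfolding m_def by (auto intro: Min_in)
  define k where "k = (LEAST k. k \<le> n \<and> s k = m)"
  have k: "k \<le> n \<and> s k = m" unfolding k_def by (rule LeastI_ex) (use m(2) in auto)
  have kmin: "s i > m" if "i < k" for i
  proof -
    have "i \<le> n" using that k by simp
    moreover have "s i \<noteq> m" using not_less_Least[of i "\<lambda>k. k \<le> n \<and> s k = m"] that k by (auto simp: k_def)
    ultimately show ?thesis using m(1)[of i] by simp
  qed
  have "rotate k xs \<in> excursions"
    unfolding excursions_def
  proof (intro CollectI conjI allI impI)
    show "lsum (rotate k xs) = -1" using assms by simp
    fix i assume i: "i < length (rotate k xs)"
    have eq: "lsum (take i (rotate k xs)) = (if i \<le> n - k then s (k + i) - s k else s n - s k + s (i - (n - k)))"
      unfolding s_def n_def using k i n_def by (subst lsum_take_rotate) auto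
    show "0 \<le> lsum (take i (rotate k xs))"
    proof (cases "i \<le> n - k")
      case True
      then have "m \<le> s (k + i)" using k by (intro m(1)) auto
      then show ?thesis using eq True k by simp
    next
      case False
      then have "i - (n - k) < k" using i k by (simp add: n_def)
      then show ?thesis using eq kmin[of "i - (n - k)"] k False sn by simp
    qed
  qed
  \<comment> \<open>The minimum is at most -1 while the walk starts at 0, so it is first attained in
    1..n; the value n is the trivial rotation and is reported as index 0.\<close>
  moreover have "k \<noteq> 0" using k m(1)[of n] sn by (metis order_refl not_less zero_le_numeral neg_0_le_iff_le not_one_le_zero)
  moreover have "rotate 0 xs = rotate (length xs) xs" by simp
  ultimately show ?thesis using k
    by (cases "k = n") (auto simp: n_def intro: exI[of _ 0] exI[of _ k])
qed

text \<open>The cut points i < j divide the cyclic word into two arcs, each a proper prefix of one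
  of the rotations. Two excursions would give both arcs nonnegative sums, although these add up to
  -1.\<close>

lemma excursion_rotation_unique:
  assumes "rotate i xs \<in> excursions" "i < j" "j < length xs"
  shows "rotate j xs \<notin> excursions"
proof
  assume "rotate j xs \<in> excursions"
  then have "0 \<le> lsum (take (length xs - j + i) (rotate j xs))" "lsum xs = -1"
    using assms by (auto simp: excursions_def)
  moreover have "0 \<le> lsum (take (j - i) (rotate i xs))"
    using assms by (auto simp: excursions_def)
  ultimately show False using assms
    by (cases "i = 0") (simp_all add: lsum_take_rotate split: if_splits)
qed

text \<open>In the applications \<open>zs\<close> consists of the n - 1 letters other than the big
  one; the slope is nevertheless -b/n, because time is rescaled by n.\<close>

definition near_line :: "real \<Rightarrow> nat \<Rightarrow> real \<Rightarrow> nat list \<Rightarrow> bool" where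
  "near_line b n e zs \<longleftrightarrow> (\<forall>i\<le>length zs. \<bar>real_of_int (lsum (take i zs)) + real i * b / real n\<bar> \<le> e * b)"

text \<open>For negative u = -v: exp (-v) <= 1 / (1 + v), and (1 + v) (1 - v + v^2) = 1 + v^3 >=
  1.\<close>

lemma exp_le_quadratic:
  assumes "-1 \<le> u" "u \<le> (1::real)"
  shows "exp u \<le> 1 + u + u\<^sup>2"
proof (cases "0 \<le> u")
  case True
  then show ?thesis using exp_bound[of u] assms by simp
next
  case False
  define v where "v = - u"
  have v: "0 < v" "v \<le> 1" using False assms by (auto simp: v_def)
  have "exp u = inverse (exp v)" by (simp add: v_def exp_minus)
  also have "\<dots> \<le> inverse (1 + v)" using v exp_ge_add_one_self[of v] by (intro le_imp_inverse_le) auto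
  also have "\<dots> \<le> 1 - v + v\<^sup>2"
  proof -
    have "(1 + v) * (1 - v + v\<^sup>2) = 1 + v ^ 3" by (simp add: algebra_simps power2_eq_square power3_eq_cube)
    then have "1 \<le> (1 - v + v\<^sup>2) * (1 + v)" using v by (simp add: mult.commute)
    then show ?thesis using v by (simp add: inverse_eq_divide pos_divide_le_eq)
  qed
  finally show ?thesis by (simp add: v_def)
qed

text \<open>The fourth power beats the cubic ratio of point masses in \<open>p_le\<close> with one
  factor to spare.\<close>

lemma power4_le_exp: assumes "0 \<le> (x::real)" shows "x ^ 4 \<le> 256 * exp x"
proof -
  have "(x / 4) ^ 4 \<le> (1 + x / 4) ^ 4" using assms by (intro power_mono) auto
  also have "\<dots> \<le> exp x" using exp_ge_one_plus_x_over_n_power_n[of 4 x] assms by simp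
  finally show ?thesis by (simp add: power_divide)
qed

section \<open>Exponential bound and comparison of point masses\<close>

context cauchy_offspring
begin

lemma chernoff:
  "\<exists>A\<ge>A0. \<forall>z\<ge>A. \<forall>n t. iid_prob n \<mu> {xs. set xs \<subseteq> {..<z} \<and> - t \<le> real_of_int (lsum xs)}
     \<le> exp (t / real z - 3 / 4 * (real n * g z / real z))"
proof -
  obtain A where A: "A \<ge> A0" "\<forall>y\<ge>A. 4 * Q y \<le> real y * g y" using Q_over_g by blast
  show ?thesis
  proof (intro exI[of _ A] conjI allI impI)
    fix z n t assume z: "z \<ge> A"
    have z2: "real z \<ge> 2" "real z > 0" using z A(1) A0(1) by auto
    \<comment> \<open>For letters below \<open>z\<close> this parameter keeps the exponents in
      [-1, 1], where the quadratic bound applies; the moment is then at most 1 - g/z + Q/z^2 <= 1 -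
      3/4 g/z.\<close>
    define l where "l = 1 / real z"
    define M where "M = exp (- (3 / 4 * (g z / real z)))"
    have l: "0 \<le> l" by (simp add: l_def)
    have "(\<integral>\<^sup>+x. ennreal (exp (l * (real x - 1))) * indicator {..<z} x \<partial>\<mu>) =
       (\<Sum>x<z. ennreal (exp (l * (real x - 1))) * indicator {..<z} x * ennreal (pmf \<mu> x))"
      by (rule nn_integral_measure_pmf_support) auto
    also have "\<dots> = (\<Sum>x<z. ennreal (exp (l * (real x - 1)) * p x))"
      by (intro sum.cong) (auto simp: p_def ennreal_mult)
    also have "\<dots> = ennreal (\<Sum>x<z. exp (l * (real x - 1)) * p x)"
      by (intro sum_ennreal) (simp add: p_nonneg)
    also have "\<dots> \<le> ennreal M"
    proof (rule ennreal_leI)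
      have "(\<Sum>x<z. exp (l * (real x - 1)) * p x) \<le> (\<Sum>x<z. (1 + l * (real x - 1) + (l * (real x - 1))\<^sup>2) * p x)"
      proof (intro sum_mono mult_right_mono exp_le_quadratic)
        fix x assume "x \<in> {..<z}"
        then have "real x - 1 \<le> real z" "- real z \<le> real x - 1" using z2 by auto
        then show "-1 \<le> l * (real x - 1)" "l * (real x - 1) \<le> 1" using z2 by (auto simp: l_def field_simps)
      qed (simp add: p_nonneg)
      also have "\<dots> = (\<Sum>x<z. p x - l * ((1 - real x) * p x) + l\<^sup>2 * ((real x - 1)\<^sup>2 * p x))"
        by (intro sum.cong) (auto simp: algebra_simps power2_eq_square)
      also have "\<dots> = (\<Sum>x<z. p x) - l * g z + l\<^sup>2 * Q z"
        by (simp add: sum.distrib sum_subtractf g_def Q_def sum_distrib_left)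
      also have "\<dots> \<le> 1 - l * g z + l\<^sup>2 * (real z * g z / 4)"
        using T_nonneg[of z] A(2) z l by (intro add_mono diff_mono mult_left_mono) (auto simp: T_def)
      also have "\<dots> = 1 + (- (3 / 4 * (g z / real z)))" using z2 by (simp add: l_def power2_eq_square field_simps)
      also have "\<dots> \<le> M" unfolding M_def by (rule exp_ge_add_one_self)
      finally show "(\<Sum>x<z. exp (l * (real x - 1)) * p x) \<le> M" .
    qed
    finally have "iid_prob n \<mu> {xs. set xs \<subseteq> {..<z} \<and> - t \<le> (\<Sum>x\<leftarrow>xs. real x - 1)} \<le> exp (l * t) * M ^ n"
      by (rule iid_chernoff) (auto simp: M_def l)
    also have "exp (l * t) * M ^ n = exp (t / real z - 3 / 4 * (real n * g z / real z))"
      unfolding M_def by (simp add: l_def field_simps flip: exp_of_nat_mult exp_add)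
    finally show "iid_prob n \<mu> {xs. set xs \<subseteq> {..<z} \<and> - t \<le> real_of_int (lsum xs)}
      \<le> exp (t / real z - 3 / 4 * (real n * g z / real z))" by (simp add: real_lsum)
  qed (use A in auto)
qed

text \<open>With v = x/y, the division by k^2 contributes v^2 and the Potter bound sqrt v <= v,
  which makes the cube. In the other direction the quadratic decay wins, so \<open>p\<close> is
  decreasing up to the factor 8.\<close>

lemma p_le:
  assumes "A0 \<le> y" "y \<le> x"
  shows "p y \<le> 8 * (real x / real y) ^ 3 * p x" "p x \<le> 8 * p y"
proof -
  have yp: "real y > 0" "real x > 0" "real y \<le> real x" using assms A0(1) by auto
  have p: "p y = w y / real y ^ 2" "p x = w x / real x ^ 2" using yp by (auto simp: p_eq)
  define v where "v = real x / real y"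
  have v: "v \<ge> 1" using yp by (simp add: v_def)
  have sv: "sqrt v \<le> v" using v by (intro real_le_lsqrt) (auto simp: power2_eq_square mult_le_cancel_left1)
  have w: "w y \<le> 8 * v * w x" "w x \<le> 8 * v * w y"
  proof -
    have pos: "0 < w x" "0 < w y" using A0(4)[of x] A0(4)[of y] assms by auto
    have "8 * sqrt v * w x \<le> 8 * v * w x" "8 * sqrt v * w y \<le> 8 * v * w y"
      using pos sv by (auto intro!: mult_right_mono)
    then show "w y \<le> 8 * v * w x" "w x \<le> 8 * v * w y"
      using A0(2,3)[OF assms, folded v_def] by linarith+
  qed
  have "w y / real y ^ 2 \<le> 8 * v * w x / real y ^ 2" using w(1) by (rule divide_right_mono) simp
  also have "\<dots> = 8 * v ^ 3 * p x" using yp by (simp add: p v_def power3_eq_cube power2_eq_square)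
  finally show "p y \<le> 8 * (real x / real y) ^ 3 * p x" by (simp add: p v_def)
  have "w x / real x ^ 2 \<le> 8 * v * w y / real x ^ 2" using w(2) by (rule divide_right_mono) simp
  also have "\<dots> = 8 * p y * (1 / v)" using yp by (simp add: p v_def power2_eq_square)
  also have "\<dots> \<le> 8 * p y * 1" using v p_nonneg by (intro mult_left_mono) auto
  finally show "p x \<le> 8 * p y" by (simp add: p)
qed

end

section \<open>Maximal law of large numbers\<close>

context cauchy_scaling
begin

lemma eventually_drift:
  assumes "e > 0"
  shows "\<forall>\<^sub>F n in sequentially. B n - real n * g (\<beta> n) \<le> e * real (\<beta> n)"
proof -
  have "\<forall>\<^sub>F n in sequentially. (B n - real n * g (\<beta> n)) / real (\<beta> n) < e"
    using order_tendstoD(2)[OF drift_lim assms] .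
  then show ?thesis using eventually_\<beta>_ge[of 0]
    by eventually_elim (simp add: pos_divide_less_eq less_imp_le)
qed

text \<open>Letters are truncated at \<open>\<beta> n\<close> and centred. A letter beyond the
  truncation costs n T, the maximal inequality costs a multiple of n Q / B^2, and both vanish; what
  remains is the deterministic discrepancy between the slopes B/n and
  \<open>g (\<beta> n)\<close>.\<close>

lemma maximal_law_of_large_numbers:
  assumes \<eta>: "\<eta> > 0"
  shows "(\<lambda>n. iid_prob (n - 1) \<mu> {zs. \<not> near_line (B n) n \<eta> zs}) \<longlonglongrightarrow> 0"
proof (rule tendsto_sandwich[of "\<lambda>_. 0"])
  have \<eta>4: "\<eta> / 4 > 0" using \<eta> by simp
  show "\<forall>\<^sub>F n in sequentially. iid_prob (n - 1) \<mu> {zs. \<not> near_line (B n) n \<eta> zs} \<le>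
    real n * T (\<beta> n) + 4 / \<eta>\<^sup>2 * (real n * Q (\<beta> n) / real (\<beta> n) ^ 2 * (real (\<beta> n) / B n) ^ 2)"
    using eventually_drift[OF \<eta>4] \<beta>_bounds eventually_\<alpha>_ge[of 1] eventually_gt_at_top[of 0]
  proof eventually_elim
    case (elim n)
    \<comment> \<open>Large letters are replaced by steps 0, not by -1, so that the mean is exactly
      \<open>- g (\<beta> n)\<close>.\<close>
    define h where "h = (\<lambda>x. if x < \<beta> n then real x - 1 else 0)"
    define f where "f = (\<lambda>x. h x + g (\<beta> n))"
    have Bp: "B n > 0" "real (\<beta> n) > 0" using elim by auto
    have hb: "\<bar>h x\<bar> \<le> real (\<beta> n)" for x using Bp by (auto simp: h_def)
    have inth: "integrable (measure_pmf \<mu>) h"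
      using hb by (intro measure_pmf.integrable_const_bound[where B = "real (\<beta> n)"]) auto
    have inth2: "integrable (measure_pmf \<mu>) (\<lambda>x. (h x)\<^sup>2)"
      using hb by (intro measure_pmf.integrable_const_bound[where B = "real (\<beta> n) ^ 2"])
        (auto simp: abs_le_square_iff[symmetric])
    have Eh: "measure_pmf.expectation \<mu> h = - g (\<beta> n)"
    proof -
      have "measure_pmf.expectation \<mu> h = (\<Sum>x<\<beta> n. h x * pmf \<mu> x)"
        by (rule integral_measure_pmf_real) (auto simp: h_def split: if_splits)
      then show ?thesis by (auto simp: g_def p_def h_def sum_negf[symmetric] algebra_simps intro!: sum.cong)
    qed
    have Eh2: "measure_pmf.expectation \<mu> (\<lambda>x. (h x)\<^sup>2) = Q (\<beta> n)"
    proof -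
      have "measure_pmf.expectation \<mu> (\<lambda>x. (h x)\<^sup>2) = (\<Sum>x<\<beta> n. (h x)\<^sup>2 * pmf \<mu> x)"
        by (rule integral_measure_pmf_real) (auto simp: h_def split: if_splits)
      then show ?thesis by (simp add: Q_def p_def h_def)
    qed
    have int: "integrable (measure_pmf \<mu>) f" "integrable (measure_pmf \<mu>) (\<lambda>x. (f x)\<^sup>2)"
      using inth inth2 by (auto simp: f_def power2_sum)
    have Ef: "measure_pmf.expectation \<mu> f = 0" using inth Eh by (simp add: f_def)
    have "measure_pmf.expectation \<mu> (\<lambda>x. (f x)\<^sup>2) = Q (\<beta> n) - (g (\<beta> n))\<^sup>2"
      using inth inth2 Eh Eh2 by (simp add: f_def power2_sum) (simp add: power2_eq_square)
    then have Ef2: "measure_pmf.expectation \<mu> (\<lambda>x. (f x)\<^sup>2) \<le> Q (\<beta> n)" by simp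
    \<comment> \<open>Half of the tolerance is for the fluctuations and half for the drift
      discrepancy; the latter is at most a quarter of \<open>\<eta> * \<beta> n\<close>, and
      \<open>\<beta> n\<close> is at most twice \<open>B n\<close>.\<close>
    define c where "c = \<eta> * B n / 2"
    have c: "c > 0" using \<eta> Bp by (simp add: c_def)
    define E1 where "E1 = {zs. \<exists>x\<in>set zs. x \<in> {\<beta> n..}}"
    define E2 where "E2 = {zs. \<exists>i\<le>n-1. c \<le> \<bar>0 + sum_list (map f (take i zs))\<bar>}"
    have sub: "zs \<in> E1 \<union> E2" if zs: "length zs = n - 1" "zs \<in> {zs. \<not> near_line (B n) n \<eta> zs}" for zs
    proof (rule ccontr)
      assume no: "zs \<notin> E1 \<union> E2"
      then have small: "\<forall>x\<in>set zs. x < \<beta> n" by (auto simp: E1_def not_le)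
      obtain i where i: "i \<le> n - 1" "\<eta> * B n < \<bar>real_of_int (lsum (take i zs)) + real i * B n / real n\<bar>"
        using zs by (auto simp: near_line_def not_le)
      have "sum_list (map f (take i zs)) = (\<Sum>x\<leftarrow>take i zs. (real x - 1) + g (\<beta> n))"
        using small by (intro arg_cong[of _ _ sum_list] map_cong) (auto simp: f_def h_def dest: in_set_takeD)
      also have "\<dots> = real_of_int (lsum (take i zs)) + real i * g (\<beta> n)"
        using i zs(1) by (simp add: sum_list_addf real_lsum sum_list_triv min_def)
      finally have s_eq: "sum_list (map f (take i zs)) = real_of_int (lsum (take i zs)) + real i * g (\<beta> n)" .
      have "\<bar>0 + sum_list (map f (take i zs))\<bar> < c"
        using no i(1) unfolding E2_def not_le[symmetric] by blast
      then have s: "\<bar>real_of_int (lsum (take i zs)) + real i * g (\<beta> n)\<bar> < c"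
        unfolding s_eq by simp
      \<comment> \<open>The slope discrepancy is nonnegative because \<open>g\<close> decreases, so
        the final time n is the worst.\<close>
      have "real i * (B n / real n - g (\<beta> n)) \<le> real n * (B n / real n - g (\<beta> n))"
      proof (rule mult_right_mono)
        show "0 \<le> B n / real n - g (\<beta> n)" using elim g_antimono[of "\<alpha> n" "\<beta> n"] by (simp add: B_def)
      qed (use i in auto)
      also have "\<dots> = B n - real n * g (\<beta> n)" using elim by (simp add: right_diff_distrib)
      also have "\<dots> \<le> \<eta> / 4 * real (\<beta> n)" using elim by simp
      also have "\<dots> \<le> \<eta> / 4 * (2 * B n)" using elim \<eta> by (intro mult_left_mono) auto
      finally have "real i * B n / real n - real i * g (\<beta> n) \<le> c" by (simp add: c_def right_diff_distrib)
      moreover have "0 \<le> real i * (B n / real n - g (\<beta> n))"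
        using elim g_antimono[of "\<alpha> n" "\<beta> n"] by (intro mult_nonneg_nonneg) (auto simp: B_def)
      then have "0 \<le> real i * B n / real n - real i * g (\<beta> n)" by (simp add: right_diff_distrib)
      moreover have "\<bar>l + u\<bar> < 2 * c" if "u - w \<le> c" "0 \<le> u - w" "\<bar>l + w\<bar> < c" for l u w :: real
        using that by linarith
      ultimately have "\<bar>real_of_int (lsum (take i zs)) + real i * B n / real n\<bar> < 2 * c" using s by blast
      then show False using i by (simp add: c_def)
    qed
    have "iid_prob (n - 1) \<mu> {zs. \<not> near_line (B n) n \<eta> zs} \<le> iid_prob (n - 1) \<mu> (E1 \<union> E2)"
      using sub by (rule iid_prob_mono)
    also have "\<dots> \<le> iid_prob (n - 1) \<mu> E1 + iid_prob (n - 1) \<mu> E2"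
      by (rule measure_Un_le) auto
    also have "iid_prob (n - 1) \<mu> E1 \<le> real (n - 1) * T (\<beta> n)"
      unfolding E1_def T_eq_prob by (rule iid_prob_exists_le)
    also have "real (n - 1) * T (\<beta> n) \<le> real n * T (\<beta> n)" using T_nonneg by (intro mult_right_mono) auto
    also have "iid_prob (n - 1) \<mu> E2 \<le> (0\<^sup>2 + real (n - 1) * Q (\<beta> n)) / c\<^sup>2"
      unfolding E2_def by (rule kolmogorov_maximal[OF int Ef Ef2 c])
    also have "\<dots> \<le> real n * Q (\<beta> n) / c\<^sup>2"
      by (intro divide_right_mono) (auto simp: Q_def p_nonneg sum_nonneg mult_right_mono)
    also have "\<dots> = 4 / \<eta>\<^sup>2 * (real n * Q (\<beta> n) / real (\<beta> n) ^ 2 * (real (\<beta> n) / B n) ^ 2)"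
      using Bp \<eta> by (simp add: c_def power2_eq_square mult_ac)
    finally show ?case by simp
  qed
  have "(\<lambda>n. real n * T (\<beta> n) + 4 / \<eta>\<^sup>2 * (real n * Q (\<beta> n) / real (\<beta> n) ^ 2 * (real (\<beta> n) / B n) ^ 2)) \<longlonglongrightarrow>
     0 + 4 / \<eta>\<^sup>2 * (0 * 1 ^ 2)"
    by (intro tendsto_intros T_\<beta>_lim Q_\<beta>_lim \<beta>_over_B)
  then show "(\<lambda>n. real n * T (\<beta> n) + 4 / \<eta>\<^sup>2 * (real n * Q (\<beta> n) / real (\<beta> n) ^ 2 * (real (\<beta> n) / B n) ^ 2)) \<longlonglongrightarrow> 0"
    by simp
qed auto

end

lemma rotate_to_front:
  assumes "x \<in> set xs"
  shows "\<exists>i<length xs. hd (rotate i xs) = x"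
proof -
  obtain i where i: "i < length xs" "xs ! i = x" using assms by (auto simp: in_set_conv_nth)
  then have "hd (rotate i xs) = x" by (subst hd_rotate_conv_nth) auto
  then show ?thesis using i by blast
qed

section \<open>Bridges without a big letter\<close>

context cauchy_scaling
begin

text \<open>Singling out one letter leaves n - 1 others. The value 8/9 makes the exponent in
  \<open>dyadic_block\<close> equal to 3/4 * 8/9 * 1/2 = 1/3.\<close>

lemma eventually_drift_pred: "\<forall>\<^sub>F n in sequentially. 8 / 9 * real (\<beta> n) \<le> real (n - 1) * g (\<beta> n)"
proof -
  have "\<forall>\<^sub>F n in sequentially. g (\<beta> n) < 1"
    by (rule order_tendstoD(2)[OF filterlim_compose[OF lim_g \<beta>_at_top]]) simp
  moreover have "\<forall>\<^sub>F n in sequentially. B n - real n * g (\<beta> n) \<le> 1 / 100 * real (\<beta> n)"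
    by (rule eventually_drift) simp
  ultimately show ?thesis using \<beta>_bounds eventually_\<beta>_ge[of 100] eventually_gt_at_top[of 0]
  proof eventually_elim
    case (elim n)
    have "real (n - 1) * g (\<beta> n) = real n * g (\<beta> n) - g (\<beta> n)"
      using elim by (simp add: of_nat_diff left_diff_distrib)
    then show ?case using elim by linarith
  qed
qed

text \<open>Let v be the ratio of \<open>\<beta> n\<close> to y. The large letter has point mass at
  most 64 v^3 \<open>p (\<beta> n)\<close> and the others contribute exp (1 - v/3). Since v^3 exp (1
  - v/3) is at most of order 1/v, the bound is proportional to y and the blocks add up
  geometrically.\<close>

lemma dyadic_block:
  "\<exists>A\<ge>A0. \<forall>\<^sub>F n in sequentially. \<forall>y\<ge>A. 2 * y \<le> \<beta> n \<longrightarrow>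
     iid_prob n \<mu> {xs. lsum xs = -1 \<and> (\<forall>x\<in>set xs. x < 2 * y) \<and> (\<exists>x\<in>set xs. y \<le> x)}
       \<le> 10 ^ 7 * (real n * p (\<beta> n)) * (real y / real (\<beta> n))"
proof -
  obtain A where A: "A \<ge> A0" "\<forall>z\<ge>A. \<forall>n t. iid_prob n \<mu> {xs. set xs \<subseteq> {..<z} \<and> - t \<le> real_of_int (lsum xs)}
     \<le> exp (t / real z - 3 / 4 * (real n * g z / real z))" using chernoff by blast
  have "\<forall>\<^sub>F n in sequentially. \<forall>y\<ge>A. 2 * y \<le> \<beta> n \<longrightarrow>
     iid_prob n \<mu> {xs. lsum xs = -1 \<and> (\<forall>x\<in>set xs. x < 2 * y) \<and> (\<exists>x\<in>set xs. y \<le> x)}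
       \<le> 10 ^ 7 * (real n * p (\<beta> n)) * (real y / real (\<beta> n))"
    using eventually_drift_pred eventually_gt_at_top[of 0]
  proof eventually_elim
    case (elim n)
    show ?case
    proof (intro allI impI)
      fix y assume y: "y \<ge> A" "2 * y \<le> \<beta> n"
      have y2: "y \<ge> 2" "y \<ge> A0" using y A A0(1) by auto
      have yp: "real y > 0" "real (\<beta> n) > 0" using y2 y by auto
      define m where "m = n - 1"
      have nm: "n = Suc m" using elim by (simp add: m_def)
      define v where "v = real (\<beta> n) / real y"
      have "real (2 * y) \<le> real (\<beta> n)" using y by (subst of_nat_le_iff)
      then have v: "v \<ge> 2" using yp by (simp add: v_def field_simps)
      define Z where "Z = {xs. lsum xs = -1 \<and> (\<forall>x\<in>set xs. x < 2 * y) \<and> y \<le> hd xs \<and> xs \<noteq> []}"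
      \<comment> \<open>The first letter is below 2y and the total is -1, so the others sum to at
        least -2y; in the exponential bound at scale 2y this costs only the factor exp 1.\<close>
      define R where "R = {xs. set xs \<subseteq> {..<2 * y} \<and> - real (2 * y) \<le> real_of_int (lsum xs)}"
      have "iid_prob n \<mu> {xs. lsum xs = -1 \<and> (\<forall>x\<in>set xs. x < 2 * y) \<and> (\<exists>x\<in>set xs. y \<le> x)}
        \<le> iid_prob n \<mu> {xs. \<exists>i<n. rotate i xs \<in> Z}"
      proof (rule iid_prob_mono, unfold mem_Collect_eq)
        fix xs :: "nat list" assume len: "length xs = n"
          and xs: "lsum xs = -1 \<and> (\<forall>x\<in>set xs. x < 2 * y) \<and> (\<exists>x\<in>set xs. y \<le> x)"
        then obtain x where "x \<in> set xs" "y \<le> x" by blast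
        then obtain i where "i < length xs" "y \<le> hd (rotate i xs)" using rotate_to_front by metis
        then show "\<exists>i<n. rotate i xs \<in> Z" using len xs by (intro exI[of _ i]) (auto simp: Z_def)
      qed
      also have "\<dots> \<le> real n * iid_prob n \<mu> Z" by (rule iid_prob_some_rotation_le)
      finally have 1: "iid_prob n \<mu> {xs. lsum xs = -1 \<and> (\<forall>x\<in>set xs. x < 2 * y) \<and> (\<exists>x\<in>set xs. y \<le> x)}
        \<le> real n * iid_prob n \<mu> Z" .
      have 2: "iid_prob n \<mu> Z \<le> (8 * p y) * iid_prob m \<mu> R"
        unfolding nm
      proof (rule iid_prob_first_le)
        fix x xs assume Z: "x # xs \<in> Z"
        then have x: "y \<le> x" "x < 2 * y" "lsum xs = - int x" by (auto simp: Z_def)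
        show "pmf \<mu> x \<le> 8 * p y" using p_le(2)[of y x] y2 x by (simp add: p_def)
        show "xs \<in> R" using Z x by (auto simp: Z_def R_def)
        fix x' assume Z': "x' # xs \<in> Z"
        then show "x = x'" using Z by (auto simp: Z_def)
      qed (simp add: p_nonneg)
      have 3: "p y \<le> 8 * v ^ 3 * p (\<beta> n)" using p_le(1)[of y "\<beta> n"] y2 y by (simp add: v_def)
      have 4: "iid_prob m \<mu> R \<le> exp (1 - v / 3)"
      proof -
        have "iid_prob m \<mu> R \<le> exp (real (2 * y) / real (2 * y) - 3 / 4 * (real m * g (2 * y) / real (2 * y)))"
          unfolding R_def by (rule A(2)[rule_format]) (use y in simp)
        also have "\<dots> \<le> exp (1 - v / 3)"
        proof -
          have "8 / 9 * real (\<beta> n) \<le> real m * g (\<beta> n)" using elim by (simp add: m_def)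
          also have "\<dots> \<le> real m * g (2 * y)" using y y2 by (intro mult_left_mono g_antimono) auto
          finally have "8 / 9 * real (\<beta> n) / real (2 * y) \<le> real m * g (2 * y) / real (2 * y)"
            by (rule divide_right_mono) simp
          then have "4 / 9 * v \<le> real m * g (2 * y) / real (2 * y)" by (simp add: v_def)
          then show ?thesis using yp by simp
        qed
        finally show ?thesis .
      qed
      have "(8 * p y) * iid_prob m \<mu> R \<le> (8 * (8 * v ^ 3 * p (\<beta> n))) * exp (1 - v / 3)"
        using 3 4 v p_nonneg by (intro mult_mono) auto
      with 2 have "iid_prob n \<mu> Z \<le> (8 * (8 * v ^ 3 * p (\<beta> n))) * exp (1 - v / 3)" by linarith
      then have "real n * iid_prob n \<mu> Z \<le> real n * (8 * (8 * v ^ 3 * p (\<beta> n)) * exp (1 - v / 3))"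
        by (rule mult_left_mono) simp
      with 1 have "iid_prob n \<mu> {xs. lsum xs = -1 \<and> (\<forall>x\<in>set xs. x < 2 * y) \<and> (\<exists>x\<in>set xs. y \<le> x)}
        \<le> real n * (8 * (8 * v ^ 3 * p (\<beta> n)) * exp (1 - v / 3))" by linarith
      \<comment> \<open>20736 = 256 * 3^4, and exp 1 <= 3 gives 62208 = 3 * 20736; later 64 * 62208
        < 10^7.\<close>
      also have "v ^ 3 * exp (1 - v / 3) \<le> 62208 / v"
      proof -
        have "(v / 3) ^ 4 \<le> 256 * exp (v / 3)" using v by (intro power4_le_exp) simp
        then have "v ^ 4 \<le> 20736 * exp (v / 3)" by (simp add: power_divide)
        then have "v ^ 4 * exp (1 - v / 3) \<le> 20736 * exp (v / 3) * exp (1 - v / 3)"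
          by (rule mult_right_mono) simp
        also have "\<dots> = 20736 * exp 1" by (simp add: mult.assoc flip: exp_add)
        also have "\<dots> \<le> 62208" using exp_le by simp
        finally have "v * (v ^ 3 * exp (1 - v / 3)) \<le> 62208" by (simp add: power_numeral_reduce mult.assoc)
        then show ?thesis using v by (simp add: pos_le_divide_eq mult.commute)
      qed
      then have "real n * (8 * (8 * v ^ 3 * p (\<beta> n)) * exp (1 - v / 3)) \<le> real n * (64 * p (\<beta> n) * (62208 / v))"
      proof -
        assume le: "v ^ 3 * exp (1 - v / 3) \<le> 62208 / v"
        have "(64 * (real n * p (\<beta> n))) * (v ^ 3 * exp (1 - v / 3)) \<le> (64 * (real n * p (\<beta> n))) * (62208 / v)"
          by (rule mult_left_mono[OF le]) (simp add: p_nonneg)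
        then show ?thesis by (simp add: mult_ac)
      qed
      also have "\<dots> \<le> 10 ^ 7 * (real n * p (\<beta> n)) * (real y / real (\<beta> n))"
        using p_nonneg by (simp add: v_def mult_left_mono divide_right_mono)
      finally show "iid_prob n \<mu> {xs. lsum xs = -1 \<and> (\<forall>x\<in>set xs. x < 2 * y) \<and> (\<exists>x\<in>set xs. y \<le> x)}
        \<le> 10 ^ 7 * (real n * p (\<beta> n)) * (real y / real (\<beta> n))" .
    qed
  qed
  then show ?thesis using A(1) by blast
qed

lemma eventually_\<beta>_le_n: "\<forall>\<^sub>F n in sequentially. \<beta> n \<le> n"
proof -
  have "\<forall>\<^sub>F n in sequentially. B n / real n < 1 / 2" by (rule order_tendstoD(2)[OF B_over_n_lim]) simp
  then show ?thesis using \<beta>_bounds eventually_gt_at_top[of 2]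
  proof eventually_elim
    case (elim n)
    then have "B n < real n / 2" by (simp add: pos_divide_less_eq)
    then show ?case using elim by linarith
  qed
qed

text \<open>The start of the dyadic induction. For a fixed bound on the letters the probability
  decays exponentially in n, whereas \<open>p (\<beta> n)\<close> decays at most polynomially,
  because \<open>\<beta> n \<le> n\<close>.\<close>

lemma bounded_steps_negligible:
  assumes z: "z \<ge> 2" "\<And>n t. iid_prob n \<mu> {xs. set xs \<subseteq> {..<z} \<and> - t \<le> real_of_int (lsum xs)}
     \<le> exp (t / real z - 3 / 4 * (real n * g z / real z))"
    and e: "e > 0"
  shows "\<forall>\<^sub>F n in sequentially. iid_prob n \<mu> {xs. lsum xs = -1 \<and> (\<forall>x\<in>set xs. x < z)} \<le> e * (real n * p (\<beta> n))"
proof -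
  define c where "c = 3 / 4 * (g z / real z)"
  have c: "c > 0" using g_pos[of z] z by (simp add: c_def)
  \<comment> \<open>The constant in the lower bound K / (\<open>\<beta> n\<close>)^3 for
    \<open>p (\<beta> n)\<close>, read off from \<open>p_le\<close> with y =
    \<open>A0\<close>.\<close>
  define K where "K = p A0 * real A0 ^ 3 / 8"
  have A0p: "real A0 > 0" using A0(1) by simp
  have K: "K > 0" using p_pos[of A0] A0p by (simp add: K_def)
  obtain N :: nat where N: "256 * exp 1 / (c ^ 4 * e * K) \<le> real N" using real_arch_simple by blast
  show ?thesis using eventually_\<beta>_ge[of A0] eventually_\<beta>_le_n eventually_ge_at_top[of "max N 1"]
  proof eventually_elim
    case (elim n)
    then have n: "real n \<ge> 1" "n \<ge> N" and \<beta>n: "real (\<beta> n) \<le> real n" "real (\<beta> n) > 0" by auto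
    have "iid_prob n \<mu> {xs. lsum xs = -1 \<and> (\<forall>x\<in>set xs. x < z)} \<le>
        iid_prob n \<mu> {xs. set xs \<subseteq> {..<z} \<and> - 1 \<le> real_of_int (lsum xs)}"
      by (rule iid_prob_mono) auto
    also have "\<dots> \<le> exp (1 / real z - 3 / 4 * (real n * g z / real z))" by (rule z(2))
    also have "\<dots> \<le> exp (1 - c * real n)" using z(1) by (simp add: c_def mult_ac)
    also have "\<dots> = exp 1 / exp (c * real n)" by (rule exp_diff)
    also have "\<dots> \<le> exp 1 / ((c * real n) ^ 4 / 256)"
      using power4_le_exp[of "c * real n"] c n by (intro divide_left_mono) auto
    also have "\<dots> = 256 * exp 1 / c ^ 4 / real n ^ 4" by (simp add: power_mult_distrib)
    also have "\<dots> \<le> e * K * real N / real n ^ 4"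
      using N c e K by (intro divide_right_mono) (auto simp: field_simps)
    also have "\<dots> \<le> e * K * real n ^ 2 / real n ^ 4"
    proof (intro divide_right_mono mult_left_mono)
      have "real N \<le> real n" using n by simp
      also have "\<dots> \<le> real n ^ 2" using n by (simp add: power2_eq_square)
      finally show "real N \<le> real n ^ 2" .
    qed (use e K in auto)
    also have "\<dots> = e * (real n * (K / real n ^ 3))" using n by (simp add: field_simps eval_nat_numeral)
    also have "\<dots> \<le> e * (real n * p (\<beta> n))"
    proof (intro mult_left_mono)
      have "K / real n ^ 3 \<le> K / real (\<beta> n) ^ 3"
        using K \<beta>n n by (intro divide_left_mono power_mono) auto
      also have "\<dots> \<le> p (\<beta> n)"
        using p_le(1)[of A0 "\<beta> n"] elim A0p \<beta>n by (simp add: K_def field_simps power_divide)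
      finally show "K / real n ^ 3 \<le> p (\<beta> n)" .
    qed (use e in auto)
    finally show ?case .
  qed
qed

text \<open>The block bounds double with the level, so their sum is of the order of the last one and
  proportional to \<open>\<delta>\<close>. The induction reaches powers of two only, whence a
  \<open>D\<close> known up to a factor 2.\<close>

lemma no_big_jump_negligible:
  assumes \<delta>: "0 < \<delta>" "\<delta> \<le> 1"
  shows "\<forall>\<^sub>F n in sequentially. \<exists>D. \<delta> / 2 * real (\<beta> n) \<le> real D \<and> D \<le> \<beta> n \<and>
    iid_prob n \<mu> {xs. lsum xs = -1 \<and> (\<forall>x\<in>set xs. x < D)} \<le> (10 ^ 7 + 1) * \<delta> * (real n * p (\<beta> n))"
proof -
  obtain A where A: "A \<ge> A0" "\<forall>\<^sub>F n in sequentially. \<forall>y\<ge>A. 2 * y \<le> \<beta> n \<longrightarrow>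
     iid_prob n \<mu> {xs. lsum xs = -1 \<and> (\<forall>x\<in>set xs. x < 2 * y) \<and> (\<exists>x\<in>set xs. y \<le> x)}
       \<le> 10 ^ 7 * (real n * p (\<beta> n)) * (real y / real (\<beta> n))" using dyadic_block by blast
  obtain A' where A': "A' \<ge> A0" "\<forall>z\<ge>A'. \<forall>n t. iid_prob n \<mu> {xs. set xs \<subseteq> {..<z} \<and> - t \<le> real_of_int (lsum xs)}
     \<le> exp (t / real z - 3 / 4 * (real n * g z / real z))" using chernoff by blast
  define j0 where "j0 = max A A'"
  have "j0 < 2 ^ j0" by (rule less_exp)
  moreover have "A \<le> j0" "A' \<le> j0" by (simp_all add: j0_def)
  ultimately have j0: "2 ^ j0 \<ge> A" "2 ^ j0 \<ge> A'" by linarith+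
  have z2: "(2::nat) ^ j0 \<ge> 2" using j0 A A0(1) by linarith
  show ?thesis
    using A(2) bounded_steps_negligible[OF z2 A'(2)[rule_format, OF j0(2)] \<delta>(1)] eventually_\<beta>_ge[of "nat \<lceil>2 ^ Suc j0 / \<delta>\<rceil>"]
  proof eventually_elim
    case (elim n)
    have \<beta>: "2 ^ Suc j0 \<le> \<delta> * real (\<beta> n)" "real (\<beta> n) > 0"
    proof -
      have "2 ^ Suc j0 / \<delta> \<le> real (\<beta> n)" using elim(3) by linarith
      then show "2 ^ Suc j0 \<le> \<delta> * real (\<beta> n)" using \<delta> by (simp add: pos_divide_le_eq mult.commute)
      show "real (\<beta> n) > 0" using elim(3) by linarith
    qed
    define P where "P = (\<lambda>J. iid_prob n \<mu> {xs. lsum xs = -1 \<and> (\<forall>x\<in>set xs. x < 2 ^ J)})"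
    \<comment> \<open>The first summand accounts for words with all letters below 2^j0. The second
      makes the induction step exact, as 2^J + 2^J = 2^(J+1).\<close>
    have P: "P J \<le> \<delta> * (real n * p (\<beta> n)) + 10 ^ 7 * (real n * p (\<beta> n)) * (2 ^ J / real (\<beta> n))"
      if "j0 \<le> J" "2 ^ J \<le> \<beta> n" for J
      using that
    proof (induction J rule: dec_induct)
      case base
      show ?case using elim(2) p_nonneg[of "\<beta> n"] by (simp add: P_def add_increasing2)
    next
      case (step J)
      have J: "2 ^ J \<ge> A" using j0(1) step.hyps(1) power_increasing[of j0 J "2::nat"] by linarith
      have "P (Suc J) \<le> iid_prob n \<mu> ({xs. lsum xs = -1 \<and> (\<forall>x\<in>set xs. x < 2 ^ J)} \<union>
          {xs. lsum xs = -1 \<and> (\<forall>x\<in>set xs. x < 2 * 2 ^ J) \<and> (\<exists>x\<in>set xs. 2 ^ J \<le> x)})"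
        unfolding P_def by (rule iid_prob_mono) (auto simp: not_le)
      also have "\<dots> \<le> P J + iid_prob n \<mu> {xs. lsum xs = -1 \<and> (\<forall>x\<in>set xs. x < 2 * 2 ^ J) \<and> (\<exists>x\<in>set xs. 2 ^ J \<le> x)}"
        unfolding P_def by (rule measure_Un_le) auto
      also have "iid_prob n \<mu> {xs. lsum xs = -1 \<and> (\<forall>x\<in>set xs. x < 2 * 2 ^ J) \<and> (\<exists>x\<in>set xs. 2 ^ J \<le> x)} \<le>
          10 ^ 7 * (real n * p (\<beta> n)) * (real (2 ^ J) / real (\<beta> n))"
        by (rule elim(1)[rule_format]) (use J step.prems in simp_all)
      also have "P J \<le> \<delta> * (real n * p (\<beta> n)) + 10 ^ 7 * (real n * p (\<beta> n)) * (2 ^ J / real (\<beta> n))"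
        using step.prems by (intro step.IH) simp
      finally show ?case by simp
    qed
    have "\<delta> * real (\<beta> n) \<ge> 1" using \<beta>(1) by (smt (verit) two_realpow_ge_one)
    then have "nat \<lfloor>\<delta> * real (\<beta> n)\<rfloor> \<ge> 1" by linarith
    then obtain J where J: "2 ^ J \<le> nat \<lfloor>\<delta> * real (\<beta> n)\<rfloor>" "nat \<lfloor>\<delta> * real (\<beta> n)\<rfloor> < 2 ^ (J + 1)"
      using ex_power_ivl1[of 2 "nat \<lfloor>\<delta> * real (\<beta> n)\<rfloor>"] by auto
    have J1: "real (2 ^ J) \<le> \<delta> * real (\<beta> n)" using J(1) \<open>\<delta> * real (\<beta> n) \<ge> 1\<close> by linarith
    have J2: "\<delta> * real (\<beta> n) < real (2 ^ (J + 1))" using J(2) by linarith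
    have "(2::real) ^ Suc j0 < 2 ^ (J + 1)" by (rule le_less_trans[OF \<beta>(1)]) (use J2 in simp)
    then have "Suc j0 < J + 1" by (rule power_less_imp_less_exp[rotated]) simp
    then have "j0 \<le> J" by simp
    have D: "real (2 ^ J) \<le> real (\<beta> n)"
      using J1 mult_right_mono[OF \<delta>(2), of "real (\<beta> n)"] by linarith
    then have "2 ^ J \<le> \<beta> n" by (simp only: of_nat_le_iff)
    show ?case
    proof (intro exI[of _ "2 ^ J"] conjI)
      show "\<delta> / 2 * real (\<beta> n) \<le> real (2 ^ J)" using J2 by simp
      show "2 ^ J \<le> \<beta> n" by fact
      have "P J \<le> \<delta> * (real n * p (\<beta> n)) + 10 ^ 7 * (real n * p (\<beta> n)) * (2 ^ J / real (\<beta> n))"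
        by (rule P) fact+
      also have "\<dots> \<le> \<delta> * (real n * p (\<beta> n)) + 10 ^ 7 * (real n * p (\<beta> n)) * \<delta>"
        using J1 \<beta> p_nonneg by (intro add_left_mono mult_left_mono) (auto simp: pos_divide_le_eq)
      finally show "iid_prob n \<mu> {xs. lsum xs = -1 \<and> (\<forall>x\<in>set xs. x < 2 ^ J)} \<le> (10 ^ 7 + 1) * \<delta> * (real n * p (\<beta> n))"
        by (simp add: P_def algebra_simps)
    qed
  qed
qed

end

lemma rotate_rotate_ex:
  assumes "i < length xs" "j < length xs"
  shows "\<exists>k<length xs. rotate i xs = rotate k (rotate j xs)"
proof (intro exI conjI)
  have "rotate (i + (length xs - j) + j) xs = rotate i xs"
    using assms by (subst (1 2) rotate_conv_mod) simp
  then show "rotate i xs = rotate ((i + (length xs - j)) mod length xs) (rotate j xs)"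
    using rotate_conv_mod[of "i + (length xs - j)" "rotate j xs"] by (simp add: rotate_rotate)
  show "(i + (length xs - j)) mod length xs < length xs"
    by (rule mod_less_divisor) (use assms in linarith)
qed

section \<open>Lower bounds for bridges and excursions, and the one big jump\<close>

context cauchy_scaling
begin

lemma p_near_\<beta>:
  assumes "A0 \<le> x" "A0 \<le> \<beta> n" "x \<le> 2 * \<beta> n"
  shows "p (\<beta> n) \<le> 32 * p x"
proof (cases "x \<le> \<beta> n")
  case True
  then show ?thesis using p_le(2)[of x "\<beta> n"] assms p_nonneg[of x] by linarith
next
  case False
  then have x: "w (\<beta> n) \<le> 8 * w x" "real x > 0" "real (\<beta> n) > 0"
    using A0(5)[of "\<beta> n" x] assms A0(1) by auto
  have "p (\<beta> n) = w (\<beta> n) / real (\<beta> n) ^ 2" using x by (simp add: p_eq)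
  also have "\<dots> \<le> 8 * w x / real (\<beta> n) ^ 2" using x by (intro divide_right_mono) auto
  also have "\<dots> = 8 * p x * (real x / real (\<beta> n)) ^ 2" using x by (simp add: w_def power_divide)
  also have "\<dots> \<le> 8 * p x * 2 ^ 2"
  proof (intro mult_left_mono power_mono)
    have "real x \<le> real (2 * \<beta> n)" using assms by (subst of_nat_le_iff)
    then show "real x / real (\<beta> n) \<le> 2" using x by (simp add: pos_divide_le_eq)
  qed (use p_nonneg in auto)
  finally show ?thesis by simp
qed

text \<open>Half of \<open>\<beta> n\<close> will separate the big letter of a bridge from the
  others; the chance that one of the others reaches it is below 1/4.\<close>

lemma T_half_\<beta>: "\<forall>\<^sub>F n in sequentially. real n * T (nat \<lceil>real (\<beta> n) / 2\<rceil>) < 1 / 4"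
proof -
  have "\<forall>\<^sub>F n in sequentially. real n * w (\<beta> n) / real (\<beta> n) < 1 / 4096"
    by (rule order_tendstoD(2)[OF w_\<beta>_lim]) simp
  then show ?thesis using eventually_\<beta>_ge[of "2 * A0"]
  proof eventually_elim
    case (elim n)
    define d where "d = nat \<lceil>real (\<beta> n) / 2\<rceil>"
    have d: "real (\<beta> n) / 2 \<le> real d" "d \<le> \<beta> n" unfolding d_def by linarith+
    have dA: "d \<ge> A0" using d elim by linarith
    have pos: "real d > 0" "real (\<beta> n) > 0" using dA A0(1) elim by auto
    have wp: "w (\<beta> n) > 0" using A0(4) elim by simp
    have "sqrt (real (\<beta> n) / real d) \<le> 2"
      using d pos by (intro real_le_lsqrt) (auto simp: pos_divide_le_eq)
    then have "8 * sqrt (real (\<beta> n) / real d) * w (\<beta> n) \<le> 8 * 2 * w (\<beta> n)"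
      using wp by (intro mult_right_mono mult_left_mono) auto
    then have wd: "w d \<le> 16 * w (\<beta> n)" using A0(3)[OF dA d(2)] by linarith
    have "T d \<le> 32 * w d / real d" by (rule T_le[OF dA])
    also have "\<dots> \<le> 32 * (16 * w (\<beta> n)) / (real (\<beta> n) / 2)"
      using wd wp d pos by (intro frac_le) auto
    finally have "real n * T d \<le> real n * (32 * (16 * w (\<beta> n)) / (real (\<beta> n) / 2))"
      by (rule mult_left_mono) simp
    also have "\<dots> = 1024 * (real n * w (\<beta> n) / real (\<beta> n))" by simp
    finally show ?case using elim unfolding d_def by linarith
  qed
qed

text \<open>The bridges counted have one letter at least d, the others staying below d and near the
  line. The others behave so with probability at least 1 - 1/4 - 1/4; the remaining letter is then
  forced, lies between d and \<open>2 * \<beta> n\<close>, and has point mass at least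
  \<open>p (\<beta> n) / 32\<close>.\<close>

lemma bridge_lower_bound:
  "\<forall>\<^sub>F n in sequentially. real n * p (\<beta> n) / 64 \<le> iid_prob n \<mu> {xs. lsum xs = -1}"
proof -
  have "\<forall>\<^sub>F n in sequentially. iid_prob (n - 1) \<mu> {zs. \<not> near_line (B n) n (1/8) zs} < 1 / 4"
    by (rule order_tendstoD(2)[OF maximal_law_of_large_numbers]) simp_all
  then show ?thesis
    using T_half_\<beta> \<beta>_bounds eventually_\<beta>_le_n eventually_\<beta>_ge[of "2 * A0 + 100"]
  proof eventually_elim
    case (elim n)
    define d where "d = nat \<lceil>real (\<beta> n) / 2\<rceil>"
    define m where "m = n - 1"
    have nm: "n = Suc m" using elim by (simp add: m_def)
    have d: "real (\<beta> n) / 2 \<le> real d" "real d \<le> real (\<beta> n) / 2 + 1" "A0 \<le> d"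
      using elim(5) unfolding d_def by linarith+
    define R where "R = {zs. near_line (B n) n (1/8) zs \<and> (\<forall>x\<in>set zs. x < d)}"
    \<comment> \<open>Exactly one letter reaches \<open>d\<close>, so two different rotations of a
      word cannot both lie in \<open>Z\<close>, and a full factor n is gained.\<close>
    define Z where "Z = {xs. lsum xs = -1 \<and> xs \<noteq> [] \<and> d \<le> hd xs \<and> (\<forall>x\<in>set (tl xs). x < d)}"
    have "iid_prob m \<mu> UNIV \<le> iid_prob m \<mu> (R \<union> ({zs. \<not> near_line (B n) n (1/8) zs} \<union> {zs. \<exists>x\<in>set zs. x \<in> {d..}}))"
      by (rule iid_prob_mono) (auto simp: R_def not_less)
    also have "\<dots> \<le> iid_prob m \<mu> R + iid_prob m \<mu> ({zs. \<not> near_line (B n) n (1/8) zs} \<union> {zs. \<exists>x\<in>set zs. x \<in> {d..}})"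
      by (rule measure_Un_le) auto
    also have "iid_prob m \<mu> ({zs. \<not> near_line (B n) n (1/8) zs} \<union> {zs. \<exists>x\<in>set zs. x \<in> {d..}}) \<le>
        iid_prob m \<mu> {zs. \<not> near_line (B n) n (1/8) zs} + iid_prob m \<mu> {zs. \<exists>x\<in>set zs. x \<in> {d..}}"
      by (rule measure_Un_le) auto
    also have "iid_prob m \<mu> {zs. \<exists>x\<in>set zs. x \<in> {d..}} \<le> real m * T d"
      unfolding T_eq_prob by (rule iid_prob_exists_le)
    also have "real m * T d \<le> real n * T d" using T_nonneg by (intro mult_right_mono) (auto simp: m_def)
    finally have R: "1 / 2 \<le> iid_prob m \<mu> R" using elim(1,2) by (simp add: d_def m_def)
    have "p (\<beta> n) / 32 * iid_prob m \<mu> R \<le> iid_prob (Suc m) \<mu> Z"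
    proof (rule iid_prob_first_ge)
      fix zs assume len: "length zs = m" and zs: "zs \<in> R"
      define x where "x = - real_of_int (lsum zs)"
      have "\<bar>real_of_int (lsum (take m zs)) + real m * B n / real n\<bar> \<le> 1 / 8 * B n"
        using zs len unfolding R_def near_line_def by blast
      then have "\<bar>- x + real m * B n / real n\<bar> \<le> B n / 8" using len by (simp add: x_def)
      \<comment> \<open>The missing letter costs only \<open>B n / n\<close> of the descent, which
        is at most 1 because \<open>\<beta> n \<le> n\<close>.\<close>
      moreover have "real m * B n / real n = B n - B n / real n"
        using nm by (simp add: field_simps)
      moreover have "0 \<le> B n / real n" "B n / real n \<le> 1" using elim(3,4) nm by auto
      moreover have "real d \<le> x \<and> x \<le> real (2 * \<beta> n)"
        if "\<bar>- x + u\<bar> \<le> B n / 8" "u = B n - r" "0 \<le> r" "r \<le> 1" for u r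
        using that elim(3,5) d by linarith
      ultimately have x: "real d \<le> x" "x \<le> real (2 * \<beta> n)" by blast+
      define k where "k = nat (- lsum zs)"
      have k: "int k = - lsum zs" "real k = x" using x unfolding k_def x_def by linarith+
      have kd: "d \<le> k" "k \<le> 2 * \<beta> n" using x k(2) by (metis of_nat_le_iff)+
      have "k # zs \<in> Z" using zs k kd by (auto simp: Z_def R_def)
      moreover have "p (\<beta> n) / 32 \<le> pmf \<mu> k"
        using p_near_\<beta>[of k n] kd d elim(5) by (simp add: p_def)
      ultimately show "\<exists>x. x # zs \<in> Z \<and> p (\<beta> n) / 32 \<le> pmf \<mu> x" by blast
    qed (simp add: p_nonneg)
    then have "p (\<beta> n) / 32 * iid_prob m \<mu> R \<le> iid_prob n \<mu> Z" by (simp only: nm[symmetric])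
    moreover have "p (\<beta> n) / 32 * (1 / 2) \<le> p (\<beta> n) / 32 * iid_prob m \<mu> R"
      using R p_nonneg by (intro mult_left_mono) auto
    ultimately have "p (\<beta> n) / 64 \<le> iid_prob n \<mu> Z" by linarith
    then have "real n * (p (\<beta> n) / 64) \<le> real n * iid_prob n \<mu> Z" by (rule mult_left_mono) simp
    also have "\<dots> = iid_prob n \<mu> {xs. \<exists>i<n. rotate i xs \<in> Z}"
    proof (rule iid_prob_some_rotation_eq[symmetric])
      fix xs :: "nat list" and i j
      assume len: "length xs = n" and ij: "i < j" "j < n" and i: "rotate i xs \<in> Z"
      have "hd (rotate i xs) = xs ! i" using ij len by (subst hd_rotate_conv_nth) auto
      then have "d \<le> xs ! i" using i by (simp add: Z_def)
      moreover have "rotate j xs = xs ! j # drop (Suc j) xs @ take j xs"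
        using ij len by (simp add: rotate_drop_take Cons_nth_drop_Suc[symmetric])
      moreover have "xs ! i \<in> set (take j xs)" using ij len by (auto simp: in_set_conv_nth intro!: exI[of _ i])
      ultimately have "xs ! i \<in> set (tl (rotate j xs))" "\<not> xs ! i < d" by auto
      then show "rotate j xs \<notin> Z" unfolding Z_def by blast
    qed
    also have "\<dots> \<le> iid_prob n \<mu> {xs. lsum xs = -1}"
      by (rule iid_prob_mono) (auto simp: Z_def)
    finally show ?case by simp
  qed
qed

text \<open>Every bridge has a rotation that is an excursion, so the union bound over rotations
  cancels the factor n.\<close>

lemma excursion_lower_bound:
  "\<forall>\<^sub>F n in sequentially. p (\<beta> n) / 64 \<le> iid_prob n \<mu> excursions"
  using bridge_lower_bound eventually_gt_at_top[of 0]
proof eventually_elim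
  case (elim n)
  have "iid_prob n \<mu> {xs. lsum xs = -1} \<le> iid_prob n \<mu> {xs. \<exists>i<n. rotate i xs \<in> excursions}"
    by (rule iid_prob_mono) (use excursion_rotation_exists in auto)
  also have "\<dots> \<le> real n * iid_prob n \<mu> excursions" by (rule iid_prob_some_rotation_le)
  finally have "real n * (p (\<beta> n) / 64) \<le> real n * iid_prob n \<mu> excursions"
    using elim(1) by (simp only: times_divide_eq_right)
  then show ?case by (rule mult_left_le_imp_le) (use elim in simp)
qed

text \<open>
  Typical excursions are cyclic shifts of one big jump followed by a walk close to a line, so any
  event avoiding those is negligible.
\<close>

theorem condensation:
  assumes \<eta>: "\<eta> > 0"
    and bad: "\<forall>\<^sub>F n in sequentially. \<forall>k zs i. length zs = n - 1 \<longrightarrow> near_line (B n) n \<eta> zs \<longrightarrow>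
      lsum (k # zs) = -1 \<longrightarrow> i < n \<longrightarrow> rotate i (k # zs) \<in> excursions \<longrightarrow> rotate i (k # zs) \<notin> Bad n"
  shows "(\<lambda>n. iid_prob n \<mu> (excursions \<inter> Bad n) / iid_prob n \<mu> excursions) \<longlonglongrightarrow> 0"
proof (rule tendstoI)
  fix e :: real assume e: "e > 0"
  \<comment> \<open>Relative to the lower bound \<open>p (\<beta> n) / 64\<close>, each of the two
    error terms may use half of e, that is e/128.\<close>
  define \<delta> where "\<delta> = min 1 (e / (128 * (10 ^ 7 + 1)))"
  have \<delta>: "0 < \<delta>" "\<delta> \<le> 1" using e by (auto simp: \<delta>_def)
  have "\<delta> \<le> e / (128 * (10 ^ 7 + 1))" by (simp add: \<delta>_def)
  then have \<delta>e: "(10 ^ 7 + 1) * \<delta> \<le> e / 128" by simp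
  \<comment> \<open>\<open>C\<close> bounds p x relative to \<open>p (\<beta> n)\<close> for every
    letter at least \<open>D\<close>. It depends on \<open>\<delta>\<close>, so the law of large
    numbers is invoked only afterwards, with tolerance e / (128 C).\<close>
  define C where "C = 8 * (2 / \<delta>) ^ 3"
  have "1 \<le> 2 / \<delta>" using \<delta> by simp
  then have "1 \<le> (2 / \<delta>) ^ 3" by (rule one_le_power)
  then have C: "C \<ge> 8" "C > 0" using \<delta> by (simp_all add: C_def)
  have "\<forall>\<^sub>F n in sequentially. iid_prob (n - 1) \<mu> {zs. \<not> near_line (B n) n \<eta> zs} < e / (128 * C)"
    by (rule order_tendstoD(2)[OF maximal_law_of_large_numbers[OF \<eta>]]) (use e C in simp)
  then show "\<forall>\<^sub>F n in sequentially. dist (iid_prob n \<mu> (excursions \<inter> Bad n) / iid_prob n \<mu> excursions) 0 < e"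
    using bad no_big_jump_negligible[OF \<delta>] excursion_lower_bound
      eventually_\<beta>_ge[of "nat \<lceil>2 * real A0 / \<delta>\<rceil>"] eventually_\<beta>_ge[of A0] eventually_gt_at_top[of 0]
  proof eventually_elim
    case (elim n)
    define m where "m = n - 1"
    have nm: "n = Suc m" using elim by (simp add: m_def)
    have p\<beta>: "p (\<beta> n) > 0" using p_pos elim by simp
    obtain D where D: "\<delta> / 2 * real (\<beta> n) \<le> real D" "D \<le> \<beta> n"
      "iid_prob n \<mu> {xs. lsum xs = -1 \<and> (\<forall>x\<in>set xs. x < D)} \<le> (10 ^ 7 + 1) * \<delta> * (real n * p (\<beta> n))"
      using elim(3) by blast
    have "2 * real A0 / \<delta> < real (\<beta> n)" using elim(5) by linarith
    then have "2 * real A0 < \<delta> * real (\<beta> n)" using \<delta> by (simp add: pos_divide_less_eq mult.commute)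
    then have DA: "A0 \<le> D" using D(1) by linarith
    define Z where "Z = {xs. xs \<noteq> [] \<and> D \<le> hd xs \<and> lsum xs = -1 \<and> \<not> near_line (B n) n \<eta> (tl xs)}"
    \<comment> \<open>Uniqueness of the rotation is essential: the union bound goes in the opposite
      direction.\<close>
    have "real n * iid_prob n \<mu> (excursions \<inter> Bad n) = iid_prob n \<mu> {xs. \<exists>i<n. rotate i xs \<in> excursions \<inter> Bad n}"
      by (rule iid_prob_some_rotation_eq[symmetric]) (use excursion_rotation_unique in blast)
    also have "\<dots> \<le> iid_prob n \<mu> ({xs. lsum xs = -1 \<and> (\<forall>x\<in>set xs. x < D)} \<union> {xs. \<exists>i<n. rotate i xs \<in> Z})"
    proof (rule iid_prob_mono)
      fix xs :: "nat list" assume len: "length xs = n" and "xs \<in> {xs. \<exists>i<n. rotate i xs \<in> excursions \<inter> Bad n}"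
      then obtain i where i: "i < n" "rotate i xs \<in> excursions" "rotate i xs \<in> Bad n" by blast
      have s: "lsum xs = -1" using i(2) by (simp add: excursions_def)
      show "xs \<in> {xs. lsum xs = -1 \<and> (\<forall>x\<in>set xs. x < D)} \<union> {xs. \<exists>i<n. rotate i xs \<in> Z}"
      proof (cases "\<forall>x\<in>set xs. x < D")
        case False
        then obtain x where x: "x \<in> set xs" "D \<le> x" by (auto simp: not_less)
        \<comment> \<open>Bringing a letter at least \<open>D\<close> to the front exhibits the
          excursion as a rotation of a word k # zs, the form in which \<open>bad\<close> is
          stated.\<close>
        then obtain j where j: "j < length xs" "hd (rotate j xs) = x" using rotate_to_front[OF x(1)] by blast
        obtain l where l: "l < length xs" "rotate i xs = rotate l (rotate j xs)"
          using rotate_rotate_ex[OF i(1)[folded len] j(1)] by blast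
        have "rotate j xs \<noteq> []" using j(1) by fastforce
        then obtain k zs where kz: "rotate j xs = k # zs" by (meson list.exhaust)
        have "length (rotate j xs) = n" using len by simp
        then have lz: "length zs = n - 1" unfolding kz by simp
        have "lsum (rotate j xs) = -1" using s by simp
        then have ls: "lsum (k # zs) = -1" unfolding kz .
        have "rotate l (k # zs) \<in> excursions" "rotate l (k # zs) \<in> Bad n"
          using i(2,3) unfolding l(2) kz by this+
        then have "\<not> near_line (B n) n \<eta> zs"
          using elim(2)[rule_format, OF lz _ ls l(1)[unfolded len]] by blast
        moreover have "D \<le> k" using j(2) x(2) unfolding kz by simp
        ultimately have "rotate j xs \<in> Z" using ls unfolding kz Z_def by simp
        then show ?thesis using j(1) unfolding len by blast
      qed (use s in auto)
    qed
    also have "\<dots> \<le> iid_prob n \<mu> {xs. lsum xs = -1 \<and> (\<forall>x\<in>set xs. x < D)} + iid_prob n \<mu> {xs. \<exists>i<n. rotate i xs \<in> Z}"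
      by (rule measure_Un_le) auto
    also have "iid_prob n \<mu> {xs. \<exists>i<n. rotate i xs \<in> Z} \<le> real n * iid_prob n \<mu> Z"
      by (rule iid_prob_some_rotation_le)
    finally have 1: "real n * iid_prob n \<mu> (excursions \<inter> Bad n) \<le>
       iid_prob n \<mu> {xs. lsum xs = -1 \<and> (\<forall>x\<in>set xs. x < D)} + real n * iid_prob n \<mu> Z" by simp
    have "iid_prob (Suc m) \<mu> Z \<le> (C * p (\<beta> n)) * iid_prob m \<mu> {zs. \<not> near_line (B n) n \<eta> zs}"
    proof (rule iid_prob_first_le)
      fix x xs assume Z: "x # xs \<in> Z"
      then have x: "D \<le> x" by (simp add: Z_def)
      have "p x \<le> C * p (\<beta> n)"
      proof (cases "x \<le> \<beta> n")
        case True
        have "p x \<le> 8 * (real (\<beta> n) / real x) ^ 3 * p (\<beta> n)" using p_le(1)[of x "\<beta> n"] True x DA by simp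
        also have "\<dots> \<le> C * p (\<beta> n)"
          unfolding C_def
        proof (intro mult_right_mono mult_left_mono power_mono)
          have "real x > 0" using x DA A0(1) by simp
          moreover have "\<delta> / 2 * real (\<beta> n) \<le> real x" using D(1) x by linarith
          ultimately show "real (\<beta> n) / real x \<le> 2 / \<delta>" using \<delta> by (simp add: field_simps)
        qed (use p\<beta> in auto)
        finally show ?thesis .
      next
        case False
        then have "p x \<le> 8 * p (\<beta> n)" using p_le(2)[of "\<beta> n" x] elim by simp
        also have "\<dots> \<le> C * p (\<beta> n)" using C p\<beta> by (intro mult_right_mono) auto
        finally show ?thesis .
      qed
      then show "pmf \<mu> x \<le> C * p (\<beta> n)" by (simp add: p_def)
      show "xs \<in> {zs. \<not> near_line (B n) n \<eta> zs}" using Z by (simp add: Z_def)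
      fix x' assume "x' # xs \<in> Z"
      then show "x = x'" using Z by (auto simp: Z_def)
    qed (use C p\<beta> in simp)
    then have "iid_prob n \<mu> Z \<le> (C * p (\<beta> n)) * iid_prob m \<mu> {zs. \<not> near_line (B n) n \<eta> zs}"
      by (simp only: nm[symmetric])
    also have "\<dots> < C * p (\<beta> n) * (e / (128 * C))"
      using elim(1) C p\<beta> by (intro mult_strict_left_mono) (auto simp: m_def)
    also have "\<dots> = e / 128 * p (\<beta> n)" using C by simp
    finally have "real n * iid_prob n \<mu> Z < real n * (e / 128 * p (\<beta> n))"
      using elim by (intro mult_strict_left_mono) auto
    moreover have "(10 ^ 7 + 1) * \<delta> * (real n * p (\<beta> n)) \<le> e / 128 * (real n * p (\<beta> n))"
      using \<delta>e p\<beta> by (intro mult_right_mono) auto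
    moreover have "real n * (e / 128 * p (\<beta> n)) + e / 128 * (real n * p (\<beta> n)) = real n * (e * (p (\<beta> n) / 64))"
      by (simp add: algebra_simps)
    ultimately have "real n * iid_prob n \<mu> (excursions \<inter> Bad n) < real n * (e * (p (\<beta> n) / 64))"
      using 1 D(3) by linarith
    then have "iid_prob n \<mu> (excursions \<inter> Bad n) < e * (p (\<beta> n) / 64)"
      by (rule mult_left_less_imp_less) simp
    also have "\<dots> \<le> e * iid_prob n \<mu> excursions" using elim(4) e by (intro mult_left_mono) auto
    finally have "iid_prob n \<mu> (excursions \<inter> Bad n) < e * iid_prob n \<mu> excursions" .
    moreover have "iid_prob n \<mu> excursions > 0" using elim(4) p\<beta> by linarith
    ultimately show ?case by (simp add: pos_divide_less_eq)
  qed
qed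

end

section \<open>Plane trees as excursions\<close>

primrec child_counts :: "plane_tree \<Rightarrow> nat list" where
  "child_counts (Node ts) = length ts # concat (map child_counts ts)"

lemma num_children_preorder: "map (num_children \<tau>) (preorder \<tau>) = child_counts \<tau>"
proof (induction \<tau> rule: preorder.induct)
  case (1 ts)
  have "map (num_children (Node ts)) (map (Cons i) (preorder (ts ! i))) = child_counts (ts ! i)"
    if "i < length ts" for i
    using 1[of i] that by (auto simp: num_children_def o_def)
  then have "map (\<lambda>i. map (num_children (Node ts)) (map (Cons i) (preorder (ts ! i)))) [0..<length ts] =
      map (\<lambda>i. child_counts (ts ! i)) [0..<length ts]" by (intro map_cong) auto
  also have "\<dots> = map child_counts ts" by (rule nth_equalityI) auto
  finally show ?case by (simp add: map_concat o_def num_children_def)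
qed

lemma distinct_preorder: "distinct (preorder \<tau>)"
  using sorted_preorder[of \<tau>] strict_sorted_iff by blast

lemma num_vertices_eq: "num_vertices \<tau> = length (child_counts \<tau>)"
proof -
  have "num_vertices \<tau> = length (preorder \<tau>)"
    using distinct_card[OF distinct_preorder, of \<tau>] by (simp add: num_vertices_def set_preorder)
  then show ?thesis by (metis length_map num_children_preorder)
qed

lemma prod_vertices_eq:
  "(\<Prod>u\<in>vertices \<tau>. pmf \<mu> (num_children \<tau> u)) = prod_list (map (pmf \<mu>) (child_counts \<tau>))"
  using prod.distinct_set_conv_list[OF distinct_preorder, of "\<lambda>u. pmf \<mu> (num_children \<tau> u)" \<tau>]
  by (simp add: set_preorder o_def flip: num_children_preorder)

lemma luk_nat_eq: "i \<le> length (child_counts \<tau>) \<Longrightarrow> luk_nat \<tau> i = lsum (take i (child_counts \<tau>))"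
proof (induction i)
  case (Suc i)
  then have i: "i < length (preorder \<tau>)" by (metis Suc_le_eq length_map num_children_preorder)
  have "dfs_vertex \<tau> i = preorder \<tau> ! i" by (simp add: dfs_vertex_def sorted_list_of_vertices)
  then have "num_children \<tau> (dfs_vertex \<tau> i) = child_counts \<tau> ! i"
    using i by (simp flip: num_children_preorder)
  moreover have "take (Suc i) (child_counts \<tau>) = take i (child_counts \<tau>) @ [child_counts \<tau> ! i]"
    using Suc.prems by (simp add: take_Suc_conv_app_nth)
  ultimately show ?case using Suc by (simp add: num_vertices_eq)
qed simp

text \<open>The code of a forest of m trees first brings the walk to -m at its very end, each tree
  lowering it by one; the root contributes a preceding step m - 1.\<close>

lemma child_counts_excursion: "child_counts \<tau> \<in> excursions"
proof (induction \<tau>)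
  case (Node ts)
  have "lsum (concat (map child_counts ts)) = - int (length ts) \<and>
    (\<forall>i<length (concat (map child_counts ts)). 1 - int (length ts) \<le> lsum (take i (concat (map child_counts ts))))"
    using Node
  proof (induction ts)
    case (Cons t ts)
    define c r where "c = child_counts t" and "r = concat (map child_counts ts)"
    have c: "lsum c = -1" "\<forall>i<length c. 0 \<le> lsum (take i c)"
      using Cons.prems[of t] by (auto simp: excursions_def c_def)
    have r: "lsum r = - int (length ts)" "\<forall>i<length r. 1 - int (length ts) \<le> lsum (take i r)"
      using Cons.IH Cons.prems by (auto simp: r_def)
    have "1 - int (length (t # ts)) \<le> lsum (take i (c @ r))" if i: "i < length (c @ r)" for i
    proof (cases "i < length c")
      case True
      then show ?thesis using c(2)[rule_format, of i] by simp
    next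
      case False
      then have "i - length c < length r" using i by simp
      then show ?thesis using c(1) r(2)[rule_format, of "i - length c"] False by simp
    qed
    then show ?case using c(1) r(1) by (simp add: c_def r_def)
  qed simp
  then have f: "lsum (concat (map child_counts ts)) = - int (length ts)"
    "\<And>i. i < length (concat (map child_counts ts)) \<Longrightarrow> 1 - int (length ts) \<le> lsum (take i (concat (map child_counts ts)))"
    by auto
  have "0 \<le> lsum (take i (child_counts (Node ts)))" if "i < length (child_counts (Node ts))" for i
  proof (cases i)
    case (Suc j)
    then show ?thesis using f(2)[of j] that by simp
  qed simp
  then show ?case using f(1) unfolding excursions_def by simp
qed

text \<open>\<open>m\<close> counts the trees still to be read. A letter k replaces the current tree
  by its k children, so the rest codes m - 1 + k trees, the first k of which become these
  children.\<close>

lemma ex_forest_of_counts: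
  assumes "lsum xs = - int m" "\<And>i. i < length xs \<Longrightarrow> 1 - int m \<le> lsum (take i xs)"
  shows "\<exists>ts. length ts = m \<and> concat (map child_counts ts) = xs"
  using assms
proof (induction xs arbitrary: m)
  case Nil
  then show ?case by (intro exI[of _ "[]"]) simp
next
  case (Cons k ys)
  have m: "m \<ge> 1" using Cons.prems(2)[of 0] by simp
  have "\<exists>ts. length ts = m - 1 + k \<and> concat (map child_counts ts) = ys"
  proof (rule Cons.IH)
    show "lsum ys = - int (m - 1 + k)" using Cons.prems(1) m by simp
    fix i assume "i < length ys"
    then show "1 - int (m - 1 + k) \<le> lsum (take i ys)" using Cons.prems(2)[of "Suc i"] m by simp
  qed
  then obtain ts where ts: "length ts = m - 1 + k" "concat (map child_counts ts) = ys" by blast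
  have "concat (map child_counts (take k ts)) @ concat (map child_counts (drop k ts)) = ys"
    using ts(2) by (metis append_take_drop_id concat_append map_append)
  then show ?case using ts(1) m
    by (intro exI[of _ "Node (take k ts) # drop k ts"]) (auto simp: min_def)
qed

text \<open>The codes form a prefix code. The remainders allow the concatenated codes of siblings to
  be cut off one after another.\<close>

lemma child_counts_append_inject:
  "child_counts t @ r = child_counts t' @ r' \<Longrightarrow> t = t' \<and> r = r'"
proof (induction t arbitrary: t' r r')
  case (Node ts)
  obtain ts' where t': "t' = Node ts'" by (cases t')
  have len: "length ts = length ts'"
    and eq: "concat (map child_counts ts) @ r = concat (map child_counts ts') @ r'"
    using Node.prems by (auto simp: t')
  from len eq Node.IH have "ts = ts' \<and> r = r'"
  proof (induction ts ts' rule: list_induct2)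
    case (Cons x xs y ys)
    have "x = y \<and> concat (map child_counts xs) @ r = concat (map child_counts ys) @ r'"
      by (rule Cons.prems(2)) (use Cons.prems(1) in auto)
    then show ?case using Cons.IH Cons.prems(2) by auto
  qed simp
  then show ?case by (simp add: t')
qed

lemma child_counts_bij: "bij_betw child_counts UNIV excursions"
  unfolding bij_betw_def
proof
  show "inj child_counts"
    by (rule injI) (use child_counts_append_inject[of _ "[]" _ "[]"] in simp)
  show "range child_counts = excursions"
  proof (intro equalityI subsetI)
    fix xs assume xs: "xs \<in> excursions"
    then obtain ts where "length ts = 1" "concat (map child_counts ts) = xs"
      using ex_forest_of_counts[of xs 1] by (auto simp: excursions_def)
    then show "xs \<in> range child_counts" by (auto simp: length_Suc_conv)
  qed (use child_counts_excursion in auto)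
qed

text \<open>The weight of a tree is the probability of its code as a random word, and trees with n
  vertices correspond to excursions of length n.\<close>

lemma emeasure_bgw:
  "emeasure (bgw \<mu>) {\<tau>. num_vertices \<tau> = n \<and> child_counts \<tau> \<in> C} = emeasure (replicate_pmf n \<mu>) (excursions \<inter> C)"
proof -
  define A where "A = {\<tau>. num_vertices \<tau> = n \<and> child_counts \<tau> \<in> C}"
  have "bij_betw child_counts A (child_counts ` A)"
    using child_counts_bij by (meson bij_betw_def bij_betw_imageI inj_on_subset subset_UNIV)
  also have "child_counts ` A = {xs \<in> excursions \<inter> C. length xs = n}"
  proof (intro equalityI subsetI)
    fix xs assume "xs \<in> {xs \<in> excursions \<inter> C. length xs = n}"
    moreover from this obtain \<tau> where "xs = child_counts \<tau>"
      using child_counts_bij unfolding bij_betw_def by blast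
    ultimately show "xs \<in> child_counts ` A" by (auto simp: A_def num_vertices_eq)
  qed (auto simp: A_def num_vertices_eq child_counts_excursion)
  finally have bij: "bij_betw child_counts A {xs \<in> excursions \<inter> C. length xs = n}" .
  have "emeasure (bgw \<mu>) A = (\<integral>\<^sup>+\<tau>. ennreal (prod_list (map (pmf \<mu>) (child_counts \<tau>))) * indicator A \<tau> \<partial>count_space UNIV)"
    unfolding bgw_def by (subst emeasure_density) (auto simp: prod_vertices_eq)
  also have "\<dots> = (\<integral>\<^sup>+\<tau>. ennreal (prod_list (map (pmf \<mu>) (child_counts \<tau>))) \<partial>count_space A)"
    by (subst nn_integral_count_space_indicator) auto
  also have "\<dots> = (\<integral>\<^sup>+\<tau>. ennreal (pmf (replicate_pmf n \<mu>) (child_counts \<tau>)) \<partial>count_space A)"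
    by (intro nn_integral_cong) (auto simp: A_def num_vertices_eq pmf_replicate_pmf)
  also have "\<dots> = (\<integral>\<^sup>+xs. ennreal (pmf (replicate_pmf n \<mu>) xs) \<partial>count_space {xs \<in> excursions \<inter> C. length xs = n})"
    by (rule nn_integral_bij_count_space[OF bij])
  also have "\<dots> = emeasure (replicate_pmf n \<mu>) {xs \<in> excursions \<inter> C. length xs = n}"
    by (rule nn_integral_pmf)
  also have "\<dots> = emeasure (replicate_pmf n \<mu>) (excursions \<inter> C)"
    unfolding measure_pmf.emeasure_eq_measure by (intro arg_cong[of _ _ ennreal] iid_prob_cong) auto
  finally show ?thesis by (simp add: A_def)
qed

lemma space_bgw [simp]: "space (bgw \<mu>) = UNIV" and sets_bgw [simp]: "sets (bgw \<mu>) = UNIV"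
  by (simp_all add: bgw_def)

lemma
  assumes "iid_prob n \<mu> excursions > 0"
  shows prob_space_bgw_cond: "prob_space (bgw_cond \<mu> n)"
    and measure_bgw_cond: "measure (bgw_cond \<mu> n) {\<tau>. child_counts \<tau> \<in> C} =
      iid_prob n \<mu> (excursions \<inter> C) / iid_prob n \<mu> excursions"
proof -
  have A: "emeasure (bgw \<mu>) {\<tau>. num_vertices \<tau> = n} = ennreal (iid_prob n \<mu> excursions)"
    using emeasure_bgw[of \<mu> n UNIV] by (simp add: measure_pmf.emeasure_eq_measure)
  show "prob_space (bgw_cond \<mu> n)"
    unfolding bgw_cond_def by (rule prob_space_uniform_measure) (use A assms in auto)
  have AC: "{\<tau>. num_vertices \<tau> = n} \<inter> {\<tau>. child_counts \<tau> \<in> C} = {\<tau>. num_vertices \<tau> = n \<and> child_counts \<tau> \<in> C}"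
    by auto
  show "measure (bgw_cond \<mu> n) {\<tau>. child_counts \<tau> \<in> C} =
      iid_prob n \<mu> (excursions \<inter> C) / iid_prob n \<mu> excursions"
    unfolding bgw_cond_def
    by (subst measure_uniform_measure)
      (use A assms in \<open>auto simp: AC measure_def emeasure_bgw\<close>)
qed

section \<open>Convergence in the Skorokhod space\<close>

text \<open>The piecewise linear map sending [-1, s] onto [-1, 0] and [s, 1] onto [0, 1]; its slope
  increases at s, so it is a maximum of two affine functions. It aligns a jump at s with the jump of
  the limit at 0.\<close>

lemma ex_time_change_shift:
  fixes s :: real
  assumes s: "0 < s" "s < 1"
  shows "\<exists>l\<in>time_changes (-1) 1. \<forall>t\<in>{-1..1}. t - s \<le> l t \<and> l t \<le> t \<and> (l t < 0 \<longleftrightarrow> t < s)"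
proof
  define l where "l = (\<lambda>t. max ((t - s) / (1 + s)) ((t - s) / (1 - s)))"
  have lo: "l t = (t - s) / (1 + s)" if "t < s" for t
  proof -
    have "(t - s) / (1 - s) \<le> (t - s) / (1 + s)" using that s by (intro divide_left_mono_neg) auto
    then show ?thesis by (simp add: l_def)
  qed
  have hi: "l t = (t - s) / (1 - s)" if "s \<le> t" for t
  proof -
    have "(t - s) / (1 + s) \<le> (t - s) / (1 - s)" using that s by (intro divide_left_mono) auto
    then show ?thesis by (simp add: l_def)
  qed
  have mono: "l t < l u" if "t < u" for t u
  proof -
    have "(t - s) / (1 + s) < (u - s) / (1 + s)" "(t - s) / (1 - s) < (u - s) / (1 - s)"
      using that s by (auto intro!: divide_strict_right_mono)
    then show ?thesis unfolding l_def by linarith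
  qed
  have cont: "continuous_on {-1..1} l" unfolding l_def using s by (intro continuous_intros) auto
  have "(- 1 - s) / (1 + s) = - 1" using s by (simp add: divide_eq_eq)
  then have ends: "l (-1) = -1" "l 1 = 1" using lo[of "-1"] hi[of 1] s by auto
  have "l ` {-1..1} = {-1..1}"
  proof (intro equalityI subsetI)
    fix y assume "y \<in> l ` {-1..1}"
    then obtain t where t: "t \<in> {-1..1}" "y = l t" by blast
    have "l (-1) \<le> l t" "l t \<le> l 1"
      using mono[of "-1" t] mono[of t 1] t(1) by (cases "t = -1"; cases "t = 1"; auto)+
    then show "y \<in> {-1..1}" using ends t by auto
  next
    fix y :: real assume y: "y \<in> {-1..1}"
    have "\<exists>t\<ge>-1. t \<le> 1 \<and> l t = y" by (rule IVT') (use y ends cont in auto)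
    then show "y \<in> l ` {-1..1}" by auto
  qed
  then show "l \<in> time_changes (-1) 1"
    using mono cont by (auto simp: time_changes_def strict_mono_on_def)
  show "\<forall>t\<in>{-1..1}. t - s \<le> l t \<and> l t \<le> t \<and> (l t < 0 \<longleftrightarrow> t < s)"
  proof
    fix t :: real assume t: "t \<in> {-1..1}"
    show "t - s \<le> l t \<and> l t \<le> t \<and> (l t < 0 \<longleftrightarrow> t < s)"
    proof (cases "t < s")
      case True
      have "(t - s) * (1 + s) \<le> (t - s) * 1" using True s by (intro mult_left_mono_neg) auto
      moreover have "s * (-1) \<le> s * t" using s t by (intro mult_left_mono) auto
      then have "t - s \<le> t * (1 + s)" by (simp add: algebra_simps)
      ultimately show ?thesis using True s lo[OF True]
        by (simp add: pos_le_divide_eq pos_divide_le_eq pos_divide_less_eq)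
    next
      case False
      have "(t - s) * (1 - s) \<le> (t - s) * 1" using False s by (intro mult_left_mono) auto
      moreover have "s * t \<le> s * 1" using s t by (intro mult_left_mono) auto
      then have "t - s \<le> t * (1 - s)" by (simp add: algebra_simps)
      ultimately show ?thesis using False s hi[of t]
        by (simp add: pos_le_divide_eq pos_divide_le_eq pos_divide_less_eq)
    qed
  qed
qed

text \<open>The letter k has index m in the rotated word. Before it the path follows the descending
  line, and nonnegativity just before the jump keeps that descent within the error, so m is small.
  After it the path follows the line from b down to 0; the extra 1 comes from the total -1.\<close>

lemma one_jump_excursion:
  assumes n: "n > 0" "length zs = n - 1" "i < n" and b: "b > 0" and near: "near_line b n \<eta> zs"
    and total: "lsum (k # zs) = -1" and exc: "rotate i (k # zs) \<in> excursions"
  defines "W \<equiv> \<lambda>l. real_of_int (lsum (take l (rotate i (k # zs))))"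
  shows "\<exists>m<n. real m \<le> 2 * \<eta> * real n \<and> (\<forall>l\<le>m. \<bar>W l\<bar> \<le> 4 * \<eta> * b) \<and>
    (\<forall>l. m < l \<and> l \<le> n \<longrightarrow> \<bar>W l - b * (1 - real l / real n)\<bar> \<le> 2 * \<eta> * b + 1)"
proof -
  define xs where "xs = k # zs"
  have len: "length xs = n" using n by (simp add: xs_def)
  \<comment> \<open>Rotation by 0 is read as rotation by n, so that the letter k has index n - q in
    every case.\<close>
  define q where "q = (if i = 0 then n else i)"
  have q: "1 \<le> q" "q \<le> n" using n by (auto simp: q_def)
  have rot: "rotate i xs = rotate q xs" using len by (auto simp: q_def)
  define S where "S = (\<lambda>j. real_of_int (lsum (take j zs)))"
  have take_xs: "real_of_int (lsum (take (Suc j) xs)) = real k - 1 + S j" for j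
    by (simp add: xs_def S_def)
  define m where "m = n - q"
  have m: "m < n" "n - q = m" "q = n - m" using q n by (auto simp: m_def)
  define r where "r = (\<lambda>j. S j + real j * b / real n)"
  have r: "\<bar>r j\<bar> \<le> \<eta> * b" if "j \<le> n - 1" for j
    using near that n by (simp add: near_line_def r_def S_def)
  have S: "S j = r j - real j * b / real n" for j by (simp add: r_def)
  have W: "W l = (if l \<le> m then S (q - 1 + l) - S (q - 1) else - 1 - S (q - 1) + S (l - m - 1))" if "l \<le> n" for l
  proof -
    have eq: "lsum (take l (rotate q xs)) = (if l \<le> m then lsum (take (q + l) xs) - lsum (take q xs)
      else lsum xs - lsum (take q xs) + lsum (take (l - m) xs))"
      using lsum_take_rotate[of q xs l] q that len m by simp
    have q1: "Suc (q - 1) = q" using q by simp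
    show ?thesis
    proof (cases "l \<le> m")
      case True
      then show ?thesis
        using take_xs[of "q - 1"] take_xs[of "q - 1 + l"] q q1 by (simp add: W_def rot eq flip: xs_def)
    next
      case False
      then have "Suc (l - m - 1) = l - m" by simp
      then show ?thesis
        using False take_xs[of "q - 1"] take_xs[of "l - m - 1"] q1 total
        by (simp add: W_def rot eq flip: xs_def)
    qed
  qed
  have np: "real n > 0" using n by simp
  have rq: "\<bar>r (q - 1)\<bar> \<le> \<eta> * b" by (rule r) (use q in simp)
  have pre: "W l = r (q - 1 + l) - r (q - 1) - real l * b / real n" "\<bar>r (q - 1 + l)\<bar> \<le> \<eta> * b" if "l \<le> m" for l
  proof -
    show "\<bar>r (q - 1 + l)\<bar> \<le> \<eta> * b" by (rule r) (use q that m in simp)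
    have "W l = S (q - 1 + l) - S (q - 1)" using W[of l] that m by simp
    also have "\<dots> = r (q - 1 + l) - r (q - 1) - real l * b / real n"
      unfolding S by (simp add: add_divide_distrib distrib_right)
    finally show "W l = r (q - 1 + l) - r (q - 1) - real l * b / real n" .
  qed
  have "0 \<le> W m" using exc m len by (simp add: excursions_def W_def xs_def)
  then have mb: "real m * b / real n \<le> 2 * \<eta> * b" using pre[of m] rq by linarith
  then have "real m / real n * b \<le> 2 * \<eta> * b" by simp
  then have "real m / real n \<le> 2 * \<eta>" using b by (simp only: mult_le_cancel_right_pos)
  then have m\<eta>: "real m \<le> 2 * \<eta> * real n" using np by (simp add: pos_divide_le_eq)
  have "\<bar>W l\<bar> \<le> 4 * \<eta> * b" if l: "l \<le> m" for l
  proof -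
    have "real l * b / real n \<le> real m * b / real n" using l b by (intro divide_right_mono mult_right_mono) auto
    moreover have "0 \<le> real l * b / real n" using b by simp
    ultimately show ?thesis using pre[OF l] rq mb by linarith
  qed
  moreover have "\<bar>W l - b * (1 - real l / real n)\<bar> \<le> 2 * \<eta> * b + 1" if l: "m < l" "l \<le> n" for l
  proof -
    have rl: "\<bar>r (l - m - 1)\<bar> \<le> \<eta> * b" by (rule r) (use l in simp)
    have "W l = - 1 - S (q - 1) + S (l - m - 1)" using W[of l] l by simp
    also have "\<dots> = - 1 - r (q - 1) + r (l - m - 1) + (real (q - 1) - real (l - m - 1)) * b / real n"
      unfolding S by (simp add: diff_divide_distrib left_diff_distrib)
    also have "real (q - 1) - real (l - m - 1) = real n - real l" using q l m by simp
    also have "(real n - real l) * b / real n = b * (1 - real l / real n)" using np by (simp add: field_simps)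
    finally show ?thesis using rl rq by linarith
  qed
  ultimately show ?thesis using m\<eta> m(1) by blast
qed

text \<open>The bound adds up d in space, (m + 1)/n for the shift of time and 1/n for rounding time
  to the grid.\<close>

lemma skorokhod_dist_luk_process_le:
  assumes n: "length (child_counts \<tau>) = n" "n > 0" and b: "b > 0" and m: "real m + 1 < real n"
    and pre: "\<And>l. l \<le> m \<Longrightarrow> \<bar>real_of_int (lsum (take l (child_counts \<tau>)))\<bar> \<le> d * b"
    and post: "\<And>l. m < l \<Longrightarrow> l \<le> n \<Longrightarrow>
      \<bar>real_of_int (lsum (take l (child_counts \<tau>))) - b * (1 - real l / real n)\<bar> \<le> d * b"
  shows "skorokhod_dist (-1) 1 (luk_process b n \<tau>) limit_process \<le> d + (real m + 2) / real n"
proof -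
  have np: "real n > 0" using n by simp
  \<comment> \<open>The step with index \<open>m\<close> has first been made at time (m + 1)/n; that
    is where the rescaled path jumps.\<close>
  define s where "s = (real m + 1) / real n"
  have s: "0 < s" "s < 1" using np m by (auto simp: s_def)
  obtain l where l: "l \<in> time_changes (-1) 1"
    "\<And>t. t \<in> {-1..1} \<Longrightarrow> t - s \<le> l t \<and> l t \<le> t \<and> (l t < 0 \<longleftrightarrow> t < s)"
    using ex_time_change_shift[OF s] by blast
  have lI: "l t \<in> {-1..1}" if "t \<in> {-1..1}" for t using l(1) that by (auto simp: time_changes_def)
  have "0 \<le> d * b" using pre[of 0] by simp
  then have d: "0 \<le> d" using b by (simp add: zero_le_mult_iff)
  have ms: "(real m + 2) / real n = s + 1 / real n" by (simp add: s_def add_divide_distrib)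
  define e where "e = d + (real m + 2) / real n"
  have "0 < 1 / real n" using np by simp
  then have e: "0 < e" "s \<le> e" "d \<le> e" "d + 1 / real n + s \<le> e"
    using d s(1) unfolding e_def ms by linarith+
  have "\<bar>l t - t\<bar> \<le> e \<and> \<bar>luk_process b n \<tau> t - limit_process (l t)\<bar> \<le> e" if t: "t \<in> {-1..1}" for t
  proof
    show "\<bar>l t - t\<bar> \<le> e" using l(2)[OF t] e by auto
    show "\<bar>luk_process b n \<tau> t - limit_process (l t)\<bar> \<le> e"
    proof (cases "t < s")
      case True
      then have lim: "limit_process (l t) = 0" using l(2)[OF t] lI[OF t] by (simp add: limit_process_def)
      show ?thesis
      proof (cases "t < 0")
        case True
        then have "real n * t < 0" using np by (simp add: mult_pos_neg)
        then show ?thesis using lim t e by (simp add: luk_process_def luk_def)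
      next
        case False
        define j where "j = nat \<lfloor>real n * t\<rfloor>"
        have nt: "0 \<le> real n * t" using False by simp
        moreover have "real n * t < real m + 1" using True np by (simp add: s_def pos_less_divide_eq mult.commute)
        ultimately have j: "\<lfloor>real n * t\<rfloor> = int j" "j \<le> m" unfolding j_def by linarith+
        have "luk_process b n \<tau> t = real_of_int (lsum (take j (child_counts \<tau>))) / b"
          using j t n m nt luk_nat_eq[of j \<tau>] by (simp add: luk_process_def luk_def)
        moreover have "\<bar>real_of_int (lsum (take j (child_counts \<tau>))) / b\<bar> \<le> d"
          using pre[OF j(2)] b by (simp add: abs_divide pos_divide_le_eq)
        ultimately show ?thesis using lim e by simp
      qed
    next
      case False
      then have t0: "0 \<le> t" "s \<le> t" using s by auto
      have "0 \<le> l t" using l(2)[OF t] False by auto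
      then have lim: "limit_process (l t) = 1 - l t" using lI[OF t] by (simp add: limit_process_def)
      define j where "j = nat \<lfloor>real n * t\<rfloor>"
      have "real m + 1 \<le> real n * t" using t0 np by (simp add: s_def pos_divide_le_eq mult.commute)
      moreover have "real n * t \<le> real n * 1" using t by (intro mult_left_mono) auto
      ultimately have j: "\<lfloor>real n * t\<rfloor> = int j" "m < j" "j \<le> n" "real j \<le> real n * t" "real n * t < real j + 1"
        unfolding j_def by linarith+
      have "luk_process b n \<tau> t = real_of_int (lsum (take j (child_counts \<tau>))) / b"
        using j t n luk_nat_eq[of j \<tau>] by (simp add: luk_process_def luk_def)
      moreover have "\<bar>real_of_int (lsum (take j (child_counts \<tau>))) / b - (1 - real j / real n)\<bar> \<le> d"
      proof -
        have "real_of_int (lsum (take j (child_counts \<tau>))) / b - (1 - real j / real n) =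
          (real_of_int (lsum (take j (child_counts \<tau>))) - b * (1 - real j / real n)) / b"
          using b by (simp add: diff_divide_distrib)
        then show ?thesis using post[OF j(2,3)] b by (simp add: abs_divide pos_divide_le_eq)
      qed
      moreover have "real j / real n \<le> t" "t < real j / real n + 1 / real n"
        using j(4,5) np by (auto simp: pos_divide_le_eq mult.commute pos_less_divide_eq simp flip: add_divide_distrib)
      moreover have "t - s \<le> l t" "l t \<le> t" using l(2)[OF t] by auto
      ultimately show ?thesis using lim e by linarith
    qed
  qed
  then have "e \<in> skorokhod_bounds (-1) 1 (luk_process b n \<tau>) limit_process"
    using e l(1) unfolding skorokhod_bounds_def by blast
  then show ?thesis
    by (simp add: skorokhod_dist_eq luk_process_cadlag limit_process_cadlag cInf_lower skorokhod_bounds_bdd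
        flip: e_def)
qed

context cauchy_scaling
begin

lemma eventually_excursion_positive: "\<forall>\<^sub>F n in sequentially. 0 < iid_prob n \<mu> excursions"
  using excursion_lower_bound eventually_\<beta>_ge[of A0]
proof eventually_elim
  case (elim n)
  then show ?case using p_pos[of "\<beta> n"] by linarith
qed

lemma skorokhod_distance_to_limit:
  assumes e: "e > 0"
  shows "(\<lambda>n. measure (bgw_cond \<mu> n) {\<tau>. e < skorokhod_dist (-1) 1 (luk_process (B n) n \<tau>) limit_process}) \<longlonglongrightarrow> 0"
proof -
  \<comment> \<open>Space and time errors will be at most \<open>4 * \<eta>\<close> each, and
    \<open>16 * \<eta> \<le> 1\<close> also ensures m + 1 < n.\<close>
  define \<eta> where "\<eta> = min e 1 / 16"
  have \<eta>: "\<eta> > 0" "16 * \<eta> \<le> e" "16 * \<eta> \<le> 1" using e by (auto simp: \<eta>_def)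
  define D where "D = (\<lambda>n. {\<tau>. e < skorokhod_dist (-1) 1 (luk_process (B n) n \<tau>) limit_process})"
  \<comment> \<open>Since \<open>child_counts\<close> is injective, a tree lies in
    \<open>D n\<close> exactly when its code lies in this image.\<close>
  define Bad where "Bad = (\<lambda>n. child_counts ` D n)"
  have inj: "inj child_counts" using child_counts_bij by (simp add: bij_betw_def)
  have D: "D n = {\<tau>. child_counts \<tau> \<in> Bad n}" for n
    using inj by (auto simp: Bad_def inj_image_mem_iff)
  have "\<forall>\<^sub>F n in sequentially. 1 / B n < \<eta>"
    by (rule order_tendstoD(2)[of _ 0])
      (use tendsto_divide_0[OF tendsto_const filterlim_at_top_imp_at_infinity[OF B_at_top]] \<eta> in auto)
  moreover have "\<forall>\<^sub>F n in sequentially. 1 / real n < \<eta>"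
    by (rule order_tendstoD(2)[OF lim_1_over_n]) (use \<eta> in auto)
  ultimately have "\<forall>\<^sub>F n in sequentially. \<forall>k zs i. length zs = n - 1 \<longrightarrow> near_line (B n) n \<eta> zs \<longrightarrow>
      lsum (k # zs) = -1 \<longrightarrow> i < n \<longrightarrow> rotate i (k # zs) \<in> excursions \<longrightarrow> rotate i (k # zs) \<notin> Bad n"
    using \<beta>_bounds eventually_gt_at_top[of 0]
  proof eventually_elim
    case (elim n)
    have Bp: "B n > 0" using elim by simp
    have np: "real n > 0" using elim by simp
    have B1: "1 \<le> \<eta> * B n" using elim(1) Bp by (simp add: pos_divide_less_eq)
    show ?case
    proof (intro allI impI notI)
      fix k zs i
      assume A: "length zs = n - 1" "near_line (B n) n \<eta> zs" "lsum (k # zs) = -1" "i < n"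
        "rotate i (k # zs) \<in> excursions" "rotate i (k # zs) \<in> Bad n"
      obtain \<tau> where \<tau>: "rotate i (k # zs) = child_counts \<tau>" "\<tau> \<in> D n" using A(6) by (auto simp: Bad_def)
      have len: "length (child_counts \<tau>) = n" using A(1) elim by (simp flip: \<tau>(1))
      obtain m where m: "m < n" "real m \<le> 2 * \<eta> * real n"
        "\<forall>l\<le>m. \<bar>real_of_int (lsum (take l (child_counts \<tau>)))\<bar> \<le> 4 * \<eta> * B n"
        "\<forall>l. m < l \<and> l \<le> n \<longrightarrow> \<bar>real_of_int (lsum (take l (child_counts \<tau>))) - B n * (1 - real l / real n)\<bar> \<le> 2 * \<eta> * B n + 1"
        using one_jump_excursion[OF elim(4) A(1,4) Bp A(2,3,5)] unfolding \<tau>(1) by blast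
      have n1: "1 \<le> \<eta> * real n" using elim(2) np by (simp add: pos_divide_less_eq)
      have "real m + 2 \<le> 4 * \<eta> * real n" using m(2) n1 by linarith
      moreover have "4 * \<eta> * real n < 1 * real n" using \<eta> np by (intro mult_strict_right_mono) auto
      ultimately have m1: "real m + 1 < real n" by linarith
      have "skorokhod_dist (-1) 1 (luk_process (B n) n \<tau>) limit_process \<le> 4 * \<eta> + (real m + 2) / real n"
      proof (rule skorokhod_dist_luk_process_le[OF len elim(4) Bp m1])
        fix l assume "m < l" "l \<le> n"
        then have "\<bar>real_of_int (lsum (take l (child_counts \<tau>))) - B n * (1 - real l / real n)\<bar> \<le> 2 * \<eta> * B n + 1"
          using m(4) by blast
        also have "\<dots> \<le> 4 * \<eta> * B n" using B1 by linarith
        finally show "\<bar>real_of_int (lsum (take l (child_counts \<tau>))) - B n * (1 - real l / real n)\<bar> \<le> 4 * \<eta> * B n" .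
      qed (use m(3) in blast)
      also have "(real m + 2) / real n \<le> 4 * \<eta>"
        using \<open>real m + 2 \<le> 4 * \<eta> * real n\<close> np by (simp add: pos_divide_le_eq)
      also have "4 * \<eta> + 4 * \<eta> \<le> e" using \<eta> by linarith
      finally show False using \<tau>(2) by (simp add: D_def)
    qed
  qed
  from condensation[OF \<eta>(1) this]
  have "(\<lambda>n. iid_prob n \<mu> (excursions \<inter> Bad n) / iid_prob n \<mu> excursions) \<longlonglongrightarrow> 0" .
  then have "(\<lambda>n. measure (bgw_cond \<mu> n) (D n)) \<longlonglongrightarrow> 0"
    by (rule Lim_transform_eventually)
      (use eventually_excursion_positive in eventually_elim, simp add: D measure_bgw_cond)
  then show ?thesis by (simp add: D_def)
qed

end

section \<open>Weak convergence to a deterministic limit and the conclusion\<close>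

lemma borel_measurable_continuous_map:
  assumes "continuous_map X euclideanreal F"
  shows "F \<in> borel_measurable (borel_of_topology X)"
proof (rule borel_measurableI)
  fix S :: "real set" assume "open S"
  then have "openin X {x \<in> topspace X. F x \<in> S}"
    using openin_continuous_map_preimage[OF assms, of S] by simp
  moreover have "F -` S \<inter> space (borel_of_topology X) = {x \<in> topspace X. F x \<in> S}" by auto
  moreover have "sets (borel_of_topology X) = sigma_sets (topspace X) {U. openin X U}"
    unfolding borel_of_topology_def by (rule sets_measure_of) (auto dest: openin_subset)
  ultimately show "F -` S \<inter> space (borel_of_topology X) \<in> sets (borel_of_topology X)" by auto
qed

text \<open>Convergence in probability to a constant: near \<open>c\<close> the integrand is within
  e/2 of \<open>F c\<close>, and elsewhere it differs by at most 2K on an event of vanishing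
  probability. \<open>prob\<close> is only eventual because the conditioning event may be null for
  small n.\<close>

lemma weak_conv_on_return:
  assumes X: "Metric_space S d" "X = Metric_space.mtopology S d" and c: "c \<in> S"
    and meas: "\<And>n. f n \<in> P n \<rightarrow>\<^sub>M borel_of_topology X"
    and prob: "\<forall>\<^sub>F n in sequentially. prob_space (P n)"
    and sets: "\<And>n e. {\<omega> \<in> space (P n). e < d (f n \<omega>) c} \<in> sets (P n)"
    and conv: "\<And>e. e > 0 \<Longrightarrow> (\<lambda>n. measure (P n) {\<omega> \<in> space (P n). e < d (f n \<omega>) c}) \<longlonglongrightarrow> 0"
  shows "weak_conv_on X (\<lambda>n. distr (P n) (borel_of_topology X) (f n)) (return (borel_of_topology X) c)"
  unfolding weak_conv_on_def
proof (intro allI impI, elim conjE)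
  fix F assume F: "continuous_map X euclideanreal F" and bdd: "bounded (F ` topspace X)"
  interpret Metric_space S d by (rule X(1))
  have top: "topspace X = S" by (simp add: X(2))
  have Fm: "F \<in> borel_measurable (borel_of_topology X)" by (rule borel_measurable_continuous_map[OF F])
  obtain K where K: "\<And>x. x \<in> S \<Longrightarrow> \<bar>F x\<bar> \<le> K" using bdd by (auto simp: bounded_iff top)
  have K0: "0 \<le> K" using K[OF c] by linarith
  have ret: "integral\<^sup>L (return (borel_of_topology X) c) F = F c"
    by (rule integral_return) (use c top Fm in auto)
  show "(\<lambda>n. integral\<^sup>L (distr (P n) (borel_of_topology X) (f n)) F) \<longlonglongrightarrow> integral\<^sup>L (return (borel_of_topology X) c) F"
    unfolding ret
  proof (rule tendstoI)
    fix e :: real assume e: "e > 0"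
    have "openin X {x \<in> topspace X. F x \<in> ball (F c) (e/2)}"
      using openin_continuous_map_preimage[OF F, of "ball (F c) (e/2)"] by simp
    moreover have "c \<in> {x \<in> topspace X. F x \<in> ball (F c) (e/2)}" using c top e by simp
    ultimately obtain r where r: "r > 0" "mball c r \<subseteq> {x \<in> topspace X. F x \<in> ball (F c) (e/2)}"
      unfolding X(2) openin_mtopology by blast
    have near: "\<bar>F x - F c\<bar> < e/2" if "x \<in> S" "\<not> r/2 < d x c" for x
    proof -
      have "x \<in> mball c r" using that c r(1) commute[of x c] by auto
      then have "F x \<in> ball (F c) (e/2)" using r(2) by blast
      then show ?thesis by (simp add: dist_real_def abs_minus_commute)
    qed
    have "\<forall>\<^sub>F n in sequentially. measure (P n) {\<omega> \<in> space (P n). r/2 < d (f n \<omega>) c} < e / (4 * (K + 1))"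
      by (rule order_tendstoD(2)[OF conv]) (use r e K0 in auto)
    then show "\<forall>\<^sub>F n in sequentially. dist (integral\<^sup>L (distr (P n) (borel_of_topology X) (f n)) F) (F c) < e"
      using prob
    proof eventually_elim
      case (elim n)
      interpret prob_space "P n" by (rule elim(2))
      define D where "D = {\<omega> \<in> space (P n). r/2 < d (f n \<omega>) c}"
      have Dm: "D \<in> sets (P n)" unfolding D_def by (rule sets)
      have fS: "f n \<omega> \<in> S" if "\<omega> \<in> space (P n)" for \<omega>
        using measurable_space[OF meas that] by (simp add: top)
      have Ffm: "(\<lambda>\<omega>. F (f n \<omega>)) \<in> borel_measurable (P n)" by (rule measurable_compose[OF meas Fm])
      have int: "integrable (P n) (\<lambda>\<omega>. F (f n \<omega>))"
        using K fS by (intro integrable_const_bound[OF _ Ffm, of K]) auto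
      have "\<bar>(\<integral>\<omega>. F (f n \<omega>) \<partial>P n) - F c\<bar> = \<bar>\<integral>\<omega>. F (f n \<omega>) - F c \<partial>P n\<bar>"
        using int by (simp add: prob_space)
      also have "\<dots> \<le> (\<integral>\<omega>. \<bar>F (f n \<omega>) - F c\<bar> \<partial>P n)" by (rule integral_abs_bound)
      also have "\<dots> \<le> (\<integral>\<omega>. e/2 + 2 * K * indicator D \<omega> \<partial>P n)"
      proof (rule integral_mono)
        show "integrable (P n) (\<lambda>\<omega>. \<bar>F (f n \<omega>) - F c\<bar>)" using int by auto
        show "integrable (P n) (\<lambda>\<omega>. e/2 + 2 * K * indicator D \<omega>)" using Dm by (auto simp: less_top[symmetric])
        fix \<omega> assume \<omega>: "\<omega> \<in> space (P n)"
        show "\<bar>F (f n \<omega>) - F c\<bar> \<le> e/2 + 2 * K * indicator D \<omega>"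
        proof (cases "\<omega> \<in> D")
          case True
          then show ?thesis using K[OF fS[OF \<omega>]] K[OF c] e by auto
        next
          case False
          then show ?thesis using near[OF fS[OF \<omega>]] \<omega> by (simp add: D_def less_imp_le)
        qed
      qed
      also have "\<dots> = e/2 + 2 * K * prob D" using Dm by (simp add: prob_space less_top[symmetric])
      \<comment> \<open>Passing to K + 1 keeps the next inequality strict when K = 0.\<close>
      also have "2 * K * prob D \<le> 2 * (K + 1) * prob D" by (intro mult_right_mono) auto
      also have "\<dots> < 2 * (K + 1) * (e / (4 * (K + 1)))"
        using elim(1) K0 unfolding D_def by (intro mult_strict_left_mono) auto
      also have "\<dots> = e/2" using K0 by (simp add: field_simps)
      finally have "\<bar>(\<integral>\<omega>. F (f n \<omega>) \<partial>P n) - F c\<bar> < e" by simp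
      then show ?case by (simp add: integral_distr[OF meas Fm] dist_real_def)
    qed
  qed
qed

theorem proposition24:
  fixes L :: "real \<Rightarrow> real" and \<mu> :: "nat pmf" and a b :: "nat \<Rightarrow> real"
  assumes L: "slowly_varying L"
    and mean: "(\<lambda>i. real i * pmf \<mu> i) sums 1"
    and tail: "(\<lambda>n. pmf \<mu> n) \<sim>[sequentially] (\<lambda>n. L (real n) / real n ^ 2)"
    and a: "(\<lambda>n. real n * measure_pmf.prob (step_pmf \<mu>) {x. real_of_int x \<ge> a n}) \<longlonglongrightarrow> 1"
    and b: "\<And>n. n \<ge> 1 \<Longrightarrow> b n = real n * measure_pmf.expectation (step_pmf \<mu>)
              (\<lambda>x. real_of_int x * indicator {x. \<bar>real_of_int x\<bar> \<le> a n} x)"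
  shows "weak_conv_on (skorokhod_J1 (-1) 1)
           (\<lambda>n. distr (bgw_cond \<mu> n) (borel_of_topology (skorokhod_J1 (-1) 1))
                  (luk_process \<bar>b n\<bar> n))
           (return (borel_of_topology (skorokhod_J1 (-1) 1)) limit_process)"
proof -
  define p w T g Q where "p = pmf \<mu>" and "w = (\<lambda>k. p k * real k ^ 2)"
    and "T = (\<lambda>y. 1 - (\<Sum>k<y. p k))" and "g = (\<lambda>y. \<Sum>k<y. (1 - real k) * p k)"
    and "Q = (\<lambda>y. \<Sum>k<y. (real k - 1) ^ 2 * p k)"
  note defs = p_def w_def T_def g_def Q_def
  note weights = weight_regularity[OF L _ tail, OF pmf_nonneg]
  interpret off: cauchy_offspring \<mu> p w T g Q
    by unfold_locales (use mean weights in \<open>simp_all add: defs\<close>)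
  define \<alpha> where "\<alpha> = (\<lambda>n. nat \<lfloor>a n\<rfloor> + 2)"
  define B where "B = (\<lambda>n. real n * g (\<alpha> n))"
  define \<beta> where "\<beta> = (\<lambda>n. nat \<lceil>B n\<rceil>)"
  have step: "measure_pmf.prob (step_pmf \<mu>) {x. real_of_int x \<ge> r} = measure_pmf.prob \<mu> {k. r \<le> real k - 1}" for r
    by (simp add: step_pmf_def vimage_def)
  have a_le: "\<forall>\<^sub>F n in sequentially. real n * measure_pmf.prob \<mu> {k. a n \<le> real k - 1} < 2"
    using order_tendstoD(2)[OF a, of 2] by (simp add: step)
  have a_ge: "\<forall>\<^sub>F n in sequentially. 1 / 2 < real n * measure_pmf.prob \<mu> {k. a n \<le> real k - 1}"
    using order_tendstoD(1)[OF a, of "1/2"] by (simp add: step)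
  \<comment> \<open>If a_n were at most K, the event X >= a_n would contain a fixed letter k with
    \<open>p k > 0\<close>, and n times its probability would be at least 2 once n >= 2 / p
    k.\<close>
  have a_large: "\<forall>\<^sub>F n in sequentially. real K < a n" for K
  proof -
    define k where "k = max off.A0 (K + 1)"
    have pk: "p k > 0" using off.p_pos[of k] by (simp add: k_def)
    obtain N :: nat where N: "2 / p k \<le> real N" using real_arch_simple by blast
    show ?thesis using a_le eventually_ge_at_top[of N]
    proof eventually_elim
      case (elim n)
      show ?case
      proof (rule ccontr)
        assume "\<not> real K < a n"
        then have "{k} \<subseteq> {k. a n \<le> real k - 1}" by (auto simp: k_def)
        then have "measure_pmf.prob \<mu> {k} \<le> measure_pmf.prob \<mu> {k. a n \<le> real k - 1}"
          by (rule measure_pmf.finite_measure_mono) simp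
        then have "real n * p k \<le> real n * measure_pmf.prob \<mu> {k. a n \<le> real k - 1}"
          by (intro mult_left_mono) (auto simp: p_def pmf.rep_eq)
        moreover have "2 \<le> real n * p k"
        proof -
          have "2 / p k \<le> real n" using N elim(2) by linarith
          then show ?thesis using pk by (simp add: pos_divide_le_eq)
        qed
        ultimately show False using elim(1) by linarith
      qed
    qed
  qed
  have \<alpha>_lim: "filterlim \<alpha> at_top sequentially"
    unfolding filterlim_at_top
  proof
    fix Z show "\<forall>\<^sub>F n in sequentially. Z \<le> \<alpha> n"
      using a_large[of Z] unfolding \<alpha>_def by eventually_elim linarith
  qed
  \<comment> \<open>As a_n need not be an integer, the event X >= a_n lies between k >=
    \<open>\<alpha> n\<close> and k >= \<open>\<alpha> n - 1\<close>: the upper bound is obtained at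
    the former level, the lower bound at the latter.\<close>
  have T_le_2: "\<forall>\<^sub>F n in sequentially. real n * T (\<alpha> n) \<le> 2"
    using a_le a_large[of 1]
  proof eventually_elim
    case (elim n)
    have "T (\<alpha> n) \<le> measure_pmf.prob \<mu> {k. a n \<le> real k - 1}"
      unfolding off.T_eq_prob
    proof (rule measure_pmf.finite_measure_mono)
      show "{\<alpha> n..} \<subseteq> {k. a n \<le> real k - 1}" using elim(2) unfolding \<alpha>_def by (auto; linarith)
    qed simp
    then have "real n * T (\<alpha> n) \<le> real n * measure_pmf.prob \<mu> {k. a n \<le> real k - 1}"
      by (rule mult_left_mono) simp
    then show ?case using elim by linarith
  qed
  have T_ge_half: "\<forall>\<^sub>F n in sequentially. 1 / 2 \<le> real n * T (\<alpha> n - 1)"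
    using a_ge a_large[of 1]
  proof eventually_elim
    case (elim n)
    have "measure_pmf.prob \<mu> {k. a n \<le> real k - 1} \<le> T (\<alpha> n - 1)"
      unfolding off.T_eq_prob
    proof (rule measure_pmf.finite_measure_mono)
      show "{k. a n \<le> real k - 1} \<subseteq> {\<alpha> n - 1..}" using elim(2) unfolding \<alpha>_def by (auto; linarith)
    qed simp
    then have "real n * measure_pmf.prob \<mu> {k. a n \<le> real k - 1} \<le> real n * T (\<alpha> n - 1)"
      by (rule mult_left_mono) simp
    then show ?case using elim by linarith
  qed
  interpret cauchy_scaling \<mu> p w T g Q \<alpha> B \<beta>
    by unfold_locales (use \<alpha>_lim T_le_2 T_ge_half in \<open>simp_all add: B_def \<beta>_def defs\<close>)
  have bB: "\<forall>\<^sub>F n in sequentially. \<bar>b n\<bar> = B n"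
    using a_large[of 1] eventually_ge_at_top[of 1]
  proof eventually_elim
    case (elim n)
    \<comment> \<open>The letter 0 has |X| = 1, so it is inside the truncation only because a_n
      exceeds 1.\<close>
    have range: "\<bar>real k - 1\<bar> \<le> a n \<longleftrightarrow> k < \<alpha> n" for k
      using elim(1) unfolding \<alpha>_def by linarith
    have "measure_pmf.expectation (step_pmf \<mu>) (\<lambda>x. real_of_int x * indicator {x. \<bar>real_of_int x\<bar> \<le> a n} x) =
      measure_pmf.expectation \<mu> (\<lambda>k. (real k - 1) * indicator {..<\<alpha> n} k)"
      unfolding step_pmf_def by (subst integral_map_pmf) (auto simp: indicator_def range intro!: Bochner_Integration.integral_cong)
    also have "\<dots> = (\<Sum>k<\<alpha> n. (real k - 1) * indicator {..<\<alpha> n} k * pmf \<mu> k)"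
      by (rule integral_measure_pmf_real) (auto simp: indicator_def split: if_splits)
    also have "\<dots> = - g (\<alpha> n)"
      by (auto simp: g_def p_def algebra_simps simp flip: sum_negf intro!: sum.cong)
    finally have "b n = - B n" using b[OF elim(2)] by (simp add: B_def)
    moreover have "B n \<ge> 0" using off.g_nonneg[of "\<alpha> n"] by (simp add: B_def \<alpha>_def)
    ultimately show ?case by simp
  qed
  show ?thesis
  proof (rule weak_conv_on_return[OF Metric_space_skorokhod _ limit_process_cadlag])
    show "\<forall>\<^sub>F n in sequentially. prob_space (bgw_cond \<mu> n)"
      using eventually_excursion_positive by eventually_elim (rule prob_space_bgw_cond)
    have bgw: "sets (bgw_cond \<mu> n) = UNIV" "space (bgw_cond \<mu> n) = UNIV" for n
      by (simp_all add: bgw_cond_def)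
    show "{\<omega> \<in> space (bgw_cond \<mu> n). e < skorokhod_dist (- 1) 1 (luk_process \<bar>b n\<bar> n \<omega>) limit_process}
       \<in> sets (bgw_cond \<mu> n)" for n e by (simp add: bgw)
    fix e :: real assume "e > 0"
    from skorokhod_distance_to_limit[OF this]
    show "(\<lambda>n. measure (bgw_cond \<mu> n) {\<omega> \<in> space (bgw_cond \<mu> n).
        e < skorokhod_dist (- 1) 1 (luk_process \<bar>b n\<bar> n \<omega>) limit_process}) \<longlonglongrightarrow> 0"
      by (rule Lim_transform_eventually) (use bB in eventually_elim, simp add: bgw)
  qed (simp_all add: skorokhod_J1_def measurable_luk_process[unfolded skorokhod_J1_def])
qed

end
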